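(* Let $N\ge2$ and $-\infty<x_1<\dots<x_N<\infty$. Let $U\in\mathcal C^2(\mathbb R)$ be such that $U'$ is Lipschitz continuous, i.e. there is a constant $L_U$ with $|U''(x)|\le L_U$ for all $x\in\mathbb R$, let $\alpha\ge1$, and let $V'(x)=-x/|x|^{\alpha+1}$ for $x\ne0$. Consider the stochastic differential equation $$dX^i_t=\sqrt{2\sigma_N}\,dB^i_t-U'(X^i_t)\,dt-\frac1N\sum_{j\ne i}V'(X^i_t-X^j_t)\,dt,\qquad i=1,\dots,N,\quad(\ast)$$ where $B^1,\dots,B^N$ are independent Brownian motions. (i) If $\alpha>1$, then for any $\sigma_N\ge0$ there exists a unique strong solution $X=(X^1,\dots,X^N)$ to $(\ast)$ with initial condition $X^1_0=x_1,\dots,X^N_0=x_N$, which furthermore satisfies $X_t\in\mathcal O_N$ for all $t\ge0$, $\mathbb P$-a.s. (ii) The same result holds for $\alpha=1$ and $\sigma_N\le\frac1N$.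
   Context: $\mathcal O_N=\{(x_1,\dots,x_N)\in\mathbb R^N:\ -\infty<x_1<\dots<x_N<\infty\}$. The system $(\ast)$ describes $N$ particles on the line with confining potential $U$ and singular repulsive interaction potential $V$, where $V(x)=\frac{1}{\alpha-1}|x|^{-\alpha+1}$ if $\alpha>1$ and $V(x)=-\ln|x|$ if $\alpha=1$; $\sigma_N$ is a diffusion coefficient that may depend on $N$. *)

theory Defs
  imports "HOL-Probability.Probability"
begin

text \<open>
  Particles are indexed by \<open>{..<N}\<close> instead of \<open>1, \<dots>, N\<close>, and a process is a function
  \<open>X i t \<omega>\<close> of the particle, the time and the sample point.  Only the values at \<open>i < N\<close> and
  \<open>0 \<le> t\<close> are ever constrained.
\<close>

definition ordered_configurations :: "nat \<Rightarrow> (nat \<Rightarrow> real) set" where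
  "ordered_configurations N = {x. strict_mono_on {..<N} x}"

definition natural_filtration ::
    "'a measure \<Rightarrow> nat \<Rightarrow> (nat \<Rightarrow> real \<Rightarrow> 'a \<Rightarrow> real) \<Rightarrow> real \<Rightarrow> 'a measure" where
  "natural_filtration M N B t =
     sigma (space M) {B i s -` A \<inter> space M | i s A. i < N \<and> 0 \<le> s \<and> s \<le> t \<and> A \<in> sets borel}"

definition augmentation :: "'a measure \<Rightarrow> (real \<Rightarrow> 'a measure) \<Rightarrow> real \<Rightarrow> 'a measure" where
  "augmentation M F t = sigma (space M) (sets (F t) \<union> null_sets M)"

definition filtered_prob_space :: "'a measure \<Rightarrow> (real \<Rightarrow> 'a measure) \<Rightarrow> bool" where
  "filtered_prob_space M F \<longleftrightarrow>
     prob_space M \<and> filtration (space M) F \<and> (\<forall>t. subalgebra M (F t))"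

definition brownian_motion :: "'a measure \<Rightarrow> (real \<Rightarrow> 'a measure) \<Rightarrow> (real \<Rightarrow> 'a \<Rightarrow> real) \<Rightarrow> bool" where
  "brownian_motion M F W \<longleftrightarrow>
     (\<forall>t\<ge>0. W t \<in> borel_measurable (F t)) \<and>
     (AE \<omega> in M. W 0 \<omega> = 0) \<and>
     (AE \<omega> in M. continuous_on {0..} (\<lambda>t. W t \<omega>)) \<and>
     (\<forall>s t. 0 \<le> s \<and> s < t \<longrightarrow>
        distributed M lborel (\<lambda>\<omega>. W t \<omega> - W s \<omega>) (normal_density 0 (sqrt (t - s))) \<and>
        prob_space.indep_set M (sets (F s))
          (sets (vimage_algebra (space M) (\<lambda>\<omega>. W t \<omega> - W s \<omega>) borel)))"

text \<open>
  The last conjunct says that the vector of increments is independent of the past.  For a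
  filtration larger than the natural one this does not follow from the corresponding property
  of each component.
\<close>

definition independent_brownian_motions ::
    "'a measure \<Rightarrow> (real \<Rightarrow> 'a measure) \<Rightarrow> nat \<Rightarrow> (nat \<Rightarrow> real \<Rightarrow> 'a \<Rightarrow> real) \<Rightarrow> bool" where
  "independent_brownian_motions M F N B \<longleftrightarrow>
     (\<forall>i<N. brownian_motion M F (B i)) \<and>
     prob_space.indep_vars M (\<lambda>_. Pi\<^sub>M {0..} (\<lambda>_. borel)) (\<lambda>i \<omega>. \<lambda>t\<in>{0..}. B i t \<omega>) {..<N} \<and>
     (\<forall>s t. 0 \<le> s \<and> s < t \<longrightarrow>
        prob_space.indep_set M (sets (F s))
          (sets (vimage_algebra (space M) (\<lambda>\<omega>. \<lambda>i\<in>{..<N}. B i t \<omega> - B i s \<omega>)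
            (Pi\<^sub>M {..<N} (\<lambda>_. borel)))))"

text \<open>
  The function \<open>V'\<close>.  It is only meaningful for \<open>x \<noteq> 0\<close>; its value at \<open>0\<close> is never used, since
  the equation below is only required to hold for processes without collisions at almost every time.
\<close>

definition interaction_deriv :: "real \<Rightarrow> real \<Rightarrow> real" where
  "interaction_deriv \<alpha> x = - x / \<bar>x\<bar> powr (\<alpha> + 1)"

definition drift :: "nat \<Rightarrow> (real \<Rightarrow> real) \<Rightarrow> real \<Rightarrow> (nat \<Rightarrow> real) \<Rightarrow> nat \<Rightarrow> real" where
  "drift N U' \<alpha> y i =
     - U' (y i) - (1 / real N) * (\<Sum>j\<in>{..<N} - {i}. interaction_deriv \<alpha> (y i - y j))"

text \<open>
  As the noise is additive, the stochastic differential equation is the pathwise integral equation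
  below.  The solution is not required to be ordered, only to have its drift defined at almost
  every time and locally integrable.
\<close>

definition sde_solution ::
    "'a measure \<Rightarrow> (real \<Rightarrow> 'a measure) \<Rightarrow> nat \<Rightarrow> real \<Rightarrow> (real \<Rightarrow> real) \<Rightarrow> real \<Rightarrow>
     (nat \<Rightarrow> real \<Rightarrow> 'a \<Rightarrow> real) \<Rightarrow> (nat \<Rightarrow> real) \<Rightarrow> (nat \<Rightarrow> real \<Rightarrow> 'a \<Rightarrow> real) \<Rightarrow> bool" where
  "sde_solution M F N \<sigma> U' \<alpha> B x X \<longleftrightarrow>
     (\<forall>i<N. \<forall>t\<ge>0. X i t \<in> borel_measurable (F t)) \<and>
     (AE \<omega> in M. \<forall>i<N. continuous_on {0..} (\<lambda>t. X i t \<omega>)) \<and>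
     (AE \<omega> in M. \<forall>i<N. X i 0 \<omega> = x i) \<and>
     (AE \<omega> in M. AE s in lborel. 0 \<le> s \<longrightarrow> inj_on (\<lambda>i. X i s \<omega>) {..<N}) \<and>
     (AE \<omega> in M. \<forall>i<N. \<forall>t\<ge>0.
        set_integrable lborel {0..t} (\<lambda>s. drift N U' \<alpha> (\<lambda>j. X j s \<omega>) i) \<and>
        X i t \<omega> = X i 0 \<omega> + sqrt (2 * \<sigma>) * B i t \<omega>
                  + (LBINT s:{0..t}. drift N U' \<alpha> (\<lambda>j. X j s \<omega>) i))"

definition strong_solution ::
    "'a measure \<Rightarrow> nat \<Rightarrow> real \<Rightarrow> (real \<Rightarrow> real) \<Rightarrow> real \<Rightarrow>
     (nat \<Rightarrow> real \<Rightarrow> 'a \<Rightarrow> real) \<Rightarrow> (nat \<Rightarrow> real) \<Rightarrow> (nat \<Rightarrow> real \<Rightarrow> 'a \<Rightarrow> real) \<Rightarrow> bool" where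
  "strong_solution M N \<sigma> U' \<alpha> B x X \<longleftrightarrow>
     sde_solution M (augmentation M (natural_filtration M N B)) N \<sigma> U' \<alpha> B x X"

text \<open>
  A strong solution that stays ordered exists, and it is pathwise unique: it is indistinguishable
  from every solution on the given filtered probability space.  When \<open>B\<close> is adapted to \<open>F\<close>,
  these include all strong solutions.
\<close>

definition unique_ordered_strong_solution ::
    "'a measure \<Rightarrow> (real \<Rightarrow> 'a measure) \<Rightarrow> nat \<Rightarrow> real \<Rightarrow> (real \<Rightarrow> real) \<Rightarrow> real \<Rightarrow>
     (nat \<Rightarrow> real \<Rightarrow> 'a \<Rightarrow> real) \<Rightarrow> (nat \<Rightarrow> real) \<Rightarrow> bool" where
  "unique_ordered_strong_solution M F N \<sigma> U' \<alpha> B x \<longleftrightarrow>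
     (\<exists>X. strong_solution M N \<sigma> U' \<alpha> B x X \<and>
          (AE \<omega> in M. \<forall>t\<ge>0. (\<lambda>i. X i t \<omega>) \<in> ordered_configurations N) \<and>
          (\<forall>Y. sde_solution M (augmentation M F) N \<sigma> U' \<alpha> B x Y \<longrightarrow>
             (AE \<omega> in M. \<forall>t\<ge>0. \<forall>i<N. Y i t \<omega> = X i t \<omega>)))"

end

theory Submission
  imports Defs
begin

text \<open>
  The noise is additive, so the equation is solved path by path.  Truncating the repulsion at
  distance \<open>\<delta>\<close> gives a Lipschitz integral equation whose solution solves the original one as long
  as all gaps are at least \<open>\<delta>\<close>.  The energy relative to a moving reference configuration with wide
  gaps bounds the particles and the time integral of the repulsion, so an ordered solution has a
  limit at its explosion time \<open>\<tau>\<close>.  If the particles \<open>k, \<dots>, n\<close> are those with a common limit, then just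
  before \<open>\<tau>\<close> the distance \<open>D = X n - X k\<close> satisfies \<open>dD \<ge> dw + (\<kappa> / D - C) dt\<close>, where \<open>w\<close> has variance
  \<open>4 \<sigma> t\<close> and \<open>\<kappa> \<ge> 2 \<sigma>\<close>: this is the regime in which a Bessel process does not reach \<open>0\<close>.

  To prove this without stochastic calculus, the Euler chain of \<open>dZ = dw + (\<kappa> / Z - C) dt\<close> is stopped
  at a level \<open>\<epsilon>\<close>.  By comparison, a collision forces the chain below \<open>\<epsilon>\<close> for all fine meshes.  The
  expectation of \<open>ln z + (C / \<kappa>) z - z\<^sup>2\<close> decreases at most linearly along the chain, so this happens with
  probability at most a constant over \<open>ln (1 / \<epsilon>)\<close>.  Countably many rational data \<open>(q, z)\<close> for the
  start of the chain exhaust all possible collisions.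
\<close>

section \<open>Lipschitz integral equations\<close>

text \<open>The outermost pair \<open>k\<close>, \<open>n\<close> of a cluster is chosen because the
  particles in between push it apart and all others stay at a positive distance. So the drift of
  \<open>D\<close> is bounded below by the two repulsion terms of the pair alone, which sum to 2/N
  times \<open>D powr (- \<alpha>)\<close>, up to a constant. Up to scaling,
  \<open>dD = dw + (\<kappa> / D) dt\<close> is a Bessel process of dimension
  \<open>1 + \<kappa> / (2 * \<sigma>)\<close>, and dimension 2 is critical. For
  \<open>\<alpha> = 1\<close> only \<open>\<kappa> = 2 / N\<close> is available, which gives
  \<open>\<sigma> \<le> 1 / N\<close>; for \<open>\<alpha> > 1\<close> every \<open>\<kappa>\<close>
  is. The obstacle is that \<open>D\<close> is not Markovian and that the cluster and the collision
  time are random. Comparison replaces \<open>D\<close> by a scalar equation started at a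
  deterministic time from a deterministic value. For its Euler chain only the independence of the
  increments from the past and their first three moments matter: a Taylor expansion with cubic
  remainder in each step replaces the Ito formula, and the remainders sum to the order of the square
  root of the mesh.\<close>

text \<open>The path \<open>w\<close> carries the initial value as well as the noise: at time 0 the
  equation forces \<open>X i 0 = w i 0\<close>. As \<open>has_integral\<close> asserts integrability
  too, one predicate serves both the Lipschitz drift and the singular one.\<close>

definition solves ::
    "nat \<Rightarrow> ((nat \<Rightarrow> real) \<Rightarrow> nat \<Rightarrow> real) \<Rightarrow> real \<Rightarrow> (nat \<Rightarrow> real \<Rightarrow> real) \<Rightarrow> (nat \<Rightarrow> real \<Rightarrow> real) \<Rightarrow> bool"
  where
  "solves N b T w X \<longleftrightarrow> (\<forall>i<N. continuous_on {0..T} (X i)) \<and>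
     (\<forall>i<N. \<forall>t\<in>{0..T}. ((\<lambda>s. b (\<lambda>j. X j s) i) has_integral (X i t - w i t)) {0..t})"

text \<open>Configurations are functions on all of \<open>nat\<close>, and the l1 norm is taken over
  the first \<open>N\<close> coordinates only. Two configurations that agree below \<open>N\<close>
  therefore have the same drift below \<open>N\<close>.\<close>

definition sum_lipschitz :: "nat \<Rightarrow> ((nat \<Rightarrow> real) \<Rightarrow> nat \<Rightarrow> real) \<Rightarrow> real \<Rightarrow> bool" where
  "sum_lipschitz N b K \<longleftrightarrow>
     0 \<le> K \<and> (\<forall>y z. (\<Sum>i<N. \<bar>b y i - b z i\<bar>) \<le> K * (\<Sum>i<N. \<bar>y i - z i\<bar>))"

lemma solvesD:
  assumes "solves N b T w X" "i < N"
  shows "continuous_on {0..T} (X i)"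
    "\<And>t. t \<in> {0..T} \<Longrightarrow> ((\<lambda>s. b (\<lambda>j. X j s) i) has_integral (X i t - w i t)) {0..t}"
  using assms unfolding solves_def by auto

lemma solves_subinterval:
  assumes "solves N b T w X" "S \<le> T"
  shows "solves N b S w X"
  using assms unfolding solves_def
  by (auto intro: continuous_on_subset)

lemma solves_cong:
  assumes "solves N b T w X" "\<And>i t. i < N \<Longrightarrow> t \<in> {0..T} \<Longrightarrow> Y i t = X i t"
    and "\<And>i t. i < N \<Longrightarrow> t \<in> {0..T} \<Longrightarrow> c (\<lambda>j. Y j t) i = b (\<lambda>j. X j t) i"
  shows "solves N c T w Y"
  unfolding solves_def
proof (intro conjI allI impI ballI)
  fix i assume i: "i < N"
  show "continuous_on {0..T} (Y i)"
    by (rule continuous_on_eq[OF solvesD(1)[OF assms(1) i]]) (simp add: assms(2)[OF i])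
  fix t assume t: "t \<in> {0..T}"
  have "((\<lambda>s. b (\<lambda>j. X j s) i) has_integral (Y i t - w i t)) {0..t}"
    using solvesD(2)[OF assms(1) i t] assms(2)[OF i t] by simp
  then show "((\<lambda>s. c (\<lambda>j. Y j s) i) has_integral (Y i t - w i t)) {0..t}"
    by (rule has_integral_eq[rotated]) (use t in \<open>simp add: assms(3)[OF i]\<close>)
qed

lemma sum_lipschitzD:
  assumes "sum_lipschitz N b K"
  shows "0 \<le> K" "(\<Sum>i<N. \<bar>b y i - b z i\<bar>) \<le> K * (\<Sum>i<N. \<bar>y i - z i\<bar>)"
  using assms unfolding sum_lipschitz_def by auto

lemma sum_lipschitz_component:
  assumes "sum_lipschitz N b K" "i < N"
  shows "\<bar>b y i - b z i\<bar> \<le> K * (\<Sum>i<N. \<bar>y i - z i\<bar>)"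
proof -
  have "\<bar>b y i - b z i\<bar> \<le> (\<Sum>i<N. \<bar>b y i - b z i\<bar>)"
    using assms(2) by (intro member_le_sum) auto
  also have "\<dots> \<le> K * (\<Sum>i<N. \<bar>y i - z i\<bar>)" by (rule sum_lipschitzD(2)[OF assms(1)])
  finally show ?thesis .
qed

lemma sum_lipschitz_continuous:
  assumes lip: "sum_lipschitz N b K" and i: "i < N" and X: "\<And>j. j < N \<Longrightarrow> continuous_on S (X j)"
  shows "continuous_on S (\<lambda>s. b (\<lambda>j. X j s) i)"
  unfolding continuous_on_def
proof
  fix s0 assume s0: "s0 \<in> S"
  have "((\<lambda>s. K * (\<Sum>j<N. \<bar>X j s - X j s0\<bar>)) \<longlongrightarrow> K * (\<Sum>j<N. \<bar>X j s0 - X j s0\<bar>)) (at s0 within S)"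
    using X s0 unfolding continuous_on_def by (intro tendsto_intros) auto
  then have "((\<lambda>s. K * (\<Sum>j<N. \<bar>X j s - X j s0\<bar>)) \<longlongrightarrow> 0) (at s0 within S)" by simp
  then have "((\<lambda>s. b (\<lambda>j. X j s) i - b (\<lambda>j. X j s0) i) \<longlongrightarrow> 0) (at s0 within S)"
    by (rule Lim_null_comparison[rotated])
      (simp add: sum_lipschitz_component[OF lip i])
  then show "((\<lambda>s. b (\<lambda>j. X j s) i) \<longlongrightarrow> b (\<lambda>j. X j s0) i) (at s0 within S)"
    by (rule LIM_zero_cancel)
qed

section \<open>Gronwall's inequality and uniqueness\<close>

lemma gronwall:
  fixes u :: "real \<Rightarrow> real"
  assumes u: "continuous_on {0..T} u" and bound: "\<And>t. t \<in> {0..T} \<Longrightarrow> u t \<le> A + K * integral {0..t} u"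
    and K: "0 \<le> K" and t: "t \<in> {0..T}"
  shows "u t \<le> A * exp (K * t)"
proof -
  define g where "g s = (A + K * integral {0..s} u) * exp (- (K * s))" for s
  have cont: "continuous_on {0..T} (\<lambda>s. integral {0..s} u)"
    by (intro indefinite_integral_continuous_1 integrable_continuous_real u)
  have "g t \<le> g 0"
  proof (rule DERIV_nonpos_imp_decreasing_open[where f = g and a = 0 and b = t])
    show "0 \<le> t" using t by simp
    show "continuous_on {0..t} g" unfolding g_def
      using t by (intro continuous_intros continuous_on_subset[OF cont]) auto
    fix s assume s: "0 < s" "s < t"
    then have s': "s \<in> {0..T}" using t by auto
    have "((\<lambda>s. integral {0..s} u) has_real_derivative u s) (at s within {0..T})"
      using integral_has_real_derivative[OF u s'] .
    then have d: "((\<lambda>s. integral {0..s} u) has_real_derivative u s) (at s)"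
      using s t by (simp add: at_within_Icc_at)
    have "(g has_real_derivative
        (K * u s) * exp (- (K * s)) + exp (- (K * s)) * (- K) * (A + K * integral {0..s} u)) (at s)"
      unfolding g_def by (auto intro!: derivative_eq_intros d)
    moreover have "(K * u s) * exp (- (K * s)) + exp (- (K * s)) * (- K) * (A + K * integral {0..s} u)
      = K * exp (- (K * s)) * (u s - (A + K * integral {0..s} u))" by (simp add: algebra_simps)
    moreover have "\<dots> \<le> 0"
      using K bound[OF s'] by (intro mult_nonneg_nonpos) auto
    ultimately show "\<exists>y. (g has_real_derivative y) (at s) \<and> y \<le> 0" by metis
  qed
  then have "(A + K * integral {0..t} u) \<le> A * exp (K * t)"
    unfolding g_def by (simp add: exp_minus field_simps)
  then show ?thesis using bound[OF t] by linarith
qed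

lemma solves_increment:
  assumes X: "solves N b T w X" and lip: "sum_lipschitz N b K" and i: "i < N"
    and st: "0 \<le> s" "s \<le> t" "t \<le> T"
  shows "(X i t - w i t) - (X i s - w i s) = integral {s..t} (\<lambda>r. b (\<lambda>j. X j r) i)"
proof -
  have "integral {0..s} (\<lambda>r. b (\<lambda>j. X j r) i) + integral {s..t} (\<lambda>r. b (\<lambda>j. X j r) i)
      = integral {0..t} (\<lambda>r. b (\<lambda>j. X j r) i)"
    using st solvesD(2)[OF X i, of t]
    by (intro Henstock_Kurzweil_Integration.integral_combine) (auto intro: has_integral_integrable)
  then show ?thesis
    using integral_unique[OF solvesD(2)[OF X i, of t]] integral_unique[OF solvesD(2)[OF X i, of s]] st
    by simp
qed

lemma sum_lipschitz_integral_diff: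
  fixes s t :: real
  assumes lip: "sum_lipschitz N b K"
    and X: "\<And>j. j < N \<Longrightarrow> continuous_on {s..t} (X j)" and Y: "\<And>j. j < N \<Longrightarrow> continuous_on {s..t} (Y j)"
  shows "(\<Sum>i<N. \<bar>integral {s..t} (\<lambda>r. b (\<lambda>j. X j r) i) - integral {s..t} (\<lambda>r. b (\<lambda>j. Y j r) i)\<bar>)
    \<le> integral {s..t} (\<lambda>r. K * (\<Sum>i<N. \<bar>X i r - Y i r\<bar>))"
proof -
  note cb = sum_lipschitz_continuous[OF lip _ X] sum_lipschitz_continuous[OF lip _ Y]
  have "(\<Sum>i<N. \<bar>integral {s..t} (\<lambda>r. b (\<lambda>j. X j r) i) - integral {s..t} (\<lambda>r. b (\<lambda>j. Y j r) i)\<bar>)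
      \<le> (\<Sum>i<N. integral {s..t} (\<lambda>r. \<bar>b (\<lambda>j. X j r) i - b (\<lambda>j. Y j r) i\<bar>))"
  proof (rule sum_mono)
    fix i assume "i \<in> {..<N}"
    then have i: "i < N" by simp
    have "norm (integral {s..t} (\<lambda>r. b (\<lambda>j. X j r) i - b (\<lambda>j. Y j r) i))
        \<le> integral {s..t} (\<lambda>r. \<bar>b (\<lambda>j. X j r) i - b (\<lambda>j. Y j r) i\<bar>)"
      by (intro integral_norm_bound_integral integrable_continuous_real continuous_intros cb i) auto
    moreover have "integral {s..t} (\<lambda>r. b (\<lambda>j. X j r) i - b (\<lambda>j. Y j r) i)
        = integral {s..t} (\<lambda>r. b (\<lambda>j. X j r) i) - integral {s..t} (\<lambda>r. b (\<lambda>j. Y j r) i)"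
      by (intro integral_diff integrable_continuous_real cb i)
    ultimately show "\<bar>integral {s..t} (\<lambda>r. b (\<lambda>j. X j r) i) - integral {s..t} (\<lambda>r. b (\<lambda>j. Y j r) i)\<bar>
        \<le> integral {s..t} (\<lambda>r. \<bar>b (\<lambda>j. X j r) i - b (\<lambda>j. Y j r) i\<bar>)" by simp
  qed
  also have "\<dots> = integral {s..t} (\<lambda>r. \<Sum>i<N. \<bar>b (\<lambda>j. X j r) i - b (\<lambda>j. Y j r) i\<bar>)"
    by (intro integral_sum[symmetric] integrable_continuous_real continuous_intros cb) auto
  also have "\<dots> \<le> integral {s..t} (\<lambda>r. K * (\<Sum>i<N. \<bar>X i r - Y i r\<bar>))"
    by (intro integral_le integrable_continuous_real continuous_intros cb X Y sum_lipschitzD(2)[OF lip]) auto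
  finally show ?thesis .
qed

lemma solves_diff_bound:
  assumes X: "solves N b T w X" and Y: "solves N b T w Y" and lip: "sum_lipschitz N b K"
    and t: "t \<in> {0..T}"
  shows "(\<Sum>i<N. \<bar>X i t - Y i t\<bar>) \<le> K * integral {0..t} (\<lambda>s. \<Sum>i<N. \<bar>X i s - Y i s\<bar>)"
proof -
  have "continuous_on {0..t} (X i)" and "continuous_on {0..t} (Y i)" if "i < N" for i
    using solvesD(1)[OF X that] solvesD(1)[OF Y that] t by (auto intro: continuous_on_subset)
  note bound = sum_lipschitz_integral_diff[where b = b, OF lip this]
  have "X i t - Y i t = integral {0..t} (\<lambda>s. b (\<lambda>j. X j s) i) - integral {0..t} (\<lambda>s. b (\<lambda>j. Y j s) i)" if "i < N" for i
    using integral_unique[OF solvesD(2)[OF X that t]] integral_unique[OF solvesD(2)[OF Y that t]] by simp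
  then show ?thesis using bound by simp
qed

lemma solves_unique:
  assumes X: "solves N b T w X" and Y: "solves N b T w Y" and lip: "sum_lipschitz N b K"
    and t: "t \<in> {0..T}" and i: "i < N"
  shows "X i t = Y i t"
proof -
  have "(\<Sum>i<N. \<bar>X i t - Y i t\<bar>) \<le> 0 * exp (K * t)"
  proof (rule gronwall[OF _ _ _ t])
    show "continuous_on {0..T} (\<lambda>t. \<Sum>i<N. \<bar>X i t - Y i t\<bar>)"
      using solvesD(1)[OF X] solvesD(1)[OF Y] by (intro continuous_intros) auto
    show "0 \<le> K" by (rule sum_lipschitzD(1)[OF lip])
  qed (use solves_diff_bound[OF X Y lip] in auto)
  moreover have "\<bar>X i t - Y i t\<bar> \<le> (\<Sum>i<N. \<bar>X i t - Y i t\<bar>)"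
    using i by (intro member_le_sum) auto
  ultimately show ?thesis by simp
qed

section \<open>Existence by Picard iteration\<close>

lemma integral_exp_weight:
  fixes K t :: real
  assumes "0 \<le> t"
  shows "K * integral {0..t} (\<lambda>s. exp (2 * K * s)) \<le> exp (2 * K * t) / 2"
proof -
  have "((\<lambda>s. K * exp (2 * K * s)) has_integral (exp (2 * K * t) / 2 - exp (2 * K * 0) / 2)) {0..t}"
    by (rule fundamental_theorem_of_calculus[OF assms])
      (auto intro!: derivative_eq_intros simp: has_real_derivative_iff_has_vector_derivative[symmetric])
  then have "((\<lambda>s. K * exp (2 * K * s)) has_integral (exp (2 * K * t) / 2 - 1 / 2)) {0..t}" by simp
  then have "integral {0..t} (\<lambda>s. K * exp (2 * K * s)) = exp (2 * K * t) / 2 - 1 / 2"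
    by (rule integral_unique)
  then show ?thesis by simp
qed

primrec picard ::
    "((nat \<Rightarrow> real) \<Rightarrow> nat \<Rightarrow> real) \<Rightarrow> (nat \<Rightarrow> real \<Rightarrow> real) \<Rightarrow> nat \<Rightarrow> nat \<Rightarrow> real \<Rightarrow> real" where
  "picard b w 0 = w"
| "picard b w (Suc m) = (\<lambda>i t. w i t + integral {0..t} (\<lambda>s. b (\<lambda>j. picard b w m j s) i))"

lemma picard_continuous:
  assumes lip: "sum_lipschitz N b K" and w: "\<And>i. i < N \<Longrightarrow> continuous_on {0..T} (w i)"
  shows "i < N \<Longrightarrow> continuous_on {0..T} (picard b w m i)"
proof (induction m arbitrary: i)
  case (Suc m)
  then show ?case
    by (auto intro!: continuous_intros w indefinite_integral_continuous_1 integrable_continuous_real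
        sum_lipschitz_continuous[OF lip])
qed (use w in auto)

lemma picard_step_bound:
  assumes lip: "sum_lipschitz N b K" and w: "\<And>i. i < N \<Longrightarrow> continuous_on {0..T} (w i)"
  obtains A where "0 \<le> A"
    "\<And>m t. t \<in> {0..T} \<Longrightarrow>
       (\<Sum>i<N. \<bar>picard b w (Suc m) i t - picard b w m i t\<bar>) \<le> A * (1/2) ^ m * exp (2 * K * t)"
proof -
  have K: "0 \<le> K" by (rule sum_lipschitzD(1)[OF lip])
  have pc: "continuous_on {0..T} (picard b w m i)" if "i < N" for i m
    by (rule picard_continuous[OF lip w that])
  have "continuous_on {0..T} (\<lambda>t. \<Sum>i<N. \<bar>picard b w (Suc 0) i t - picard b w 0 i t\<bar>)"
    by (intro continuous_intros pc) auto
  then have "bounded ((\<lambda>t. \<Sum>i<N. \<bar>picard b w (Suc 0) i t - picard b w 0 i t\<bar>) ` {0..T})"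
    by (intro compact_imp_bounded compact_continuous_image) auto
  then obtain A where A: "0 < A"
    "\<And>t. t \<in> {0..T} \<Longrightarrow> (\<Sum>i<N. \<bar>picard b w (Suc 0) i t - picard b w 0 i t\<bar>) \<le> A"
    unfolding bounded_pos by (auto simp: abs_le_iff)
  have "(\<Sum>i<N. \<bar>picard b w (Suc m) i t - picard b w m i t\<bar>) \<le> A * (1/2) ^ m * exp (2 * K * t)"
    if "t \<in> {0..T}" for m t
    using that
  proof (induction m arbitrary: t)
    case 0
    have "A * 1 \<le> A * exp (2 * K * t)"
      using A(1) K 0 by (intro mult_left_mono) auto
    then show ?case using A(2)[OF 0] by simp
  next
    case (Suc m)
    let ?u = "picard b w (Suc m)" and ?v = "picard b w m"
    have cu: "continuous_on {0..t} (?u i)" and cv: "continuous_on {0..t} (?v i)" if "i < N" for i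
      using Suc.prems by (auto intro!: continuous_on_subset[OF pc[OF that]] simp del: picard.simps)
    have "(\<Sum>i<N. \<bar>picard b w (Suc (Suc m)) i t - ?u i t\<bar>)
        = (\<Sum>i<N. \<bar>integral {0..t} (\<lambda>s. b (\<lambda>j. ?u j s) i) - integral {0..t} (\<lambda>s. b (\<lambda>j. ?v j s) i)\<bar>)"
      unfolding picard.simps(2)[of b w "Suc m"] by simp
    also have "\<dots> \<le> integral {0..t} (\<lambda>s. K * (\<Sum>i<N. \<bar>?u i s - ?v i s\<bar>))"
      by (rule sum_lipschitz_integral_diff[OF lip cu cv])
    also have "\<dots> \<le> integral {0..t} (\<lambda>s. K * (A * (1/2) ^ m * exp (2 * K * s)))"
      using Suc.prems
      by (intro integral_le integrable_continuous_real continuous_intros cu cv mult_left_mono Suc.IH K) auto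
    also have "\<dots> = A * (1/2) ^ m * (K * integral {0..t} (\<lambda>s. exp (2 * K * s)))"
      by (simp add: mult.assoc mult.left_commute)
    also have "\<dots> \<le> A * (1/2) ^ m * (exp (2 * K * t) / 2)"
      using A(1) Suc.prems by (intro mult_left_mono integral_exp_weight) auto
    finally show ?case by (simp del: picard.simps)
  qed
  then show ?thesis using that[of A] A(1) by auto
qed

lemma solves_exists:
  assumes lip: "sum_lipschitz N b K" and w: "\<And>i. i < N \<Longrightarrow> continuous_on {0..T} (w i)"
  shows "\<exists>X. solves N b T w X"
proof -
  have K: "0 \<le> K" by (rule sum_lipschitzD(1)[OF lip])
  obtain A where A: "0 \<le> A"
    "\<And>m t. t \<in> {0..T} \<Longrightarrow>
       (\<Sum>i<N. \<bar>picard b w (Suc m) i t - picard b w m i t\<bar>) \<le> A * (1/2) ^ m * exp (2 * K * t)"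
    by (rule picard_step_bound[where w = w and T = T, OF lip]) (use w in blast)+
  have pc: "continuous_on {0..T} (picard b w m i)" if "i < N" for i m
    by (rule picard_continuous[OF lip w that])
  define X where "X i t = w i t + (\<Sum>m. picard b w (Suc m) i t - picard b w m i t)" for i t
  have lim: "uniform_limit {0..T} (\<lambda>n. picard b w n i) (X i) sequentially" if i: "i < N" for i
  proof -
    have "uniform_limit {0..T} (\<lambda>n t. \<Sum>m<n. picard b w (Suc m) i t - picard b w m i t)
        (\<lambda>t. \<Sum>m. picard b w (Suc m) i t - picard b w m i t) sequentially"
    proof (rule Weierstrass_m_test)
      show "summable (\<lambda>m. A * exp (2 * K * T) * (1/2) ^ m)"
        by (intro summable_mult summable_geometric) simp
      fix m t assume t: "t \<in> {0..T}"
      have "\<bar>picard b w (Suc m) i t - picard b w m i t\<bar>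
          \<le> (\<Sum>i<N. \<bar>picard b w (Suc m) i t - picard b w m i t\<bar>)"
        using i by (intro member_le_sum) auto
      also have "\<dots> \<le> A * (1/2) ^ m * exp (2 * K * t)" by (rule A(2)[OF t])
      also have "\<dots> \<le> A * (1/2) ^ m * exp (2 * K * T)"
        using t A(1) K by (intro mult_left_mono) (auto intro!: mult_left_mono)
      finally show "norm (picard b w (Suc m) i t - picard b w m i t) \<le> A * exp (2 * K * T) * (1/2) ^ m"
        by (simp del: picard.simps add: mult_ac)
    qed
    moreover have "(\<Sum>m<n. picard b w (Suc m) i t - picard b w m i t) = picard b w n i t - w i t" for n t
      by (subst sum_lessThan_telescope) simp
    ultimately have "uniform_limit {0..T} (\<lambda>n t. w i t + (picard b w n i t - w i t)) (X i) sequentially"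
      unfolding X_def by (intro uniform_limit_add uniform_limit_const) (simp del: picard.simps)
    then show ?thesis by simp
  qed
  have cX: "continuous_on {0..T} (X i)" if "i < N" for i
    by (rule uniform_limit_theorem[OF _ lim[OF that]]) (use pc[OF that] in auto)
  have "((\<lambda>s. b (\<lambda>j. X j s) i) has_integral (X i t - w i t)) {0..t}"
    if i: "i < N" and t: "t \<in> {0..T}" for i t
  proof -
    have "uniform_limit {0..t} (\<lambda>n s. b (\<lambda>j. picard b w n j s) i) (\<lambda>s. b (\<lambda>j. X j s) i) sequentially"
      unfolding uniform_limit_iff
    proof (intro allI impI)
      fix e :: real assume e: "0 < e"
      define d where "d = e / (K * N + 1)"
      have KN: "0 \<le> K * N" using K by simp
      have d: "0 < d" unfolding d_def using e KN by (intro divide_pos_pos) linarith+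
      have "\<forall>j\<in>{..<N}. \<forall>\<^sub>F n in sequentially. \<forall>s\<in>{0..T}. dist (picard b w n j s) (X j s) < d"
        using lim d unfolding uniform_limit_iff by auto
      then have "\<forall>\<^sub>F n in sequentially. \<forall>j\<in>{..<N}. \<forall>s\<in>{0..T}. dist (picard b w n j s) (X j s) < d"
        by (intro eventually_ball_finite) auto
      then show "\<forall>\<^sub>F n in sequentially. \<forall>s\<in>{0..t}. dist (b (\<lambda>j. picard b w n j s) i) (b (\<lambda>j. X j s) i) < e"
      proof (rule eventually_mono, intro ballI)
        fix n s assume h: "\<forall>j\<in>{..<N}. \<forall>s\<in>{0..T}. dist (picard b w n j s) (X j s) < d" and s: "s \<in> {0..t}"
        have "\<bar>b (\<lambda>j. picard b w n j s) i - b (\<lambda>j. X j s) i\<bar> \<le> K * (\<Sum>j<N. \<bar>picard b w n j s - X j s\<bar>)"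
          by (rule sum_lipschitz_component[OF lip i])
        also have "\<dots> \<le> K * (\<Sum>j<N. d)"
          using h s t by (intro mult_left_mono sum_mono K) (auto simp: dist_real_def intro!: less_imp_le)
        also have "\<dots> = (K * N) * d" by simp
        also have "\<dots> < (K * N + 1) * d" using d by simp
        also have "\<dots> = e" unfolding d_def using KN by simp
        finally show "dist (b (\<lambda>j. picard b w n j s) i) (b (\<lambda>j. X j s) i) < e" by (simp add: dist_real_def)
      qed
    qed
    moreover have "continuous_on {0..t} (\<lambda>s. b (\<lambda>j. picard b w n j s) i)" for n
      using t by (intro sum_lipschitz_continuous[OF lip i] continuous_on_subset[OF pc]) auto
    ultimately obtain I J where IJ: "\<And>n. ((\<lambda>s. b (\<lambda>j. picard b w n j s) i) has_integral I n) {0..t}"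
      "((\<lambda>s. b (\<lambda>j. X j s) i) has_integral J) {0..t}" "I \<longlonglongrightarrow> J"
      by (rule uniform_limit_integral) auto
    have "picard b w (Suc n) i t = w i t + I n" for n
      using integral_unique[OF IJ(1)[of n]] by simp
    moreover have "(\<lambda>n. picard b w (Suc n) i t) \<longlonglongrightarrow> X i t"
      using tendsto_uniform_limitI[OF lim[OF i] t] by (rule LIMSEQ_Suc)
    ultimately have "(\<lambda>n. w i t + I n) \<longlonglongrightarrow> X i t" by simp
    moreover have "(\<lambda>n. w i t + I n) \<longlonglongrightarrow> w i t + J" by (intro tendsto_intros IJ(3))
    ultimately have "X i t = w i t + J" by (rule LIMSEQ_unique)
    then show ?thesis using IJ(2) by simp
  qed
  then have "solves N b T w X" unfolding solves_def using cX by blast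
  then show ?thesis by (rule exI[where x = X])
qed

lemma solves_exists_global:
  assumes lip: "sum_lipschitz N b K" and w: "\<And>i. i < N \<Longrightarrow> continuous_on {0..} (w i)"
  obtains X where "\<And>T. solves N b T w X"
proof -
  have "\<exists>X. solves N b T w X" for T
    by (intro solves_exists[OF lip] continuous_on_subset[OF w]) auto
  then obtain Z where Z: "\<And>T. solves N b T w (Z T)" by metis
  \<comment> \<open>The diagonal choice: at time \<open>t\<close> the solution on
    \<open>{0..t}\<close> is read off. By uniqueness it agrees with the solution on every longer
    interval.\<close>
  define X where "X i t = Z t i t" for i t
  have eq: "X i t = Z T i t" if "i < N" "t \<in> {0..T}" for i t T
    unfolding X_def
    by (rule solves_unique[OF Z solves_subinterval[OF Z] lip]) (use that in auto)
  have "solves N b T w X" for T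
  proof (rule solves_cong[OF Z[of T]])
    fix i t assume it: "i < N" "t \<in> {0..T}"
    show "X i t = Z T i t" by (rule eq[OF it])
    \<comment> \<open>The two configurations may differ at indices \<open>j \<ge> N\<close>; the
      Lipschitz bound shows that the drift does not see this.\<close>
    have "\<bar>b (\<lambda>j. X j t) i - b (\<lambda>j. Z T j t) i\<bar> \<le> K * (\<Sum>j<N. \<bar>X j t - Z T j t\<bar>)"
      by (rule sum_lipschitz_component[OF lip it(1)])
    also have "(\<Sum>j<N. \<bar>X j t - Z T j t\<bar>) = 0" using eq[OF _ it(2)] by simp
    finally show "b (\<lambda>j. X j t) i = b (\<lambda>j. Z T j t) i" by simp
  qed
  then show ?thesis by (rule that)
qed

section \<open>Convergence of the Euler scheme\<close>

primrec euler ::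
    "((nat \<Rightarrow> real) \<Rightarrow> nat \<Rightarrow> real) \<Rightarrow> (nat \<Rightarrow> real \<Rightarrow> real) \<Rightarrow> real \<Rightarrow> nat \<Rightarrow> nat \<Rightarrow> real" where
  "euler b w h 0 = (\<lambda>i. w i 0)"
| "euler b w h (Suc k) = (\<lambda>i. euler b w h k i + (w i (real (Suc k) * h) - w i (real k * h))
     + h * b (euler b w h k) i)"

text \<open>The noise increments are exact on the grid, so the only new error in a step comes from
  freezing the drift while \<open>X\<close> varies by at most \<open>e\<close>. Adding
  \<open>e\<close> to the error turns the recursion into a multiplication by
  \<open>1 + h * K\<close>, which is at most \<open>exp (h * K)\<close>.\<close>

lemma euler_error:
  assumes X: "solves N b T w X" and lip: "sum_lipschitz N b K" and h: "0 \<le> h" "real n * h \<le> T"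
    and osc: "\<And>s t. s \<in> {0..T} \<Longrightarrow> t \<in> {0..T} \<Longrightarrow> \<bar>s - t\<bar> \<le> h \<Longrightarrow> (\<Sum>i<N. \<bar>X i s - X i t\<bar>) \<le> e"
  shows "k \<le> n \<Longrightarrow> (\<Sum>i<N. \<bar>euler b w h k i - X i (real k * h)\<bar>) + e \<le> e * exp (K * (real k * h))"
proof (induction k)
  case 0
  have "0 \<le> real n * h" using h(1) by simp
  then have "0 \<in> {0..T}" using h(2) by auto
  then have "X i 0 = w i 0" if "i < N" for i
    using integral_unique[OF solvesD(2)[OF X that, of 0]] by simp
  then show ?case by simp
next
  case (Suc k)
  have K: "0 \<le> K" by (rule sum_lipschitzD(1)[OF lip])
  define s t where "s = real k * h" and "t = real (Suc k) * h"
  let ?E = "euler b w h k"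
  have tT: "t \<le> T" unfolding t_def using Suc.prems h by (meson mult_right_mono of_nat_mono order_trans)
  have st: "0 \<le> s" "s \<le> t" "t - s = h" using h(1) by (auto simp: s_def t_def algebra_simps)
  have c: "continuous_on {s..t} (X j)" if "j < N" for j
    using solvesD(1)[OF X that] tT st by (auto intro: continuous_on_subset)
  define d where "d i = \<bar>integral {s..t} (\<lambda>r. b (\<lambda>j. ?E j) i) - integral {s..t} (\<lambda>r. b (\<lambda>j. X j r) i)\<bar>" for i
  have comp: "\<bar>euler b w h (Suc k) i - X i t\<bar> \<le> \<bar>?E i - X i s\<bar> + d i" if i: "i < N" for i
  proof -
    have "integral {s..t} (\<lambda>r. b (\<lambda>j. ?E j) i) = h * b ?E i" using st by simp
    moreover have "euler b w h (Suc k) i = ?E i + (w i t - w i s) + h * b ?E i" by (simp add: s_def t_def)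
    ultimately show ?thesis using solves_increment[OF X lip i st(1,2) tT] unfolding d_def by linarith
  qed
  have "(\<Sum>i<N. d i) \<le> integral {s..t} (\<lambda>r. K * (\<Sum>i<N. \<bar>?E i - X i r\<bar>))"
    unfolding d_def by (intro sum_lipschitz_integral_diff[OF lip] c) auto
  also have "\<dots> \<le> integral {s..t} (\<lambda>r. K * ((\<Sum>i<N. \<bar>?E i - X i s\<bar>) + e))"
  proof (intro integral_le integrable_continuous_real continuous_intros c mult_left_mono K)
    fix r assume r: "r \<in> {s..t}"
    have "(\<Sum>i<N. \<bar>?E i - X i r\<bar>) \<le> (\<Sum>i<N. \<bar>?E i - X i s\<bar> + \<bar>X i s - X i r\<bar>)"
      by (intro sum_mono) linarith
    also have "\<dots> \<le> (\<Sum>i<N. \<bar>?E i - X i s\<bar>) + e"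
      unfolding sum.distrib by (intro add_left_mono osc) (use r st tT in auto)
    finally show "(\<Sum>i<N. \<bar>?E i - X i r\<bar>) \<le> (\<Sum>i<N. \<bar>?E i - X i s\<bar>) + e" .
  qed auto
  also have "\<dots> = h * K * ((\<Sum>i<N. \<bar>?E i - X i s\<bar>) + e)" using st by simp
  finally have dsum: "(\<Sum>i<N. d i) \<le> h * K * ((\<Sum>i<N. \<bar>?E i - X i s\<bar>) + e)" .
  have "(\<Sum>i<N. \<bar>euler b w h (Suc k) i - X i t\<bar>) \<le> (\<Sum>i<N. \<bar>?E i - X i s\<bar> + d i)"
    by (intro sum_mono comp) auto
  then have "(\<Sum>i<N. \<bar>euler b w h (Suc k) i - X i t\<bar>) + e
      \<le> (1 + h * K) * ((\<Sum>i<N. \<bar>?E i - X i s\<bar>) + e)"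
    using dsum by (simp add: sum.distrib algebra_simps)
  also have "\<dots> \<le> (1 + h * K) * (e * exp (K * s))"
    using h(1) K Suc by (intro mult_left_mono) (auto simp: s_def)
  also have "\<dots> \<le> exp (h * K) * (e * exp (K * s))"
  proof -
    have "0 \<le> (\<Sum>i<N. \<bar>X i 0 - X i 0\<bar>)" by simp
    also have "\<dots> \<le> e" by (rule osc) (use st tT h in auto)
    finally show ?thesis by (intro mult_right_mono exp_ge_add_one_self) auto
  qed
  also have "\<dots> = e * exp (K * t)" by (simp add: s_def t_def algebra_simps exp_add[symmetric])
  finally show ?case by (simp add: t_def)
qed

text \<open>Uniformity over the grid points \<open>k \<le> n\<close> is needed for
  \<open>chain_collapses\<close>, where the solution becomes small at an interior time that need not
  lie on any grid.\<close>

lemma euler_uniform: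
  assumes X: "solves N b T w X" and lip: "sum_lipschitz N b K" and T: "0 \<le> T" and e: "0 < e"
  shows "\<forall>\<^sub>F n in sequentially. \<forall>k\<le>n.
    (\<Sum>i<N. \<bar>euler b w (T / real n) k i - X i (real k * (T / real n))\<bar>) < e"
proof -
  have K: "0 \<le> K" by (rule sum_lipschitzD(1)[OF lip])
  \<comment> \<open>The final estimate below is \<open>(real N + 1) * d * exp (K * T)\<close>;
    \<open>e'\<close> and \<open>d\<close> are chosen so that this equals \<open>e\<close>.\<close>
  define e' where "e' = e / (exp (K * T))"
  have e': "0 < e'" unfolding e'_def using e by simp
  define d where "d = e' / (real N + 1)"
  have d: "0 < d" unfolding d_def using e' by simp
  have "\<exists>r>0. \<forall>s\<in>{0..T}. \<forall>t\<in>{0..T}. dist t s < r \<longrightarrow> dist (X i t) (X i s) < d" if "i < N" for i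
    using compact_uniformly_continuous[OF solvesD(1)[OF X that]] d
    unfolding uniformly_continuous_on_def by auto
  then obtain r where r: "\<And>i. i < N \<Longrightarrow> r i > 0"
    "\<And>i s t. i < N \<Longrightarrow> s \<in> {0..T} \<Longrightarrow> t \<in> {0..T} \<Longrightarrow> dist t s < r i \<Longrightarrow> dist (X i t) (X i s) < d"
    by metis
  have "\<forall>\<^sub>F n in sequentially. \<forall>i\<in>{..<N}. T / real n < r i"
  proof (intro eventually_ball_finite ballI)
    fix i assume "i \<in> {..<N}"
    then have "0 < r i" using r(1) by simp
    moreover have "(\<lambda>n. T / real n) \<longlonglongrightarrow> 0" by (rule lim_const_over_n)
    ultimately show "\<forall>\<^sub>F n in sequentially. T / real n < r i" by (rule order_tendstoD(2)[rotated])
  qed auto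
  then show ?thesis
  proof (eventually_elim, intro allI impI)
    fix n k assume n: "\<forall>i\<in>{..<N}. T / real n < r i" and k: "k \<le> n"
    let ?h = "T / real n"
    have osc: "(\<Sum>i<N. \<bar>X i s - X i t\<bar>) \<le> real N * d" if "s \<in> {0..T}" "t \<in> {0..T}" "\<bar>s - t\<bar> \<le> ?h" for s t
    proof -
      have "(\<Sum>i<N. \<bar>X i s - X i t\<bar>) \<le> (\<Sum>i<N. d)"
      proof (rule sum_mono)
        fix i assume i: "i \<in> {..<N}"
        then have "dist s t < r i" using bspec[OF n i] that(3) by (auto simp: dist_real_def)
        then have "dist (X i s) (X i t) < d" using i that by (intro r(2)) auto
        then show "\<bar>X i s - X i t\<bar> \<le> d" by (simp add: dist_real_def)
      qed
      then show ?thesis by simp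
    qed
    have nh: "real n * ?h \<le> T" using T by (cases "n = 0") auto
    have h: "0 \<le> ?h" using T by simp
    have "(\<Sum>i<N. \<bar>euler b w ?h k i - X i (real k * ?h)\<bar>) + real N * d \<le> real N * d * exp (K * (real k * ?h))"
      by (rule euler_error[OF X lip h nh osc k])
    also have "\<dots> \<le> real N * d * exp (K * T)"
    proof -
      have "real k * ?h \<le> real n * ?h" using k h by (intro mult_right_mono) auto
      then have "K * (real k * ?h) \<le> K * T" using nh K by (intro mult_left_mono) auto
      then show ?thesis using d by (intro mult_left_mono) auto
    qed
    also have "\<dots> < (real N + 1) * d * exp (K * T)" using d by simp
    also have "\<dots> = e" unfolding d_def e'_def by simp
    finally show "(\<Sum>i<N. \<bar>euler b w ?h k i - X i (real k * ?h)\<bar>) < e"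
      using mult_nonneg_nonneg[of "real N" d] d by linarith
  qed
qed

lemma euler_tendsto:
  assumes X: "solves N b T w X" and lip: "sum_lipschitz N b K" and T: "0 \<le> T" and i: "i < N"
  shows "(\<lambda>n. euler b w (T / real n) n i) \<longlonglongrightarrow> X i T"
proof (rule tendstoI)
  fix e :: real assume "0 < e"
  from euler_uniform[OF X lip T this] eventually_gt_at_top[of 0]
  show "\<forall>\<^sub>F n in sequentially. dist (euler b w (T / real n) n i) (X i T) < e"
  proof eventually_elim
    case (elim n)
    then have "(\<Sum>i<N. \<bar>euler b w (T / real n) n i - X i (real n * (T / real n))\<bar>) < e" by blast
    moreover have "\<bar>euler b w (T / real n) n i - X i (real n * (T / real n))\<bar>
        \<le> (\<Sum>i<N. \<bar>euler b w (T / real n) n i - X i (real n * (T / real n))\<bar>)"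
      using i by (intro member_le_sum) auto
    ultimately show ?case using elim(2) by (simp add: dist_real_def)
  qed
qed

section \<open>The truncated particle system\<close>

text \<open>At the infimum of the counterexamples \<open>P\<close> holds by
  \<open>closed_step\<close>, and then \<open>open_step\<close> pushes \<open>P\<close> beyond the
  infimum. Both uniqueness and global existence of ordered solutions are proved this way.\<close>

lemma interval_induct [consumes 1, case_names start closed_step open_step]:
  fixes P :: "real \<Rightarrow> bool"
  assumes t: "t \<in> {0..T}" and start: "P 0"
    and closed_step: "\<And>t. t \<in> {0<..T} \<Longrightarrow> (\<And>s. s \<in> {0..<t} \<Longrightarrow> P s) \<Longrightarrow> P t"
    and open_step: "\<And>t. t \<in> {0..<T} \<Longrightarrow> (\<And>s. s \<in> {0..t} \<Longrightarrow> P s) \<Longrightarrow> \<exists>e>0. \<forall>s\<in>{t..<t + e} \<inter> {0..T}. P s"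
  shows "P t"
proof (rule ccontr)
  assume neg: "\<not> P t"
  define S where "S = {s\<in>{0..T}. \<not> P s}"
  have tS: "t \<in> S" using t neg by (auto simp: S_def)
  have bdd: "bdd_below S" unfolding S_def by (rule bdd_belowI[of _ 0]) auto
  define r where "r = Inf S"
  have r0: "0 \<le> r" unfolding r_def using tS by (intro cInf_greatest) (auto simp: S_def)
  have rT: "r \<le> t" unfolding r_def by (rule cInf_lower[OF tS bdd])
  have below: "P s" if "s \<in> {0..<r}" for s
  proof (rule ccontr)
    assume "\<not> P s"
    then have "s \<in> S" using that rT t by (auto simp: S_def)
    then have "r \<le> s" unfolding r_def by (rule cInf_lower[OF _ bdd])
    then show False using that by simp
  qed
  have Pr: "P r"
    using start closed_step[of r] below r0 rT t by (cases "r = 0") auto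
  then have "r < t" using neg rT by (metis order_le_imp_less_or_eq)
  then have rT': "r \<in> {0..<T}" using t r0 by auto
  have "P s" if "s \<in> {0..r}" for s using below[of s] Pr that by (cases "s = r") auto
  from open_step[OF rT' this] obtain e where e: "0 < e" "\<And>s. s \<in> {r..<r + e} \<inter> {0..T} \<Longrightarrow> P s"
    by auto
  obtain s where s: "s \<in> S" "s < r + e"
    using cInf_lessD[of S "r + e"] tS e(1) unfolding r_def by auto
  have "r \<le> s" unfolding r_def by (rule cInf_lower[OF s(1) bdd])
  then have "P s" using s e(2)[of s] by (auto simp: S_def)
  then show False using s(1) by (auto simp: S_def)
qed

lemma finite_common_pos:
  fixes P :: "'b \<Rightarrow> real \<Rightarrow> bool"
  assumes "finite S" "\<And>p. p \<in> S \<Longrightarrow> \<exists>c>0. P p c"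
    and anti: "\<And>p c d. P p c \<Longrightarrow> 0 < d \<Longrightarrow> d \<le> c \<Longrightarrow> P p d"
  shows "\<exists>c>0. \<forall>p\<in>S. P p c"
  using assms(1,2)
proof (induction S)
  case empty
  then show ?case using zero_less_one by blast
next
  case (insert x S)
  then obtain c where c: "0 < c" "\<And>p. p \<in> S \<Longrightarrow> P p c" by blast
  obtain d where d: "0 < d" "P x d" using insert.prems by blast
  have "P p (min c d)" if "p \<in> insert x S" for p
    using that c d anti[of p c "min c d"] anti[of p d "min c d"] by (cases "p = x") auto
  then show ?case using c(1) d(1) by (intro exI[of _ "min c d"]) auto
qed

lemma sum_triangle_swap:
  fixes f :: "nat \<Rightarrow> nat \<Rightarrow> real"
  shows "(\<Sum>i<N. \<Sum>j\<in>{i<..<N}. f i j) = (\<Sum>j<N. \<Sum>i<j. f i j)"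
proof -
  have "(\<Sum>i<N. \<Sum>j\<in>{i<..<N}. f i j) = (\<Sum>i<N. \<Sum>j<N. if i < j then f i j else 0)"
    by (rule sum.cong[OF refl], rule sum.mono_neutral_cong_left) auto
  also have "\<dots> = (\<Sum>j<N. \<Sum>i<N. if i < j then f i j else 0)" by (rule sum.swap)
  also have "\<dots> = (\<Sum>j<N. \<Sum>i<j. f i j)"
    by (rule sum.cong[OF refl], rule sum.mono_neutral_cong_right) auto
  finally show ?thesis .
qed

lemma sum_split_at:
  fixes f :: "nat \<Rightarrow> real"
  assumes "i < N"
  shows "sum f ({..<N} - {i}) = sum f {..<i} + sum f {i<..<N}"
proof -
  have "{..<N} - {i} = {..<i} \<union> {i<..<N}" using assms by auto
  moreover have "{..<i} \<inter> {i<..<N} = {}" by auto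
  ultimately show ?thesis by (simp add: sum.union_disjoint)
qed

text \<open>The differences are signed, so for positive \<open>\<delta>\<close> a gapped
  configuration is also ordered.\<close>

definition gapped :: "nat \<Rightarrow> real \<Rightarrow> (nat \<Rightarrow> real) \<Rightarrow> bool" where
  "gapped N \<delta> y \<longleftrightarrow> (\<forall>i<N. \<forall>j<i. \<delta> \<le> y i - y j)"

lemma gapped_mono: "gapped N \<delta> y \<Longrightarrow> \<delta>' \<le> \<delta> \<Longrightarrow> gapped N \<delta>' y"
  unfolding gapped_def by force

lemma gapped_near:
  fixes Z :: "nat \<Rightarrow> real \<Rightarrow> real"
  assumes Z: "\<And>i. i < N \<Longrightarrow> continuous_on S (Z i)" and r: "r \<in> S" and \<delta>: "0 < \<delta>"
    and gap: "gapped N (2 * \<delta>) (\<lambda>i. Z i r)"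
  shows "\<exists>e>0. \<forall>s\<in>S. \<bar>s - r\<bar> < e \<longrightarrow> gapped N \<delta> (\<lambda>i. Z i s)"
proof -
  have "\<exists>e>0. \<forall>i\<in>{..<N}. \<forall>s\<in>S. \<bar>s - r\<bar> < e \<longrightarrow> \<bar>Z i s - Z i r\<bar> < \<delta> / 2"
  proof (rule finite_common_pos)
    fix i assume "i \<in> {..<N}"
    then show "\<exists>e>0. \<forall>s\<in>S. \<bar>s - r\<bar> < e \<longrightarrow> \<bar>Z i s - Z i r\<bar> < \<delta> / 2"
      using Z[of i] r \<delta> unfolding continuous_on_iff dist_real_def by (metis lessThan_iff half_gt_zero)
  qed auto
  then obtain e where e: "0 < e" "\<And>i s. i < N \<Longrightarrow> s \<in> S \<Longrightarrow> \<bar>s - r\<bar> < e \<Longrightarrow> \<bar>Z i s - Z i r\<bar> < \<delta> / 2"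
    by auto
  have "gapped N \<delta> (\<lambda>i. Z i s)" if s: "s \<in> S" "\<bar>s - r\<bar> < e" for s
    unfolding gapped_def
  proof (intro allI impI)
    fix i j assume ij: "i < N" "j < i"
    have "2 * \<delta> \<le> Z i r - Z j r" using gap ij unfolding gapped_def by blast
    moreover have "\<bar>Z i s - Z i r\<bar> < \<delta> / 2" "\<bar>Z j s - Z j r\<bar> < \<delta> / 2"
      using e(2)[OF _ s] ij by auto
    ultimately show "\<delta> \<le> Z i s - Z j s" by linarith
  qed
  then show ?thesis using e(1) by blast
qed

text \<open>Each of the finitely many differences is continuous and positive on a compact interval,
  so it has a positive minimum. This makes every ordered solution a solution of some truncated
  equation.\<close>

lemma strictly_ordered_gapped:
  fixes X :: "nat \<Rightarrow> real \<Rightarrow> real"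
  assumes T: "0 \<le> T" and X: "\<And>i. i < N \<Longrightarrow> continuous_on {0..T} (X i)"
    and ord: "\<And>t. t \<in> {0..T} \<Longrightarrow> strict_mono_on {..<N} (\<lambda>i. X i t)"
  shows "\<exists>\<delta>>0. \<forall>t\<in>{0..T}. gapped N \<delta> (\<lambda>i. X i t)"
proof -
  have "\<exists>c>0. \<forall>p\<in>Sigma {..<N} (\<lambda>i. {..<i}). \<forall>t\<in>{0..T}. c \<le> X (fst p) t - X (snd p) t"
  proof (rule finite_common_pos)
    fix p :: "nat \<times> nat" assume p: "p \<in> Sigma {..<N} (\<lambda>i. {..<i})"
    have c: "continuous_on {0..T} (\<lambda>t. X (fst p) t - X (snd p) t)"
      using p by (intro continuous_intros X) auto
    have "\<exists>r\<in>{0..T}. \<forall>t\<in>{0..T}. X (fst p) r - X (snd p) r \<le> X (fst p) t - X (snd p) t"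
      by (rule continuous_attains_inf[OF compact_Icc _ c]) (use T in auto)
    then obtain r where r: "r \<in> {0..T}" "\<And>t. t \<in> {0..T} \<Longrightarrow> X (fst p) r - X (snd p) r \<le> X (fst p) t - X (snd p) t"
      by blast
    have "0 < X (fst p) r - X (snd p) r"
      using strict_mono_onD[OF ord[OF r(1)], of "snd p" "fst p"] p by auto
    then show "\<exists>c>0. \<forall>t\<in>{0..T}. c \<le> X (fst p) t - X (snd p) t" using r(2) by blast
  qed auto
  then obtain c where c: "0 < c"
    "\<And>i j t. i < N \<Longrightarrow> j < i \<Longrightarrow> t \<in> {0..T} \<Longrightarrow> c \<le> X i t - X j t"
    by auto
  show ?thesis unfolding gapped_def
    by (rule exI[of _ c]) (use c in blast)
qed

lemma gapped_strict_mono: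
  assumes "0 < \<delta>" "gapped N \<delta> y"
  shows "strict_mono_on {..<N} y"
  using assms unfolding gapped_def strict_mono_on_def by force

section \<open>The truncated drift\<close>

locale particles =
  fixes N :: nat and U' :: "real \<Rightarrow> real" and \<alpha> L :: real
  assumes N: "2 \<le> N" and alpha: "1 \<le> \<alpha>" and U'_lipschitz: "\<And>y z. \<bar>U' y - U' z\<bar> \<le> L * \<bar>y - z\<bar>"
begin

lemma L_nonneg: "0 \<le> L"
  using U'_lipschitz[of 1 0] by simp

definition phi :: "real \<Rightarrow> real \<Rightarrow> real" where
  "phi \<delta> d = max d \<delta> powr (- \<alpha>)"

text \<open>The direction of the repulsion is fixed by the indices and not by the sign of
  \<open>y i - y j\<close>. Hence the truncated drift is defined and Lipschitz for all
  configurations, including those where particles have crossed.\<close>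

definition tdrift :: "real \<Rightarrow> (nat \<Rightarrow> real) \<Rightarrow> nat \<Rightarrow> real" where
  "tdrift \<delta> y i = - U' (y i) +
     (1 / real N) * ((\<Sum>j<i. phi \<delta> (y i - y j)) - (\<Sum>j\<in>{i<..<N}. phi \<delta> (y j - y i)))"

lemma phi_nonneg: "0 \<le> phi \<delta> d"
  unfolding phi_def by simp

lemma interaction_deriv_pos: "0 < d \<Longrightarrow> interaction_deriv \<alpha> d = - (d powr (- \<alpha>))"
  unfolding interaction_deriv_def by (simp add: powr_add powr_minus field_simps)

lemma interaction_deriv_neg: "0 < d \<Longrightarrow> interaction_deriv \<alpha> (- d) = d powr (- \<alpha>)"
  unfolding interaction_deriv_def by (simp add: powr_add powr_minus field_simps)

lemma drift_eq_tdrift: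
  assumes "0 < \<delta>" "gapped N \<delta> y" "i < N"
  shows "drift N U' \<alpha> y i = tdrift \<delta> y i"
proof -
  have gap: "\<delta> \<le> y k - y j" if "j < k" "k < N" for j k
    using assms(2) that unfolding gapped_def by blast
  have "(\<Sum>j<i. interaction_deriv \<alpha> (y i - y j)) = (\<Sum>j<i. - phi \<delta> (y i - y j))"
  proof (rule sum.cong[OF refl])
    fix j assume "j \<in> {..<i}"
    then have "\<delta> \<le> y i - y j" using gap assms(3) by simp
    then show "interaction_deriv \<alpha> (y i - y j) = - phi \<delta> (y i - y j)"
      using interaction_deriv_pos[of "y i - y j"] assms(1) by (simp add: phi_def max_def)
  qed
  moreover have "(\<Sum>j\<in>{i<..<N}. interaction_deriv \<alpha> (y i - y j)) = (\<Sum>j\<in>{i<..<N}. phi \<delta> (y j - y i))"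
  proof (rule sum.cong[OF refl])
    fix j assume "j \<in> {i<..<N}"
    then have "\<delta> \<le> y j - y i" using gap by simp
    then show "interaction_deriv \<alpha> (y i - y j) = phi \<delta> (y j - y i)"
      using interaction_deriv_neg[of "y j - y i"] assms(1) by (simp add: phi_def max_def)
  qed
  ultimately show ?thesis
    unfolding drift_def tdrift_def sum_split_at[OF assms(3)] by (simp add: sum_negf algebra_simps)
qed

lemma phi_lipschitz:
  assumes "0 < \<delta>"
  shows "\<bar>phi \<delta> a - phi \<delta> b\<bar> \<le> \<alpha> * \<delta> powr (- \<alpha> - 1) * \<bar>a - b\<bar>"
proof -
  have "norm (max a \<delta> powr (- \<alpha>) - max b \<delta> powr (- \<alpha>)) \<le> (\<alpha> * \<delta> powr (- \<alpha> - 1)) * norm (max a \<delta> - max b \<delta>)"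
  proof (rule field_differentiable_bound[where S = "{\<delta>..}" and f' = "\<lambda>z. - \<alpha> * z powr (- \<alpha> - 1)"])
    fix z assume z: "z \<in> {\<delta>..}"
    then show "((\<lambda>z. z powr (- \<alpha>)) has_real_derivative - \<alpha> * z powr (- \<alpha> - 1)) (at z within {\<delta>..})"
      using assms by (auto intro!: derivative_eq_intros)
    have "z powr (- \<alpha> - 1) \<le> \<delta> powr (- \<alpha> - 1)" using z assms alpha by (intro powr_mono2') auto
    then show "norm (- \<alpha> * z powr (- \<alpha> - 1)) \<le> \<alpha> * \<delta> powr (- \<alpha> - 1)"
      using alpha by (simp add: abs_mult mult_left_mono)
  qed auto
  also have "\<dots> \<le> \<alpha> * \<delta> powr (- \<alpha> - 1) * \<bar>a - b\<bar>"
    using alpha by (intro mult_left_mono) auto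
  finally show ?thesis unfolding phi_def by simp
qed

text \<open>A pair contributes at most \<open>B\<close> times the sum of the displacements of its
  two particles, where \<open>B\<close> is the Lipschitz constant of \<open>phi \<delta>\<close>.
  Summing over all pairs gives \<open>2 * N * B\<close> times the l1 distance, and the mean field
  factor \<open>1 / N\<close> removes the \<open>N\<close>.\<close>

lemma tdrift_lipschitz:
  assumes "0 < \<delta>"
  shows "sum_lipschitz N (tdrift \<delta>) (L + 2 * (\<alpha> * \<delta> powr (- \<alpha> - 1)))"
proof -
  define B where "B = \<alpha> * \<delta> powr (- \<alpha> - 1)"
  have B: "0 \<le> B" unfolding B_def using alpha by simp
  have "(\<Sum>i<N. \<bar>tdrift \<delta> y i - tdrift \<delta> z i\<bar>) \<le> (L + 2 * B) * (\<Sum>i<N. \<bar>y i - z i\<bar>)" for y z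
  proof -
    let ?a = "\<lambda>i. \<bar>y i - z i\<bar>"
    have "\<bar>tdrift \<delta> y i - tdrift \<delta> z i\<bar> \<le> L * ?a i + (1 / real N) * (\<Sum>j<N. B * (?a i + ?a j))"
      if i: "i < N" for i
    proof -
      have p: "\<bar>phi \<delta> (y k - y j) - phi \<delta> (z k - z j)\<bar> \<le> B * (?a k + ?a j)" for j k
      proof -
        have "\<bar>phi \<delta> (y k - y j) - phi \<delta> (z k - z j)\<bar> \<le> B * \<bar>(y k - y j) - (z k - z j)\<bar>"
          unfolding B_def by (rule phi_lipschitz[OF assms])
        also have "\<dots> \<le> B * (?a k + ?a j)" by (intro mult_left_mono B) linarith
        finally show ?thesis .
      qed
      have "\<bar>(\<Sum>j<i. phi \<delta> (y i - y j)) - (\<Sum>j<i. phi \<delta> (z i - z j))\<bar> \<le> (\<Sum>j<i. B * (?a i + ?a j))"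
        unfolding sum_subtractf[symmetric] by (rule order_trans[OF sum_abs]) (intro sum_mono p)
      moreover have "\<bar>(\<Sum>j\<in>{i<..<N}. phi \<delta> (y j - y i)) - (\<Sum>j\<in>{i<..<N}. phi \<delta> (z j - z i))\<bar>
          \<le> (\<Sum>j\<in>{i<..<N}. B * (?a i + ?a j))"
        unfolding sum_subtractf[symmetric]
        by (rule order_trans[OF sum_abs], rule sum_mono) (use p in \<open>simp add: add.commute\<close>)
      moreover have "(\<Sum>j<i. B * (?a i + ?a j)) + (\<Sum>j\<in>{i<..<N}. B * (?a i + ?a j)) \<le> (\<Sum>j<N. B * (?a i + ?a j))"
        unfolding sum_split_at[OF i, symmetric] by (rule sum_mono2) (use B in auto)
      ultimately have "\<bar>((\<Sum>j<i. phi \<delta> (y i - y j)) - (\<Sum>j\<in>{i<..<N}. phi \<delta> (y j - y i)))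
          - ((\<Sum>j<i. phi \<delta> (z i - z j)) - (\<Sum>j\<in>{i<..<N}. phi \<delta> (z j - z i)))\<bar> \<le> (\<Sum>j<N. B * (?a i + ?a j))"
        by linarith
      then have "\<bar>(1 / real N) * (((\<Sum>j<i. phi \<delta> (y i - y j)) - (\<Sum>j\<in>{i<..<N}. phi \<delta> (y j - y i)))
          - ((\<Sum>j<i. phi \<delta> (z i - z j)) - (\<Sum>j\<in>{i<..<N}. phi \<delta> (z j - z i))))\<bar>
          \<le> (1 / real N) * (\<Sum>j<N. B * (?a i + ?a j))"
        unfolding abs_mult by (intro mult_mono) auto
      moreover have "\<bar>- U' (y i) - (- U' (z i))\<bar> \<le> L * ?a i" using U'_lipschitz[of "y i" "z i"] by simp
      ultimately show ?thesis unfolding tdrift_def right_diff_distrib by linarith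
    qed
    then have "(\<Sum>i<N. \<bar>tdrift \<delta> y i - tdrift \<delta> z i\<bar>)
        \<le> (\<Sum>i<N. L * ?a i + (1 / real N) * (\<Sum>j<N. B * (?a i + ?a j)))"
      by (intro sum_mono) simp
    also have "\<dots> = (\<Sum>i<N. L * ?a i + (B * ?a i + B / real N * (\<Sum>j<N. ?a j)))"
      using N by (intro sum.cong refl) (simp add: sum_distrib_left[symmetric] sum.distrib field_simps)
    also have "\<dots> = L * (\<Sum>i<N. ?a i) + (B * (\<Sum>i<N. ?a i) + real N * (B / real N * (\<Sum>j<N. ?a j)))"
      unfolding sum.distrib sum_distrib_left[symmetric] by simp
    also have "\<dots> = (L + 2 * B) * (\<Sum>i<N. ?a i)" using N by (simp add: algebra_simps)
    finally show ?thesis .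
  qed
  then show ?thesis unfolding sum_lipschitz_def B_def[symmetric] using L_nonneg B by simp
qed

section \<open>Ordered solutions and their uniqueness\<close>

definition osol :: "real \<Rightarrow> (nat \<Rightarrow> real \<Rightarrow> real) \<Rightarrow> (nat \<Rightarrow> real \<Rightarrow> real) \<Rightarrow> bool" where
  "osol T w X \<longleftrightarrow> solves N (drift N U' \<alpha>) T w X \<and> (\<forall>t\<in>{0..T}. strict_mono_on {..<N} (\<lambda>i. X i t))"

lemma solves_drift_iff_tdrift:
  assumes "0 < \<delta>" "\<And>t. t \<in> {0..T} \<Longrightarrow> gapped N \<delta> (\<lambda>i. X i t)"
  shows "solves N (drift N U' \<alpha>) T w X \<longleftrightarrow> solves N (tdrift \<delta>) T w X"
proof
  assume h: "solves N (drift N U' \<alpha>) T w X"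
  show "solves N (tdrift \<delta>) T w X"
    by (rule solves_cong[OF h]) (simp_all add: drift_eq_tdrift[OF assms(1) assms(2)])
next
  assume h: "solves N (tdrift \<delta>) T w X"
  show "solves N (drift N U' \<alpha>) T w X"
    by (rule solves_cong[OF h]) (simp_all add: drift_eq_tdrift[OF assms(1) assms(2)])
qed

text \<open>The competitor \<open>Y\<close> is not assumed to be ordered. As long as it agrees with
  \<open>X\<close> it inherits the gaps of \<open>X\<close>; by continuity it keeps half of them a
  little longer, and during that time both paths solve the same truncated Lipschitz
  equation.\<close>

lemma osol_unique:
  assumes T: "0 \<le> T" and X: "osol T w X" and Y: "solves N (drift N U' \<alpha>) T w Y"
    and t: "t \<in> {0..T}" and i: "i < N"
  shows "Y i t = X i t"
proof -
  have sX: "solves N (drift N U' \<alpha>) T w X" using X unfolding osol_def by blast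
  have cX: "continuous_on {0..T} (X i)" and cY: "continuous_on {0..T} (Y i)" if "i < N" for i
    using solvesD(1)[OF sX that] solvesD(1)[OF Y that] by auto
  have X0: "X i 0 = w i 0" and Y0: "Y i 0 = w i 0" if "i < N" for i
    using integral_unique[OF solvesD(2)[OF sX that, of 0]] integral_unique[OF solvesD(2)[OF Y that, of 0]] T
    by auto
  obtain \<delta>' where \<delta>': "0 < \<delta>'" "\<And>t. t \<in> {0..T} \<Longrightarrow> gapped N \<delta>' (\<lambda>i. X i t)"
  proof -
    have "strict_mono_on {..<N} (\<lambda>i. X i t)" if "t \<in> {0..T}" for t
      using X that unfolding osol_def by blast
    from strictly_ordered_gapped[of T N X, OF T cX this] show ?thesis using that by blast
  qed
  define \<delta> where "\<delta> = \<delta>' / 2"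
  have \<delta>: "0 < \<delta>" "\<delta> \<le> \<delta>'" and gap: "\<And>t. t \<in> {0..T} \<Longrightarrow> gapped N (2 * \<delta>) (\<lambda>i. X i t)"
    using \<delta>' unfolding \<delta>_def by auto
  from t have "\<forall>i<N. Y i t = X i t"
  proof (induction rule: interval_induct)
    case start
    then show ?case using X0 Y0 by simp
  next
    case (closed_step t)
    have "Y i t = X i t" if i: "i < N" for i
    proof -
      have "((\<lambda>s. Y i s - X i s) \<longlongrightarrow> Y i t - X i t) (at t within {0..T})"
        using closed_step.hyps cX[OF i] cY[OF i] unfolding continuous_on_def
        by (intro tendsto_intros) auto
      then have lim: "((\<lambda>s. Y i s - X i s) \<longlongrightarrow> Y i t - X i t) (at t within {0..<t})"
        by (rule tendsto_within_subset) (use closed_step.hyps in auto)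
      have "((\<lambda>s. Y i s - X i s) \<longlongrightarrow> 0) (at t within {0..<t})"
        by (rule tendsto_eventually) (use closed_step.IH i in \<open>auto simp: eventually_at_filter\<close>)
      moreover have "at t within {0..<t} \<noteq> bot"
        using closed_step.hyps closure_atLeastLessThan[of 0 t] by (auto simp: at_within_eq_bot_iff)
      ultimately have "Y i t - X i t = 0" using tendsto_unique[OF _ lim] by blast
      then show ?thesis by simp
    qed
    then show ?case by blast
  next
    case (open_step r)
    then have r: "r \<in> {0..T}" by auto
    have "gapped N (2 * \<delta>) (\<lambda>i. Y i r)"
      using gap[OF r] open_step.IH[of r] r unfolding gapped_def by auto
    from gapped_near[of N "{0..T}" Y, OF cY r \<delta>(1) this]
    obtain e where e: "0 < e" "\<And>s. s \<in> {0..T} \<Longrightarrow> \<bar>s - r\<bar> < e \<Longrightarrow> gapped N \<delta> (\<lambda>i. Y i s)"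
      by blast
    have "Y i s = X i s" if s: "s \<in> {r..<r + e} \<inter> {0..T}" and i: "i < N" for s i
    proof -
      have gY: "gapped N \<delta> (\<lambda>i. Y i u)" if u: "u \<in> {0..s}" for u
      proof (cases "u \<le> r")
        case True
        then have "gapped N (2 * \<delta>) (\<lambda>i. Y i u)"
          using gap[of u] open_step.IH[of u] r u s unfolding gapped_def by auto
        then show ?thesis by (rule gapped_mono) (use \<delta> in simp)
      next
        case False
        then show ?thesis using u s by (intro e(2)) auto
      qed
      have gX: "gapped N \<delta> (\<lambda>i. X i u)" if "u \<in> {0..s}" for u
        by (rule gapped_mono[OF gap]) (use that s \<delta> in auto)
      have "solves N (tdrift \<delta>) s w Y"
        using solves_drift_iff_tdrift[of \<delta> s Y w, OF \<delta>(1) gY] solves_subinterval[OF Y] s by simp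
      moreover have "solves N (tdrift \<delta>) s w X"
        using solves_drift_iff_tdrift[of \<delta> s X w, OF \<delta>(1) gX] solves_subinterval[OF sX] s by simp
      ultimately show ?thesis
        by (rule solves_unique[OF _ _ tdrift_lipschitz[OF \<delta>(1)]]) (use s i in auto)
    qed
    then show ?case using e(1) by blast
  qed
  then show ?thesis using i by blast
qed

text \<open>One path is chosen for all \<open>T\<close> at once, so that it can be followed beyond
  the time up to which the gaps are already controlled. Extension and closing of ordered solutions
  rest on this.\<close>

definition tsol :: "real \<Rightarrow> (nat \<Rightarrow> real \<Rightarrow> real) \<Rightarrow> nat \<Rightarrow> real \<Rightarrow> real" where
  "tsol \<delta> w = (SOME X. \<forall>T. solves N (tdrift \<delta>) T w X)"

lemma tsol_solves:
  assumes "0 < \<delta>" "\<And>i. i < N \<Longrightarrow> continuous_on {0..} (w i)"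
  shows "solves N (tdrift \<delta>) T w (tsol \<delta> w)"
proof -
  obtain X where "\<And>T. solves N (tdrift \<delta>) T w X"
    by (rule solves_exists_global[where w = w, OF tdrift_lipschitz[OF assms(1)]]) (use assms(2) in blast)+
  then have "\<forall>T. solves N (tdrift \<delta>) T w X" by blast
  then have "\<forall>T. solves N (tdrift \<delta>) T w (tsol \<delta> w)"
    unfolding tsol_def by (rule someI[of "\<lambda>X. \<forall>T. solves N (tdrift \<delta>) T w X"])
  then show ?thesis by blast
qed

lemma tsol_osol:
  assumes "0 < \<delta>" "\<And>i. i < N \<Longrightarrow> continuous_on {0..} (w i)"
    and "\<And>t. t \<in> {0..T} \<Longrightarrow> gapped N \<delta> (\<lambda>i. tsol \<delta> w i t)"
  shows "osol T w (tsol \<delta> w)"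
  unfolding osol_def
  using solves_drift_iff_tdrift[of \<delta> T "tsol \<delta> w" w, OF assms(1,3)] tsol_solves[of \<delta> w, OF assms(1,2)]
    gapped_strict_mono[OF assms(1) assms(3)] by blast

lemma osol_eq_tsol:
  assumes "0 < \<delta>" "\<And>i. i < N \<Longrightarrow> continuous_on {0..} (w i)" "osol T w X"
    and "\<And>t. t \<in> {0..T} \<Longrightarrow> gapped N \<delta> (\<lambda>i. X i t)" and "t \<in> {0..T}" "i < N"
  shows "X i t = tsol \<delta> w i t"
proof -
  have "solves N (tdrift \<delta>) T w X"
    using solves_drift_iff_tdrift[of \<delta> T X w, OF assms(1,4)] assms(3) unfolding osol_def by blast
  then show ?thesis
    by (rule solves_unique[OF _ tsol_solves[of \<delta> w, OF assms(1,2)] tdrift_lipschitz[OF assms(1)] assms(5,6)])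
qed

section \<open>The energy inequality for a widely spaced reference configuration\<close>

text \<open>For \<open>d \<le> 1\<close>, crossed particles included, \<open>d - e\<close> is at
  most -1. For \<open>d > 1\<close> the product \<open>phi \<delta> d * d\<close> equals
  \<open>d powr (1 - \<alpha>)\<close>, which is at most 1 since \<open>\<alpha> \<ge> 1\<close>,
  and \<open>phi \<delta> d * e\<close> is at least \<open>phi \<delta> d\<close>.\<close>

lemma phi_gap_bound:
  assumes "0 < \<delta>" "\<delta> \<le> 1" "2 \<le> e"
  shows "phi \<delta> d * (d - e) \<le> 1 - phi \<delta> d"
proof (cases "d \<le> 1")
  case True
  then have "phi \<delta> d * (d - e) \<le> phi \<delta> d * (- 1)"
    using assms phi_nonneg by (intro mult_left_mono) auto
  then show ?thesis by simp
next
  case False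
  then have d: "1 < d" by simp
  have p: "phi \<delta> d = d powr (- \<alpha>)" using d assms by (simp add: phi_def max_def)
  have "phi \<delta> d * d = d powr (1 - \<alpha>)" using d unfolding p by (simp add: powr_diff powr_minus field_simps)
  also have "\<dots> \<le> d powr 0" using d alpha by (intro powr_mono) auto
  finally have "phi \<delta> d * d \<le> 1" using d by simp
  moreover have "phi \<delta> d * 1 \<le> phi \<delta> d * e" using assms phi_nonneg by (intro mult_left_mono) auto
  ultimately show ?thesis by (simp add: algebra_simps)
qed

definition total_phi :: "real \<Rightarrow> (nat \<Rightarrow> real) \<Rightarrow> real" where
  "total_phi \<delta> y = (\<Sum>i<N. \<Sum>j<i. phi \<delta> (y i - y j))"

text \<open>
  The energy identity: pairing the drift with \<open>u i = y i - z i\<close>, where the reference configuration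
  \<open>z\<close> has gaps at least \<open>2\<close>, the singular part has a good sign.
\<close>

lemma drift_pairing:
  fixes y z :: "nat \<Rightarrow> real"
  assumes \<delta>: "0 < \<delta>" "\<delta> \<le> 1" and z: "\<And>i j. j < i \<Longrightarrow> i < N \<Longrightarrow> 2 \<le> z i - z j"
    and zR: "\<And>i. i < N \<Longrightarrow> \<bar>z i\<bar> \<le> R"
  shows "(\<Sum>i<N. (y i - z i) * tdrift \<delta> y i)
    \<le> (L + 1) * (\<Sum>i<N. (y i - z i)\<^sup>2) + real N * (\<bar>U' 0\<bar> + L * R)\<^sup>2 + real N - (1 / real N) * total_phi \<delta> y"
proof -
  let ?u = "\<lambda>i. y i - z i"
  let ?p = "\<lambda>i j. phi \<delta> (y i - y j)"
  define A where "A = \<bar>U' 0\<bar> + L * R"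
  have conf: "- (?u i * U' (y i)) \<le> (L + 1) * (?u i)\<^sup>2 + A\<^sup>2" if i: "i < N" for i
  proof -
    define v where "v = ?u i"
    have "\<bar>U' (y i)\<bar> \<le> \<bar>U' 0\<bar> + L * \<bar>y i\<bar>" using U'_lipschitz[of "y i" 0] by simp
    also have "\<dots> \<le> \<bar>U' 0\<bar> + L * (\<bar>v\<bar> + R)"
      using zR[OF i] L_nonneg unfolding v_def by (intro add_left_mono mult_left_mono) auto
    finally have "\<bar>U' (y i)\<bar> \<le> A + L * \<bar>v\<bar>" unfolding A_def by (simp add: algebra_simps)
    then have "\<bar>v\<bar> * \<bar>U' (y i)\<bar> \<le> \<bar>v\<bar> * (A + L * \<bar>v\<bar>)" by (intro mult_left_mono) auto
    also have "\<dots> = \<bar>v\<bar> * A + L * v\<^sup>2" by (simp add: algebra_simps power2_eq_square)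
    also have "\<bar>v\<bar> * A \<le> v\<^sup>2 + A\<^sup>2"
    proof -
      have "0 \<le> (\<bar>v\<bar> - A)\<^sup>2" by simp
      then have "2 * (\<bar>v\<bar> * A) \<le> v\<^sup>2 + A\<^sup>2" by (simp add: power2_diff)
      moreover have "0 \<le> v\<^sup>2 + A\<^sup>2" by simp
      ultimately show ?thesis by linarith
    qed
    finally have "\<bar>v * U' (y i)\<bar> \<le> (L + 1) * v\<^sup>2 + A\<^sup>2" by (simp add: abs_mult algebra_simps)
    then show ?thesis unfolding v_def by linarith
  qed
  have "(\<Sum>i<N. ?u i * ((\<Sum>j<i. ?p i j) - (\<Sum>j\<in>{i<..<N}. ?p j i)))
      = (\<Sum>i<N. \<Sum>j<i. ?u i * ?p i j) - (\<Sum>i<N. \<Sum>j\<in>{i<..<N}. ?u i * ?p j i)"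
    by (simp add: right_diff_distrib sum_subtractf sum_distrib_left)
  \<comment> \<open>Action equals reaction: after relabelling, each pair occurs once, with its force
    multiplied by the difference of the two displacements.\<close>
  also have "(\<Sum>i<N. \<Sum>j\<in>{i<..<N}. ?u i * ?p j i) = (\<Sum>i<N. \<Sum>j<i. ?u j * ?p i j)"
    by (rule sum_triangle_swap)
  also have "(\<Sum>i<N. \<Sum>j<i. ?u i * ?p i j) - (\<Sum>i<N. \<Sum>j<i. ?u j * ?p i j)
      = (\<Sum>i<N. \<Sum>j<i. ?p i j * ((y i - y j) - (z i - z j)))"
    by (simp add: sum_subtractf[symmetric] algebra_simps)
  also have "\<dots> \<le> (\<Sum>i<N. \<Sum>j<i. 1 - ?p i j)"
    by (intro sum_mono phi_gap_bound \<delta> z) auto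
  also have "\<dots> = (\<Sum>i<N. real i) - total_phi \<delta> y" by (simp add: sum_subtractf total_phi_def)
  also have "(\<Sum>i<N. real i) \<le> (\<Sum>i<N. real N)" by (intro sum_mono) auto
  finally have "(\<Sum>i<N. ?u i * ((\<Sum>j<i. ?p i j) - (\<Sum>j\<in>{i<..<N}. ?p j i))) \<le> real N * real N - total_phi \<delta> y"
    by simp
  then have "(1 / real N) * (\<Sum>i<N. ?u i * ((\<Sum>j<i. ?p i j) - (\<Sum>j\<in>{i<..<N}. ?p j i)))
      \<le> (1 / real N) * (real N * real N - total_phi \<delta> y)" by (intro mult_left_mono) auto
  also have "\<dots> = real N - (1 / real N) * total_phi \<delta> y" using N by (simp add: field_simps)
  finally have inter: "(1 / real N) * (\<Sum>i<N. ?u i * ((\<Sum>j<i. ?p i j) - (\<Sum>j\<in>{i<..<N}. ?p j i)))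
      \<le> real N - (1 / real N) * total_phi \<delta> y" .
  have "(\<Sum>i<N. ?u i * tdrift \<delta> y i) = (\<Sum>i<N. - (?u i * U' (y i)))
      + (1 / real N) * (\<Sum>i<N. ?u i * ((\<Sum>j<i. ?p i j) - (\<Sum>j\<in>{i<..<N}. ?p j i)))"
  proof -
    have "a * (- b + c * d) = - (a * b) + c * (a * d)" for a b c d :: real by (simp add: algebra_simps)
    then show ?thesis unfolding tdrift_def sum_distrib_left sum.distrib[symmetric] by presburger
  qed
  also have "(\<Sum>i<N. - (?u i * U' (y i))) \<le> (\<Sum>i<N. (L + 1) * (?u i)\<^sup>2 + A\<^sup>2)"
    by (intro sum_mono conf) auto
  also have "\<dots> = (L + 1) * (\<Sum>i<N. (?u i)\<^sup>2) + real N * A\<^sup>2"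
    by (simp add: sum.distrib sum_distrib_left)
  finally show ?thesis using inter unfolding A_def by linarith
qed

lemma total_phi_continuous:
  assumes "0 < \<delta>" "\<And>i. i < N \<Longrightarrow> continuous_on S (X i)"
  shows "continuous_on S (\<lambda>t. total_phi \<delta> (\<lambda>i. X i t))"
  unfolding total_phi_def phi_def
  using assms by (intro continuous_intros) auto

end

section \<open>Energy bound and limit at the explosion time\<close>

lemma mono_left_limit:
  fixes f :: "real \<Rightarrow> real"
  assumes \<tau>: "0 < \<tau>" and mono: "\<And>s t. 0 \<le> s \<Longrightarrow> s \<le> t \<Longrightarrow> t < \<tau> \<Longrightarrow> f s \<le> f t"
    and M: "\<And>t. 0 \<le> t \<Longrightarrow> t < \<tau> \<Longrightarrow> f t \<le> M"
  shows "\<exists>l. (f \<longlongrightarrow> l) (at_left \<tau>)"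
proof (rule exI, rule increasing_tendsto)
  have bdd: "bdd_above (f ` {0..<\<tau>})" using M by (intro bdd_aboveI2[of _ _ M]) auto
  have ne: "f ` {0..<\<tau>} \<noteq> {}" using \<tau> by auto
  have ev: "\<forall>\<^sub>F t in at_left \<tau>. t \<in> {s<..<\<tau>}" if "s < \<tau>" for s
    using that by (rule eventually_at_left_real)
  show "\<forall>\<^sub>F t in at_left \<tau>. f t \<le> Sup (f ` {0..<\<tau>})"
    using ev[OF \<tau>] by eventually_elim (use bdd in \<open>auto intro!: cSup_upper\<close>)
  fix x assume "x < Sup (f ` {0..<\<tau>})"
  then obtain s where s: "0 \<le> s" "s < \<tau>" "x < f s"
    using less_cSup_iff[OF ne bdd] by auto
  show "\<forall>\<^sub>F t in at_left \<tau>. x < f t"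
    using ev[OF s(2)]
  proof eventually_elim
    case (elim t)
    then have "f s \<le> f t" using s by (intro mono) auto
    then show ?case using s(3) by simp
  qed
qed

context particles
begin

text \<open>The noise cancels in \<open>X - w\<close>, so the energy relative to a reference that
  moves with \<open>w\<close> is differentiable and obeys the ordinary chain rule. Discarding the
  nonnegative repulsion integral gives the Gronwall bound \<open>M\<close>; inserting
  \<open>M\<close> and keeping that integral then bounds it as well. None of the constants involves
  \<open>\<delta>\<close>, \<open>T'\<close> or \<open>X\<close>.\<close>

lemma energy_bound_fixed:
  assumes w: "\<And>i. i < N \<Longrightarrow> continuous_on {0..} (w i)"
    and W: "\<And>i t. i < N \<Longrightarrow> t \<in> {0..T} \<Longrightarrow> \<bar>w i t\<bar> \<le> W" "0 \<le> W"
    and c_def: "c = 2 + 2 * W" and R_def: "R = W + c * real N"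
    and C_def: "C = 2 * (real N * (\<bar>U' 0\<bar> + L * R)\<^sup>2 + real N)" and K_def: "K = 2 * (L + 1)"
    and E0_def: "E0 = (\<Sum>i<N. (c * real i)\<^sup>2)" and M_def: "M = (E0 + C * T) * exp (K * T)"
    and \<delta>: "0 < \<delta>" "\<delta> \<le> 1" and T': "T' \<in> {0..T}" and X: "solves N (tdrift \<delta>) T' w X"
    and t: "t \<in> {0..T'}"
  shows "i < N \<Longrightarrow> \<bar>X i t - w i t\<bar> \<le> 1 + M + c * real N"
    and "integral {0..t} (\<lambda>s. total_phi \<delta> (\<lambda>i. X i s)) \<le> real N / 2 * (E0 + K * (M * T) + C * T)"
proof -
  have T: "0 \<le> T" "t \<le> T" "0 \<le> t" using T' t by auto
  have c: "2 \<le> c" using W(2) c_def by simp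
  have K: "0 \<le> K" unfolding K_def using L_nonneg by simp
  have C: "0 \<le> C" unfolding C_def by simp
  have E0: "0 \<le> E0" unfolding E0_def by (intro sum_nonneg) simp
  \<comment> \<open>As \<open>c = 2 + 2 * W\<close>, the reference has gaps at least 2 whatever
    values between \<open>- W\<close> and \<open>W\<close> the paths \<open>w i\<close>
    take.\<close>
  define z where "z i s = w i s + c * real i" for i s
  define b where "b i s = tdrift \<delta> (\<lambda>j. X j s) i" for i s
  define u where "u i s = X i s - z i s" for i s
  define E where "E s = (\<Sum>i<N. (u i s)\<^sup>2)" for s
  define \<Phi> where "\<Phi> s = total_phi \<delta> (\<lambda>i. X i s)" for s
  have cX: "continuous_on {0..T'} (X i)" if "i < N" for i by (rule solvesD(1)[OF X that])
  have cb: "continuous_on {0..T'} (b i)" if "i < N" for i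
    unfolding b_def by (rule sum_lipschitz_continuous[OF tdrift_lipschitz[OF \<delta>(1)] that cX])
  have c\<Phi>: "continuous_on {0..T'} \<Phi>"
    unfolding \<Phi>_def by (rule total_phi_continuous[OF \<delta>(1) cX])
  have cu: "continuous_on {0..T'} (u i)" if "i < N" for i
    unfolding u_def z_def using T'
    by (intro continuous_intros cX that continuous_on_subset[OF w]) auto
  have cE: "continuous_on {0..T'} E"
    unfolding E_def by (intro continuous_intros cu) auto
  have u_eq: "u i s = integral {0..s} (b i) - c * real i" if "i < N" "s \<in> {0..T'}" for i s
    using integral_unique[OF solvesD(2)[OF X that]] unfolding u_def z_def b_def by simp
  have du: "(u i has_real_derivative b i s) (at s within {0..T'})" if i: "i < N" and s: "s \<in> {0..T'}" for i s
  proof -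
    have "((\<lambda>s. integral {0..s} (b i) - c * real i) has_real_derivative b i s) (at s within {0..T'})"
      using integral_has_real_derivative[OF cb[OF i] s] by (auto intro!: derivative_eq_intros)
    then show ?thesis
      unfolding has_field_derivative_def
      by (rule has_derivative_transform[OF s, rotated]) (simp add: u_eq[OF i])
  qed
  have E_0: "E 0 = E0"
    unfolding E_def E0_def using T' by (intro sum.cong refl) (simp add: u_eq)
  have ineq: "(\<Sum>i<N. 2 * (u i s * b i s)) \<le> K * E s + C - 2 / real N * \<Phi> s" if s: "s \<in> {0..T'}" for s
  proof -
    have "(\<Sum>i<N. (X i s - z i s) * tdrift \<delta> (\<lambda>j. X j s) i)
      \<le> (L + 1) * (\<Sum>i<N. (X i s - z i s)\<^sup>2) + real N * (\<bar>U' 0\<bar> + L * R)\<^sup>2 + real N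
        - (1 / real N) * total_phi \<delta> (\<lambda>j. X j s)"
    proof (rule drift_pairing[OF \<delta>])
      fix i j assume ij: "j < i" "i < N"
      have "\<bar>w i s\<bar> \<le> W" "\<bar>w j s\<bar> \<le> W" using W(1) ij s T' by auto
      moreover have "c * (real j + 1) \<le> c * real i" using ij c by (intro mult_left_mono) auto
      ultimately show "2 \<le> z i s - z j s" unfolding z_def c_def by (simp add: algebra_simps)
    next
      fix i assume i: "i < N"
      have "\<bar>w i s\<bar> \<le> W" using W(1) i s T' by auto
      moreover have "c * real i \<le> c * real N" using i c by (intro mult_left_mono) auto
      moreover have "0 \<le> c * real i" using c by simp
      ultimately show "\<bar>z i s\<bar> \<le> R" unfolding z_def R_def by simp
    qed
    then show ?thesis
      unfolding E_def u_def b_def \<Phi>_def C_def K_def sum_distrib_left[symmetric] by (simp add: algebra_simps)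
  qed
  have main: "E s + 2 / real N * integral {0..s} \<Phi> \<le> E0 + integral {0..s} (\<lambda>r. K * E r + C)" if s: "s \<in> {0..T'}" for s
  proof -
    have sub: "{0..s} \<subseteq> {0..T'}" using s by auto
    have "((\<lambda>r. \<Sum>i<N. 2 * (u i r * b i r)) has_integral (E s - E 0)) {0..s}"
    proof (rule fundamental_theorem_of_calculus)
      show "0 \<le> s" using s by simp
      fix r assume r: "r \<in> {0..s}"
      have "(E has_real_derivative (\<Sum>i<N. 2 * (u i r * b i r))) (at r within {0..T'})"
        unfolding E_def using r s
        by (intro DERIV_sum) (auto intro!: derivative_eq_intros du)
      then show "(E has_vector_derivative (\<Sum>i<N. 2 * (u i r * b i r))) (at r within {0..s})"
        using sub by (metis has_real_derivative_iff_has_vector_derivative has_vector_derivative_within_subset)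
    qed
    then have "E s - E 0 = integral {0..s} (\<lambda>r. \<Sum>i<N. 2 * (u i r * b i r))" by (simp add: integral_unique)
    also have "\<dots> \<le> integral {0..s} (\<lambda>r. (K * E r + C) - 2 / real N * \<Phi> r)"
      using sub by (intro integral_le ineq integrable_continuous_real continuous_intros
          continuous_on_subset[OF cu] continuous_on_subset[OF cb] continuous_on_subset[OF cE]
          continuous_on_subset[OF c\<Phi>]) auto
    also have "\<dots> = integral {0..s} (\<lambda>r. K * E r + C) - integral {0..s} (\<lambda>r. 2 / real N * \<Phi> r)"
      using sub by (intro integral_diff integrable_continuous_real continuous_intros
          continuous_on_subset[OF cE] continuous_on_subset[OF c\<Phi>])
    finally show ?thesis using E_0 by simp
  qed
  have \<Phi>0: "0 \<le> \<Phi> s" for s unfolding \<Phi>_def total_phi_def by (intro sum_nonneg phi_nonneg)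
  have int\<Phi>0: "0 \<le> integral {0..s} \<Phi>" if "s \<in> {0..T'}" for s
    using that by (intro integral_nonneg integrable_continuous_real continuous_on_subset[OF c\<Phi>] \<Phi>0) auto
  have intE: "integral {0..s} (\<lambda>r. K * E r + C) = K * integral {0..s} E + C * s" if "s \<in> {0..T'}" for s
  proof -
    have "E integrable_on {0..s}"
      using that by (intro integrable_continuous_real continuous_on_subset[OF cE]) auto
    then show ?thesis using that by (subst integral_add) (auto intro: integrable_on_mult_right)
  qed
  have EM: "E s \<le> M" if s: "s \<in> {0..T'}" for s
  proof -
    have "E s \<le> (E0 + C * T) * exp (K * s)"
    proof (rule gronwall[OF cE _ K s])
      fix r assume r: "r \<in> {0..T'}"
      have "C * r \<le> C * T" using r T' C by (intro mult_left_mono) auto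
      moreover have "0 \<le> 2 / real N * integral {0..r} \<Phi>" using int\<Phi>0[OF r] by simp
      ultimately show "E r \<le> E0 + C * T + K * integral {0..r} E" using main[OF r] intE[OF r] by linarith
    qed
    also have "\<dots> \<le> M" unfolding M_def
      using s T' T C E0 K by (intro mult_left_mono) (auto intro!: mult_left_mono)
    finally show ?thesis .
  qed
  show "\<bar>X i t - w i t\<bar> \<le> 1 + M + c * real N" if i: "i < N"
  proof -
    have "(u i t)\<^sup>2 \<le> E t" unfolding E_def by (rule member_le_sum) (use i in auto)
    then have "(u i t)\<^sup>2 \<le> M" using EM[OF t] by linarith
    moreover have "\<bar>u i t\<bar> \<le> 1 + (u i t)\<^sup>2"
    proof -
      have "0 \<le> (\<bar>u i t\<bar> - 1)\<^sup>2" by simp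
      then have "2 * \<bar>u i t\<bar> \<le> 1 + (u i t)\<^sup>2" by (simp add: power2_diff)
      then show ?thesis by linarith
    qed
    moreover have "c * real i \<le> c * real N" using i c by (intro mult_left_mono) auto
    moreover have "0 \<le> c * real i" using c by simp
    ultimately show ?thesis unfolding u_def z_def by linarith
  qed
  have "integral {0..t} E \<le> integral {0..t} (\<lambda>_. M)"
    using t by (intro integral_le EM integrable_continuous_real continuous_on_subset[OF cE] continuous_intros) auto
  also have "\<dots> = M * t" using T by simp
  also have "\<dots> \<le> M * T" using T EM[OF t] by (intro mult_left_mono) (auto simp: M_def E0 C)
  finally have "K * integral {0..t} E \<le> K * (M * T)" using K by (intro mult_left_mono)
  moreover have "C * t \<le> C * T" using T C by (intro mult_left_mono)
  moreover have "0 \<le> E t" unfolding E_def by (intro sum_nonneg) simp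
  ultimately have "2 / real N * integral {0..t} \<Phi> \<le> E0 + K * (M * T) + C * T"
    using main[OF t] intE[OF t] by linarith
  then have "real N / 2 * (2 / real N * integral {0..t} \<Phi>) \<le> real N / 2 * (E0 + K * (M * T) + C * T)"
    by (intro mult_left_mono) auto
  then show "integral {0..t} (\<lambda>s. total_phi \<delta> (\<lambda>i. X i s)) \<le> real N / 2 * (E0 + K * (M * T) + C * T)"
    using N unfolding \<Phi>_def by simp
qed

lemma paths_bounded:
  fixes w :: "nat \<Rightarrow> real \<Rightarrow> real"
  assumes w: "\<And>i. i < N \<Longrightarrow> continuous_on {0..} (w i)"
  obtains W where "0 \<le> W" "\<And>i t. i < N \<Longrightarrow> t \<in> {0..T} \<Longrightarrow> \<bar>w i t\<bar> \<le> W"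
proof -
  have "bounded (\<Union>i<N. w i ` {0..T})"
    by (intro bounded_UN ballI compact_imp_bounded compact_continuous_image continuous_on_subset[OF w]) auto
  then obtain W where W: "\<And>x. x \<in> (\<Union>i<N. w i ` {0..T}) \<Longrightarrow> \<bar>x\<bar> \<le> W" unfolding bounded_iff by auto
  show ?thesis
  proof (rule that[of "max W 0"])
    fix i t assume "i < N" "t \<in> {0..T}"
    then have "\<bar>w i t\<bar> \<le> W" by (intro W UN_I[of i]) auto
    then show "\<bar>w i t\<bar> \<le> max W 0" by simp
  qed simp
qed

text \<open>The order of the quantifiers matters: \<open>M\<close> is found before
  \<open>\<delta>\<close> and \<open>X\<close>, so the bound survives when the gaps close at an
  explosion time.\<close>

lemma energy_bound:
  assumes w: "\<And>i. i < N \<Longrightarrow> continuous_on {0..} (w i)"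
  obtains M where "\<And>\<delta> X T' t i. 0 < \<delta> \<Longrightarrow> \<delta> \<le> 1 \<Longrightarrow> T' \<in> {0..T} \<Longrightarrow> solves N (tdrift \<delta>) T' w X \<Longrightarrow>
      t \<in> {0..T'} \<Longrightarrow> i < N \<Longrightarrow>
      \<bar>X i t\<bar> \<le> M \<and> integral {0..t} (\<lambda>s. total_phi \<delta> (\<lambda>i. X i s)) \<le> M"
proof -
  obtain W where W: "0 \<le> W" "\<And>i t. i < N \<Longrightarrow> t \<in> {0..T} \<Longrightarrow> \<bar>w i t\<bar> \<le> W"
    by (rule paths_bounded[of w T]) (use w in blast)+
  define c where "c = 2 + 2 * W"
  define R where "R = W + c * real N"
  define C where "C = 2 * (real N * (\<bar>U' 0\<bar> + L * R)\<^sup>2 + real N)"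
  define K where "K = 2 * (L + 1)"
  define E0 where "E0 = (\<Sum>i<N. (c * real i)\<^sup>2)"
  define M where "M = (E0 + C * T) * exp (K * T)"
  show ?thesis
  proof (rule that[of "max (W + (1 + M + c * real N)) (real N / 2 * (E0 + K * (M * T) + C * T))"])
    fix \<delta> T' t i X
    assume h: "0 < \<delta>" "\<delta> \<le> 1" "T' \<in> {0..T}" "solves N (tdrift \<delta>) T' w X" "t \<in> {0..T'}" "i < N"
    note eb = energy_bound_fixed[OF w W(2) W(1) c_def R_def C_def K_def E0_def M_def h(1-5)]
    have "\<bar>X i t - w i t\<bar> \<le> 1 + M + c * real N" by (rule eb(1)[OF _ _ _ h(6)])
    moreover have "\<bar>w i t\<bar> \<le> W" using W(2)[OF h(6)] h by auto
    moreover have "integral {0..t} (\<lambda>s. total_phi \<delta> (\<lambda>i. X i s)) \<le> real N / 2 * (E0 + K * (M * T) + C * T)"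
      by (rule eb(2))
    ultimately show "\<bar>X i t\<bar> \<le> max (W + (1 + M + c * real N)) (real N / 2 * (E0 + K * (M * T) + C * T)) \<and>
      integral {0..t} (\<lambda>s. total_phi \<delta> (\<lambda>i. X i s)) \<le> max (W + (1 + M + c * real N)) (real N / 2 * (E0 + K * (M * T) + C * T))"
      by linarith
  qed
qed

lemma tdrift_abs_le:
  assumes "i < N"
  shows "\<bar>tdrift \<delta> y i\<bar> \<le> \<bar>U' (y i)\<bar> + total_phi \<delta> y"
proof -
  let ?p = "\<lambda>i j. phi \<delta> (y i - y j)"
  have a: "(\<Sum>j<i. ?p i j) \<le> total_phi \<delta> y" unfolding total_phi_def
    by (rule member_le_sum[where f = "\<lambda>i. \<Sum>j<i. ?p i j"]) (use assms in \<open>auto intro: sum_nonneg phi_nonneg\<close>)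
  have b: "(\<Sum>j\<in>{i<..<N}. ?p j i) \<le> total_phi \<delta> y" unfolding total_phi_def sum_triangle_swap[symmetric]
    by (rule member_le_sum[where f = "\<lambda>i. \<Sum>j\<in>{i<..<N}. ?p j i"]) (use assms in \<open>auto intro: sum_nonneg phi_nonneg\<close>)
  have c: "0 \<le> (\<Sum>j<i. ?p i j)" "0 \<le> (\<Sum>j\<in>{i<..<N}. ?p j i)" by (intro sum_nonneg phi_nonneg)+
  have "\<bar>(1 / real N) * ((\<Sum>j<i. ?p i j) - (\<Sum>j\<in>{i<..<N}. ?p j i))\<bar> \<le> 1 * total_phi \<delta> y"
    unfolding abs_mult using a b c N by (intro mult_mono) auto
  then show ?thesis unfolding tdrift_def by linarith
qed

lemma osol_gapped:
  assumes "0 \<le> T" "osol T w X"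
  obtains \<delta> where "0 < \<delta>" "\<delta> \<le> 1" "\<And>t. t \<in> {0..T} \<Longrightarrow> gapped N \<delta> (\<lambda>i. X i t)" "solves N (tdrift \<delta>) T w X"
proof -
  have ord: "strict_mono_on {..<N} (\<lambda>i. X i t)" if "t \<in> {0..T}" for t
    using assms(2) that unfolding osol_def by blast
  have s: "solves N (drift N U' \<alpha>) T w X" using assms(2) unfolding osol_def by blast
  obtain \<delta> where \<delta>: "0 < \<delta>" "\<And>t. t \<in> {0..T} \<Longrightarrow> gapped N \<delta> (\<lambda>i. X i t)"
    using strictly_ordered_gapped[of T N X, OF assms(1) solvesD(1)[OF s] ord] by blast
  have g: "gapped N (min \<delta> 1) (\<lambda>i. X i t)" if "t \<in> {0..T}" for t
    by (rule gapped_mono[OF \<delta>(2)[OF that]]) simp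
  have "solves N (tdrift (min \<delta> 1)) T w X"
    using solves_drift_iff_tdrift[of "min \<delta> 1" T X w, OF _ g] \<delta>(1) s by simp
  then show ?thesis using \<delta>(1) g by (intro that[of "min \<delta> 1"]) auto
qed

lemma total_phi_gapped:
  assumes "0 < \<delta>" "gapped N \<delta> y"
  shows "total_phi \<delta> y = (\<Sum>i<N. \<Sum>j<i. (y i - y j) powr (- \<alpha>))"
proof -
  have "phi \<delta> (y i - y j) = (y i - y j) powr (- \<alpha>)" if "j < i" "i < N" for i j
  proof -
    have "\<delta> \<le> y i - y j" using assms(2) that unfolding gapped_def by blast
    then show ?thesis unfolding phi_def by (simp add: max_def)
  qed
  then show ?thesis unfolding total_phi_def by simp
qed

text \<open>Up to \<open>\<tau>\<close> the increments of \<open>X i - w i\<close> are dominated by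
  those of the nondecreasing bounded function \<open>k\<close>. So \<open>k\<close> and
  \<open>X i - w i + k\<close> are both monotone and bounded above, hence have left limits, and
  \<open>w i\<close> is continuous.\<close>

lemma solution_left_limit:
  assumes w: "\<And>i. i < N \<Longrightarrow> continuous_on {0..} (w i)" and \<tau>: "0 < \<tau>"
    and X: "\<And>s. s \<in> {0..<\<tau>} \<Longrightarrow> osol s w X" and i: "i < N"
  shows "\<exists>l. (X i \<longlongrightarrow> l) (at_left \<tau>)"
proof -
  obtain M where M: "\<And>\<delta> X T' t i. 0 < \<delta> \<Longrightarrow> \<delta> \<le> 1 \<Longrightarrow> T' \<in> {0..\<tau>} \<Longrightarrow> solves N (tdrift \<delta>) T' w X \<Longrightarrow>
      t \<in> {0..T'} \<Longrightarrow> i < N \<Longrightarrow>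
      \<bar>X i t\<bar> \<le> M \<and> integral {0..t} (\<lambda>s. total_phi \<delta> (\<lambda>i. X i s)) \<le> M"
    by (rule energy_bound[of w \<tau>]) (use w in blast)+
  define A where "A = \<bar>U' 0\<bar> + L * M"
  \<comment> \<open>The exact kernel instead of \<open>phi \<delta>\<close>: the
    \<open>\<delta>\<close> obtained below changes with \<open>t\<close>, whereas \<open>k\<close>
    has to be a single function.\<close>
  define \<Psi> where "\<Psi> s = (\<Sum>i<N. \<Sum>j<i. (X i s - X j s) powr (- \<alpha>))" for s
  define k where "k t = A * t + integral {0..t} \<Psi>" for t
  have key: "\<bar>(X i t - w i t) - (X i s - w i s)\<bar> \<le> k t - k s" "k t \<le> A * \<tau> + M" "\<bar>X i t\<bar> \<le> M"
    if st: "0 \<le> s" "s \<le> t" "t < \<tau>" for s t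
  proof -
    have t0: "0 \<le> t" using st by simp
    obtain \<delta> where \<delta>: "0 < \<delta>" "\<delta> \<le> 1" "\<And>r. r \<in> {0..t} \<Longrightarrow> gapped N \<delta> (\<lambda>i. X i r)" "solves N (tdrift \<delta>) t w X"
      by (rule osol_gapped[OF t0 X]) (use st in auto)
    have eq: "total_phi \<delta> (\<lambda>i. X i r) = \<Psi> r" if "r \<in> {0..t}" for r
      unfolding \<Psi>_def by (rule total_phi_gapped[OF \<delta>(1) \<delta>(3)[OF that]])
    have cX: "continuous_on {0..t} (X i)" if "i < N" for i by (rule solvesD(1)[OF \<delta>(4) that])
    have c\<Psi>: "continuous_on {0..t} \<Psi>"
      using continuous_on_eq[OF total_phi_continuous[OF \<delta>(1) cX] eq] by simp
    have cb: "continuous_on {0..t} (\<lambda>r. tdrift \<delta> (\<lambda>j. X j r) i)"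
      by (rule sum_lipschitz_continuous[OF tdrift_lipschitz[OF \<delta>(1)] i cX])
    have bX: "\<bar>X i r\<bar> \<le> M" if "r \<in> {0..t}" for r
      using M[OF \<delta>(1,2) _ \<delta>(4) that i] st by simp
    have M0: "0 \<le> M" using bX[of 0] t0 by force
    have int: "integral {0..t} \<Psi> \<le> M"
    proof -
      have "integral {0..t} \<Psi> = integral {0..t} (\<lambda>r. total_phi \<delta> (\<lambda>i. X i r))"
        by (rule integral_cong) (simp add: eq)
      then show ?thesis using M[OF \<delta>(1,2) _ \<delta>(4) _ i, of t] st by simp
    qed
    have A0: "0 \<le> A" unfolding A_def using L_nonneg M0 by simp
    show "k t \<le> A * \<tau> + M" unfolding k_def using int st A0 by (intro add_mono mult_left_mono) auto
    show "\<bar>X i t\<bar> \<le> M" using bX t0 by simp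
    have sub: "{s..t} \<subseteq> {0..t}" using st by auto
    have e1: "(X i t - w i t) - (X i s - w i s) = integral {s..t} (\<lambda>r. tdrift \<delta> (\<lambda>j. X j r) i)"
      by (rule solves_increment[OF \<delta>(4) tdrift_lipschitz[OF \<delta>(1)] i st(1,2) order_refl])
    have e2: "k t - k s = integral {s..t} (\<lambda>r. A + \<Psi> r)"
    proof -
      have "integral {0..s} \<Psi> + integral {s..t} \<Psi> = integral {0..t} \<Psi>"
        using st by (intro Henstock_Kurzweil_Integration.integral_combine integrable_continuous_real c\<Psi>)
      moreover have "integral {s..t} (\<lambda>r. A + \<Psi> r) = A * (t - s) + integral {s..t} \<Psi>"
        using st sub
        by (subst integral_add) (auto intro!: integrable_continuous_real continuous_on_subset[OF c\<Psi>])
      ultimately show ?thesis unfolding k_def by (simp add: algebra_simps)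
    qed
    have "norm (integral {s..t} (\<lambda>r. tdrift \<delta> (\<lambda>j. X j r) i)) \<le> integral {s..t} (\<lambda>r. A + \<Psi> r)"
    proof (rule integral_norm_bound_integral)
      show "(\<lambda>r. tdrift \<delta> (\<lambda>j. X j r) i) integrable_on {s..t}"
        by (intro integrable_continuous_real continuous_on_subset[OF cb sub])
      show "(\<lambda>r. A + \<Psi> r) integrable_on {s..t}"
        by (intro integrable_continuous_real continuous_intros continuous_on_subset[OF c\<Psi> sub])
      fix r assume "r \<in> {s..t}"
      then have r: "r \<in> {0..t}" using sub by auto
      have "\<bar>U' (X i r)\<bar> \<le> \<bar>U' 0\<bar> + L * \<bar>X i r\<bar>" using U'_lipschitz[of "X i r" 0] by simp
      also have "\<dots> \<le> A" unfolding A_def using bX[OF r] L_nonneg by (intro add_left_mono mult_left_mono)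
      finally show "norm (tdrift \<delta> (\<lambda>j. X j r) i) \<le> A + \<Psi> r"
        using tdrift_abs_le[OF i, of \<delta> "\<lambda>j. X j r"] eq[OF r] by simp
    qed
    then show "\<bar>(X i t - w i t) - (X i s - w i s)\<bar> \<le> k t - k s" using e1 e2 by simp
  qed
  have "\<exists>l. (k \<longlongrightarrow> l) (at_left \<tau>)"
  proof (rule mono_left_limit[OF \<tau>])
    show "k s \<le> k t" if "0 \<le> s" "s \<le> t" "t < \<tau>" for s t using key(1)[OF that] by linarith
    show "k t \<le> A * \<tau> + M" if "0 \<le> t" "t < \<tau>" for t using key(2)[of t t] that by simp
  qed
  then obtain l1 where l1: "(k \<longlongrightarrow> l1) (at_left \<tau>)" by blast
  obtain W where W: "0 \<le> W" "\<And>i t. i < N \<Longrightarrow> t \<in> {0..\<tau>} \<Longrightarrow> \<bar>w i t\<bar> \<le> W"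
    by (rule paths_bounded[of w \<tau>]) (use w in blast)+
  have "\<exists>l. ((\<lambda>t. X i t - w i t + k t) \<longlongrightarrow> l) (at_left \<tau>)"
  proof (rule mono_left_limit[OF \<tau>])
    show "X i s - w i s + k s \<le> X i t - w i t + k t" if "0 \<le> s" "s \<le> t" "t < \<tau>" for s t
      using key(1)[OF that] by linarith
    show "X i t - w i t + k t \<le> M + W + (A * \<tau> + M)" if "0 \<le> t" "t < \<tau>" for t
      using key(2,3)[of t t] W(2)[OF i, of t] that by (auto simp: abs_le_iff)
  qed
  then obtain l2 where l2: "((\<lambda>t. X i t - w i t + k t) \<longlongrightarrow> l2) (at_left \<tau>)" by blast
  have "(w i \<longlongrightarrow> w i \<tau>) (at \<tau> within {0..})" using w[OF i] \<tau> unfolding continuous_on_def by simp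
  then have "(w i \<longlongrightarrow> w i \<tau>) (at \<tau> within {0<..})" by (rule tendsto_within_subset) auto
  then have l3: "(w i \<longlongrightarrow> w i \<tau>) (at_left \<tau>)"
    using \<tau> at_within_open[of \<tau> "{0<..}"] by (simp add: filterlim_at_split)
  have "((\<lambda>t. (X i t - w i t + k t) - k t + w i t) \<longlongrightarrow> l2 - l1 + w i \<tau>) (at_left \<tau>)"
    by (intro tendsto_intros l1 l2 l3)
  then show ?thesis by auto
qed

text \<open>The mutual repulsion of the pair counts twice, once for each partner. The particles in
  between only help and are dropped; particles outside have distance at least \<open>r\<close>, so
  after division by \<open>N\<close> they cost at most \<open>r powr (- \<alpha>)\<close> on either
  side. As the pair is at most 1 apart, the confinement costs at most \<open>L\<close>.\<close>

lemma cluster_drift: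
  assumes \<delta>: "0 < \<delta>" "gapped N \<delta> y" and kl: "k < l" "l < N" and r: "0 < r"
    and below: "\<And>j. j < k \<Longrightarrow> r \<le> y k - y j" and above: "\<And>j. l < j \<Longrightarrow> j < N \<Longrightarrow> r \<le> y j - y l"
    and D: "y l - y k \<le> 1" and rep: "\<kappa> / (y l - y k) \<le> 2 / real N * (y l - y k) powr (- \<alpha>)"
  shows "\<kappa> / (y l - y k) - (L + 2 * r powr (- \<alpha>)) \<le> tdrift \<delta> y l - tdrift \<delta> y k"
proof -
  let ?D = "y l - y k"
  have D\<delta>: "\<delta> \<le> ?D" using \<delta>(2) kl unfolding gapped_def by blast
  have pD: "phi \<delta> ?D = ?D powr (- \<alpha>)" unfolding phi_def using D\<delta> by (simp add: max_def)
  have small: "phi \<delta> d \<le> r powr (- \<alpha>)" if "r \<le> d" for d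
    unfolding phi_def using r that alpha by (intro powr_mono2') auto
  have "phi \<delta> ?D \<le> (\<Sum>j<l. phi \<delta> (y l - y j))"
    by (rule member_le_sum[where f = "\<lambda>j. phi \<delta> (y l - y j)" and i = k]) (use kl phi_nonneg in auto)
  moreover have "phi \<delta> ?D \<le> (\<Sum>j\<in>{k<..<N}. phi \<delta> (y j - y k))"
    by (rule member_le_sum[where f = "\<lambda>j. phi \<delta> (y j - y k)" and i = l]) (use kl phi_nonneg in auto)
  moreover have "(\<Sum>j<k. phi \<delta> (y k - y j)) \<le> real (card {..<k}) * r powr (- \<alpha>)"
    by (rule sum_bounded_above) (use below small in auto)
  then have "(\<Sum>j<k. phi \<delta> (y k - y j)) \<le> real N * r powr (- \<alpha>)"
    using kl by (smt (verit) card_lessThan less_imp_le_nat less_trans mult_right_mono of_nat_le_iff powr_ge_zero)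
  moreover have "(\<Sum>j\<in>{l<..<N}. phi \<delta> (y j - y l)) \<le> real (card {l<..<N}) * r powr (- \<alpha>)"
    by (rule sum_bounded_above) (use above small in auto)
  then have "(\<Sum>j\<in>{l<..<N}. phi \<delta> (y j - y l)) \<le> real N * r powr (- \<alpha>)"
    by (rule order_trans) (intro mult_right_mono, auto)
  ultimately have "2 * phi \<delta> ?D - 2 * (real N * r powr (- \<alpha>)) \<le>
      ((\<Sum>j<l. phi \<delta> (y l - y j)) - (\<Sum>j\<in>{l<..<N}. phi \<delta> (y j - y l)))
      - ((\<Sum>j<k. phi \<delta> (y k - y j)) - (\<Sum>j\<in>{k<..<N}. phi \<delta> (y j - y k)))" (is "_ \<le> ?S - ?S'")
    by linarith
  then have "(1 / real N) * (2 * phi \<delta> ?D - 2 * (real N * r powr (- \<alpha>))) \<le> (1 / real N) * (?S - ?S')"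
    by (intro mult_left_mono) auto
  moreover have "(1 / real N) * (2 * phi \<delta> ?D - 2 * (real N * r powr (- \<alpha>))) = 2 / real N * ?D powr (- \<alpha>) - 2 * r powr (- \<alpha>)"
    unfolding pD using N by (simp add: field_simps)
  moreover have "\<bar>U' (y l) - U' (y k)\<bar> \<le> L * 1"
    by (rule order_trans[OF U'_lipschitz]) (use D D\<delta> \<delta>(1) L_nonneg in \<open>intro mult_left_mono, auto\<close>)
  ultimately show ?thesis using rep unfolding tdrift_def right_diff_distrib by linarith
qed

end

section \<open>Collisions force the Euler chain to collapse\<close>

text \<open>Rational starting times keep the family of exceptional events countable.\<close>

lemma at_left_rational_tail:
  fixes \<tau> :: real
  assumes "\<forall>\<^sub>F t in at_left \<tau>. P t" "0 < \<tau>"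
  obtains q where "q \<in> \<rat>" "0 \<le> q" "q < \<tau>" "\<And>t. q \<le> t \<Longrightarrow> t < \<tau> \<Longrightarrow> P t"
proof -
  obtain b where b: "b < \<tau>" "\<And>t. b < t \<Longrightarrow> t < \<tau> \<Longrightarrow> P t"
    using assms(1) unfolding eventually_at_left_field by auto
  obtain q where "q \<in> \<rat>" "max b 0 < q" "q < \<tau>"
    using Rats_dense_in_real[of "max b 0" \<tau>] b(1) assms(2) by auto
  then show ?thesis using b(2) by (intro that[of q]) auto
qed

text \<open>Go back from a violation at \<open>t\<close> to the last time \<open>s\<close> with
  \<open>Z s \<le> D s\<close>, where equality holds by the intermediate value theorem. On
  \<open>{s..t}\<close> we have \<open>D \<le> Z\<close>, so \<open>D\<close> has the larger drift
  and cannot fall behind, while the noise increments agree.\<close>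

lemma supersolution_ge:
  fixes D Z :: "real \<Rightarrow> real"
  assumes cD: "continuous_on {q..<\<tau>} D" and cZ: "continuous_on {q..<\<tau>} Z"
    and cg: "continuous_on {q..<\<tau>} (\<lambda>r. g (D r))" and cf: "continuous_on {q..<\<tau>} (\<lambda>r. f (Z r))"
    and D: "\<And>s t. q \<le> s \<Longrightarrow> s \<le> t \<Longrightarrow> t < \<tau> \<Longrightarrow> w t - w s + integral {s..t} (\<lambda>r. g (D r)) \<le> D t - D s"
    and Z: "\<And>s t. q \<le> s \<Longrightarrow> s \<le> t \<Longrightarrow> t < \<tau> \<Longrightarrow> Z t - Z s = w t - w s + integral {s..t} (\<lambda>r. f (Z r))"
    and fg: "\<And>r. r \<in> {q..<\<tau>} \<Longrightarrow> D r \<le> Z r \<Longrightarrow> f (Z r) \<le> g (D r)"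
    and start: "Z q \<le> D q" and t: "t \<in> {q..<\<tau>}"
  shows "Z t \<le> D t"
proof (rule ccontr)
  assume neg: "\<not> Z t \<le> D t"
  define S where "S = {s\<in>{q..t}. Z s \<le> D s}"
  have sub: "{q..t} \<subseteq> {q..<\<tau>}" using t by auto
  have c: "continuous_on {q..t} (\<lambda>s. D s - Z s)"
    by (intro continuous_intros continuous_on_subset[OF cD sub] continuous_on_subset[OF cZ sub])
  have "S = {q..t} \<inter> (\<lambda>s. D s - Z s) -` {0..}" unfolding S_def by auto
  then have "closed S" using continuous_closed_preimage[OF c, of "{0..}"] by simp
  moreover have "bounded S" by (rule bounded_subset[of "{q..t}"]) (auto simp: S_def)
  ultimately have "compact S" by (simp add: compact_eq_bounded_closed)
  moreover have "S \<noteq> {}" using start t unfolding S_def by auto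
  ultimately obtain s where s: "s \<in> S" "\<And>r. r \<in> S \<Longrightarrow> r \<le> s" using compact_attains_sup[of S] by auto
  have st: "q \<le> s" "s \<le> t" using s(1) unfolding S_def by auto
  have "\<exists>x\<ge>s. x \<le> t \<and> D x - Z x = 0"
    by (rule IVT2'[of "\<lambda>s. D s - Z s"])
      (use s(1) neg st in \<open>auto simp: S_def intro: continuous_on_subset[OF c]\<close>)
  then obtain x where x: "s \<le> x" "x \<le> t" "D x = Z x" by auto
  then have "x \<in> S" using st unfolding S_def by auto
  then have eq: "D s = Z s" using s(2)[of x] x by auto
  have sub': "{s..t} \<subseteq> {q..<\<tau>}" using t st by auto
  have le: "D r \<le> Z r" if r: "r \<in> {s..t}" for r
  proof (cases "r = s")
    case False
    then have "r \<notin> S" using s(2)[of r] r by auto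
    then show ?thesis using r st unfolding S_def by auto
  qed (use eq in simp)
  have "integral {s..t} (\<lambda>r. f (Z r)) \<le> integral {s..t} (\<lambda>r. g (D r))"
    using sub' by (intro integral_le integrable_continuous_real continuous_on_subset[OF cg sub']
        continuous_on_subset[OF cf sub'] fg le) auto
  then have "Z t - Z s \<le> D t - D s" using D[of s t] Z[of s t] st t by auto
  then show False using eq neg by simp
qed

text \<open>
  The Euler scheme for \<open>dZ = dw + (\<kappa> / Z - C) dt\<close>, stopped at the first passage below \<open>\<epsilon>\<close>;
  \<open>\<xi>\<close> is the sequence of increments of \<open>w\<close>.
\<close>

primrec chain :: "real \<Rightarrow> real \<Rightarrow> real \<Rightarrow> real \<Rightarrow> real \<Rightarrow> (nat \<Rightarrow> real) \<Rightarrow> nat \<Rightarrow> real" where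
  "chain \<kappa> C \<epsilon> z h \<xi> 0 = z"
| "chain \<kappa> C \<epsilon> z h \<xi> (Suc k) =
     (if chain \<kappa> C \<epsilon> z h \<xi> k \<le> \<epsilon> then chain \<kappa> C \<epsilon> z h \<xi> k
      else chain \<kappa> C \<epsilon> z h \<xi> k + \<xi> k + h * (\<kappa> / chain \<kappa> C \<epsilon> z h \<xi> k - C))"

definition grid_increment :: "(real \<Rightarrow> real) \<Rightarrow> real \<Rightarrow> real \<Rightarrow> nat \<Rightarrow> real" where
  "grid_increment w q h k = w (q + real (Suc k) * h) - w (q + real k * h)"

text \<open>The chain is frozen once it is at most \<open>\<epsilon>\<close>, so its last value
  records whether it ever got there. Requiring this for all large \<open>n\<close> makes the event a
  lower limit of events, whose probability is bounded by the limit of the bounds.\<close>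

abbreviation collapses :: "real \<Rightarrow> real \<Rightarrow> real \<Rightarrow> real \<Rightarrow> real \<Rightarrow> real \<Rightarrow> (real \<Rightarrow> real) \<Rightarrow> bool" where
  "collapses \<kappa> C \<epsilon> z T q w \<equiv> \<forall>\<^sub>F n in sequentially.
     chain \<kappa> C \<epsilon> z ((T - q) / real n) (grid_increment w q ((T - q) / real n)) n \<le> \<epsilon>"

lemma chain_stays:
  "chain \<kappa> C \<epsilon> z h \<xi> j \<le> \<epsilon> \<Longrightarrow> j \<le> n \<Longrightarrow> chain \<kappa> C \<epsilon> z h \<xi> n \<le> \<epsilon>"
  by (induction n) (auto simp: le_Suc_eq)

text \<open>Before its first passage the chain visits only values above \<open>\<epsilon>\<close>,
  where cutting off the denominator at \<open>\<epsilon>\<close> changes nothing. The cut-off drift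
  is Lipschitz, so the convergence of Euler schemes applies to it.\<close>

lemma chain_eq_euler:
  assumes "chain \<kappa> C \<epsilon> z h (grid_increment w q h) n > \<epsilon>" "j \<le> n"
  shows "chain \<kappa> C \<epsilon> z h (grid_increment w q h) j
    = euler (\<lambda>y i. \<kappa> / max (y 0) \<epsilon> - C) (\<lambda>i t. z + (w (q + t) - w q)) h j 0"
  using assms(2)
proof (induction j)
  case (Suc j)
  let ?c = "chain \<kappa> C \<epsilon> z h (grid_increment w q h)"
  have "\<epsilon> < ?c j" using chain_stays[of \<kappa> C \<epsilon> z h "grid_increment w q h" j n] assms(1) Suc.prems by force
  then show ?case using Suc by (simp add: grid_increment_def max_def)
qed simp

lemma one_dim_lipschitz:
  assumes "0 < \<epsilon>" "0 \<le> \<kappa>"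
  shows "sum_lipschitz 1 (\<lambda>y i. \<kappa> / max (y 0) \<epsilon> - C) (\<kappa> / \<epsilon>\<^sup>2)"
proof -
  have "\<bar>\<kappa> / max a \<epsilon> - \<kappa> / max b \<epsilon>\<bar> \<le> \<kappa> / \<epsilon>\<^sup>2 * \<bar>a - b\<bar>" for a b :: real
  proof -
    have p: "0 < max a \<epsilon>" "0 < max b \<epsilon>" using assms(1) by auto
    have "\<kappa> / max a \<epsilon> - \<kappa> / max b \<epsilon> = \<kappa> * (max b \<epsilon> - max a \<epsilon>) / (max a \<epsilon> * max b \<epsilon>)"
      using p by (simp add: field_simps)
    then have "\<bar>\<kappa> / max a \<epsilon> - \<kappa> / max b \<epsilon>\<bar> = \<kappa> * \<bar>max b \<epsilon> - max a \<epsilon>\<bar> / (max a \<epsilon> * max b \<epsilon>)"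
      using p assms(2) by (simp add: abs_mult)
    also have "\<dots> \<le> \<kappa> * \<bar>a - b\<bar> / (\<epsilon> * \<epsilon>)"
      using p assms by (intro frac_le mult_left_mono mult_mono mult_nonneg_nonneg mult_pos_pos) auto
    finally show ?thesis by (simp add: power2_eq_square)
  qed
  then show ?thesis unfolding sum_lipschitz_def using assms by simp
qed

text \<open>The solution \<open>Y\<close> of the cut-off equation started at \<open>z\<close> lies
  below \<open>D\<close>, hence is at most 0 at \<open>\<tau>\<close>. Its Euler scheme is then
  below \<open>\<epsilon>\<close> at a grid point near \<open>\<tau>\<close> once the mesh is fine,
  which contradicts a chain that stays above \<open>\<epsilon>\<close>. The horizon \<open>T\<close>
  is separate from \<open>\<tau>\<close> because the grid must not depend on the random collision
  time.\<close>

lemma chain_collapses: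
  fixes D w :: "real \<Rightarrow> real"
  assumes \<epsilon>: "0 < \<epsilon>" and \<kappa>: "0 \<le> \<kappa>" and q: "q < \<tau>" and T: "\<tau> \<le> T"
    and w: "continuous_on {q..} w"
    and cD: "continuous_on {q..<\<tau>} D" and Dpos: "\<And>t. t \<in> {q..<\<tau>} \<Longrightarrow> 0 < D t"
    and D0: "(D \<longlongrightarrow> 0) (at_left \<tau>)"
    and D: "\<And>s t. q \<le> s \<Longrightarrow> s \<le> t \<Longrightarrow> t < \<tau> \<Longrightarrow> w t - w s + integral {s..t} (\<lambda>r. \<kappa> / D r - C) \<le> D t - D s"
    and z: "z \<le> D q"
  shows "collapses \<kappa> C \<epsilon> z T q w"
proof -
  define b where "b = (\<lambda>(y::nat \<Rightarrow> real) (i::nat). \<kappa> / max (y 0) \<epsilon> - C)"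
  define w' where "w' = (\<lambda>(i::nat) t. z + (w (q + t) - w q))"
  have lip: "sum_lipschitz 1 b (\<kappa> / \<epsilon>\<^sup>2)" unfolding b_def by (rule one_dim_lipschitz[OF \<epsilon> \<kappa>])
  have cw': "continuous_on {0..T - q} (w' i)" for i
    unfolding w'_def by (intro continuous_intros continuous_on_compose2[OF w]) auto
  obtain Z where Z: "solves 1 b (T - q) w' Z" using solves_exists[of 1 b _ "T - q" w', OF lip cw'] by blast
  define Y where "Y t = Z 0 (t - q)" for t
  have cZ: "continuous_on {0..T - q} (Z 0)" by (rule solvesD(1)[OF Z]) simp
  have cY: "continuous_on {q..T} Y"
    unfolding Y_def by (intro continuous_on_compose2[OF cZ] continuous_intros) auto
  have sub: "{q..<\<tau>} \<subseteq> {q..T}" using T by auto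
  have cf: "continuous_on {q..T} (\<lambda>r. \<kappa> / max (Y r) \<epsilon> - C)"
    using \<epsilon> by (intro continuous_intros cY) auto
  have int: "((\<lambda>r. \<kappa> / max (Y r) \<epsilon> - C) has_integral (Y t - (z + (w t - w q)))) {q..t}" if "t \<in> {q..T}" for t
  proof -
    have "((\<lambda>s. \<kappa> / max (Z 0 s) \<epsilon> - C) has_integral (Z 0 (t - q) - w' 0 (t - q))) {0..t - q}"
      using solvesD(2)[OF Z, of 0 "t - q"] that unfolding b_def by simp
    then have "((\<lambda>s. \<kappa> / max (Z 0 s) \<epsilon> - C) has_integral (Y t - (z + (w t - w q)))) (cbox 0 (t - q))"
      unfolding Y_def w'_def by simp
    from has_integral_affinity[OF this, of 1 "- q"] that
    show ?thesis unfolding Y_def by (simp add: image_affinity_atLeastAtMost_diff image_affinity_atLeastAtMost add.commute)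
  qed
  have Yeq: "Y t - Y s = w t - w s + integral {s..t} (\<lambda>r. \<kappa> / max (Y r) \<epsilon> - C)"
    if "q \<le> s" "s \<le> t" "t < \<tau>" for s t
  proof -
    have "integral {q..s} (\<lambda>r. \<kappa> / max (Y r) \<epsilon> - C) + integral {s..t} (\<lambda>r. \<kappa> / max (Y r) \<epsilon> - C)
      = integral {q..t} (\<lambda>r. \<kappa> / max (Y r) \<epsilon> - C)"
      using that T by (intro Henstock_Kurzweil_Integration.integral_combine integrable_continuous_real
          continuous_on_subset[OF cf]) auto
    then show ?thesis
      using integral_unique[OF int[of s]] integral_unique[OF int[of t]] that T by auto
  qed
  have Yq: "Y q = z" using integral_unique[OF int[of q]] q T by simp
  have YD: "Y t \<le> D t" if "t \<in> {q..<\<tau>}" for t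
  proof (rule supersolution_ge[where g = "\<lambda>d. \<kappa> / d - C" and f = "\<lambda>d. \<kappa> / max d \<epsilon> - C", OF cD _ _ _ D Yeq _ _ that])
    show "continuous_on {q..<\<tau>} Y" by (rule continuous_on_subset[OF cY sub])
    show "continuous_on {q..<\<tau>} (\<lambda>r. \<kappa> / D r - C)"
      using Dpos by (intro continuous_intros cD) (auto simp: less_le)
    show "continuous_on {q..<\<tau>} (\<lambda>r. \<kappa> / max (Y r) \<epsilon> - C)" by (rule continuous_on_subset[OF cf sub])
    \<comment> \<open>The cut-off only lowers the drift: \<open>max (Y r) \<epsilon>\<close> is at
      least \<open>Y r\<close>, and so at least \<open>D r\<close>.\<close>
    show "\<kappa> / max (Y r) \<epsilon> - C \<le> \<kappa> / D r - C" if "r \<in> {q..<\<tau>}" "D r \<le> Y r" for r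
      using Dpos[OF that(1)] that(2) \<kappa> by (intro diff_right_mono divide_left_mono mult_pos_pos) auto
    show "Y q \<le> D q" using Yq z by simp
  qed
  have "(Y \<longlongrightarrow> Y \<tau>) (at_left \<tau>)"
    by (rule continuous_on_Icc_at_leftD[OF continuous_on_subset[OF cY]]) (use q T in auto)
  then have "Y \<tau> \<le> 0"
  proof (rule tendsto_le[OF _ D0, rotated])
    have "\<forall>\<^sub>F t in at_left \<tau>. t \<in> {q<..<\<tau>}" using q by (rule eventually_at_left_real)
    then show "\<forall>\<^sub>F t in at_left \<tau>. Y t \<le> D t" by eventually_elim (use YD in auto)
  qed simp
  then have Z\<tau>: "Z 0 (\<tau> - q) \<le> 0" unfolding Y_def .
  obtain r where r: "0 < r" "\<And>s. s \<in> {0..T - q} \<Longrightarrow> \<bar>s - (\<tau> - q)\<bar> < r \<Longrightarrow> \<bar>Z 0 s - Z 0 (\<tau> - q)\<bar> < \<epsilon> / 4"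
  proof -
    have "\<tau> - q \<in> {0..T - q}" "0 < \<epsilon> / 4" using q T \<epsilon> by auto
    then have "\<exists>r>0. \<forall>s\<in>{0..T - q}. dist s (\<tau> - q) < r \<longrightarrow> dist (Z 0 s) (Z 0 (\<tau> - q)) < \<epsilon> / 4"
      using cZ unfolding continuous_on_iff by blast
    then show ?thesis using that unfolding dist_real_def by blast
  qed
  have "(\<lambda>n. (T - q) / real n) \<longlonglongrightarrow> 0" by (rule lim_const_over_n)
  then have "\<forall>\<^sub>F n in sequentially. (T - q) / real n < r" using r(1) by (rule order_tendstoD(2))
  moreover have "\<forall>\<^sub>F n in sequentially. \<forall>k\<le>n.
      (\<Sum>i<1. \<bar>euler b w' ((T - q) / real n) k i - Z i (real k * ((T - q) / real n))\<bar>) < \<epsilon> / 4"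
    by (rule euler_uniform[OF Z lip]) (use q T \<epsilon> in auto)
  moreover have "\<forall>\<^sub>F n in sequentially. 0 < n" by (rule eventually_gt_at_top)
  ultimately show ?thesis
  proof eventually_elim
    case (elim n)
    define h where "h = (T - q) / real n"
    have h: "0 < h" "h < r" "real n * h = T - q" unfolding h_def using elim q T by auto
    \<comment> \<open>The last grid point up to \<open>\<tau>\<close>. Here \<open>Z\<close> is
      below \<open>\<epsilon> / 4\<close>, and the scheme is within \<open>\<epsilon> / 4\<close> of
      it.\<close>
    define k where "k = nat \<lfloor>(\<tau> - q) / h\<rfloor>"
    have kr: "real k = of_int \<lfloor>(\<tau> - q) / h\<rfloor>" unfolding k_def using h q by (simp add: of_nat_nat)
    have "real k \<le> (\<tau> - q) / h" "(\<tau> - q) / h < real k + 1" unfolding kr by linarith+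
    then have k: "real k * h \<le> \<tau> - q" "\<tau> - q < real k * h + h" using h(1) by (auto simp: field_simps)
    have "real k * h \<le> real n * h" using k(1) h(3) T by linarith
    then have kn: "k \<le> n" using h(1) by simp
    have "\<bar>real k * h - (\<tau> - q)\<bar> < r" using k h by linarith
    moreover have "real k * h \<in> {0..T - q}" using h k T by auto
    ultimately have "Z 0 (real k * h) < \<epsilon> / 4" using r(2)[of "real k * h"] Z\<tau> by linarith
    moreover have "\<bar>euler b w' h k 0 - Z 0 (real k * h)\<bar> < \<epsilon> / 4"
      using elim(2) kn unfolding h_def by auto
    ultimately have less: "euler b w' h k 0 < \<epsilon>" using \<epsilon> by linarith
    show ?case
    proof (rule ccontr)
      assume "\<not> chain \<kappa> C \<epsilon> z ((T - q) / real n) (grid_increment w q ((T - q) / real n)) n \<le> \<epsilon>"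
      then have gt: "chain \<kappa> C \<epsilon> z h (grid_increment w q h) n > \<epsilon>" unfolding h_def by simp
      have "chain \<kappa> C \<epsilon> z h (grid_increment w q h) k = euler b w' h k 0"
        unfolding b_def w'_def by (rule chain_eq_euler[OF gt kn])
      then show False using chain_stays[of \<kappa> C \<epsilon> z h "grid_increment w q h" k n] gt kn less by simp
    qed
  qed
qed

context particles
begin

section \<open>Continuation of ordered solutions\<close>

lemma drift_cong: "i < N \<Longrightarrow> (\<And>j. j < N \<Longrightarrow> y j = z j) \<Longrightarrow> drift N U' \<alpha> y i = drift N U' \<alpha> z i"
  unfolding drift_def by simp

lemma osol_cong:
  assumes X: "osol T w X" and eq: "\<And>i t. i < N \<Longrightarrow> t \<in> {0..T} \<Longrightarrow> Y i t = X i t"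
  shows "osol T w Y"
proof -
  have s: "solves N (drift N U' \<alpha>) T w X" using X unfolding osol_def by blast
  have "solves N (drift N U' \<alpha>) T w Y"
  proof (rule solves_cong[OF s eq])
    fix i t assume it: "i < N" "t \<in> {0..T}"
    show "drift N U' \<alpha> (\<lambda>j. Y j t) i = drift N U' \<alpha> (\<lambda>j. X j t) i"
      by (rule drift_cong[OF it(1) eq[OF _ it(2)]])
  qed
  moreover have "strict_mono_on {..<N} (\<lambda>i. Y i t)" if t: "t \<in> {0..T}" for t
  proof -
    have "strict_mono_on {..<N} (\<lambda>i. X i t)" using X t unfolding osol_def by blast
    then show ?thesis unfolding strict_mono_on_def using eq[OF _ t] by simp
  qed
  ultimately show ?thesis unfolding osol_def by blast
qed

lemma osol_subinterval:
  assumes "osol T w X" "S \<le> T"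
  shows "osol S w X"
  using assms(1) solves_subinterval[of N "drift N U' \<alpha>" T w X S, OF _ assms(2)] assms(2) unfolding osol_def by auto

lemma osol_glue:
  assumes "\<And>s. s \<in> {0..<\<tau>} \<Longrightarrow> \<exists>X. osol s w X"
  obtains X where "\<And>s. s \<in> {0..<\<tau>} \<Longrightarrow> osol s w X"
proof -
  obtain Z where Z: "\<And>s. s \<in> {0..<\<tau>} \<Longrightarrow> osol s w (Z s)" using assms by metis
  define X where "X i t = Z t i t" for i t
  have "osol s w X" if s: "s \<in> {0..<\<tau>}" for s
  proof (rule osol_cong[OF Z[OF s]])
    fix i t assume it: "i < N" "t \<in> {0..s}"
    have "solves N (drift N U' \<alpha>) t w (Z t)" using Z[of t] it s unfolding osol_def by auto
    then show "X i t = Z s i t"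
      unfolding X_def using it
      by (intro osol_unique[of t w "Z s" "Z t"] osol_subinterval[OF Z[OF s]]) auto
  qed
  then show ?thesis by (rule that)
qed

lemma osol_extend:
  assumes w: "\<And>i. i < N \<Longrightarrow> continuous_on {0..} (w i)" and T: "0 \<le> T" and X: "osol T w X"
  shows "\<exists>e>0. \<forall>s\<in>{T..<T + e}. \<exists>X. osol s w X"
proof -
  obtain \<delta>' where \<delta>': "0 < \<delta>'" "\<And>t. t \<in> {0..T} \<Longrightarrow> gapped N \<delta>' (\<lambda>i. X i t)"
    by (rule osol_gapped[OF T X]) blast
  \<comment> \<open>Truncating at half the gap leaves room: the truncated solution needs some time
    after \<open>T\<close> before its truncation becomes visible.\<close>
  define \<delta> where "\<delta> = \<delta>' / 2"
  have \<delta>: "0 < \<delta>" "2 * \<delta> = \<delta>'" using \<delta>' unfolding \<delta>_def by auto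
  have gap: "gapped N \<delta> (\<lambda>i. X i t)" if "t \<in> {0..T}" for t
    by (rule gapped_mono[OF \<delta>'(2)[OF that]]) (use \<delta> in simp)
  let ?Y = "tsol \<delta> w"
  have Y: "solves N (tdrift \<delta>) S w ?Y" for S by (rule tsol_solves[OF \<delta>(1) w])
  have eq: "?Y i t = X i t" if "t \<in> {0..T}" "i < N" for i t
    using osol_eq_tsol[of \<delta> w T X t i, OF \<delta>(1) w X gap that] by simp
  have "gapped N (2 * \<delta>) (\<lambda>i. ?Y i T)"
    using \<delta>'(2)[of T] T eq[of T] unfolding gapped_def \<delta>(2) by simp
  from gapped_near[of N "{0..T + 1}" ?Y T \<delta>, OF solvesD(1)[OF Y] _ \<delta>(1) this] T
  obtain e where e: "0 < e" "\<And>s. s \<in> {0..T + 1} \<Longrightarrow> \<bar>s - T\<bar> < e \<Longrightarrow> gapped N \<delta> (\<lambda>i. ?Y i s)" by auto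
  have "osol s w ?Y" if s: "s \<in> {T..<T + min e 1}" for s
  proof (rule tsol_osol[OF \<delta>(1) w])
    fix t assume t: "t \<in> {0..s}"
    show "gapped N \<delta> (\<lambda>i. ?Y i t)"
    proof (cases "t \<le> T")
      case True
      then show ?thesis using gap[of t] eq[of t] t unfolding gapped_def by simp
    next
      case False
      then show ?thesis using t s by (intro e(2)) auto
    qed
  qed
  then have "\<forall>s\<in>{T..<T + min e 1}. \<exists>X. osol s w X" by (intro ballI exI[of _ ?Y])
  then show ?thesis using e(1) by (intro exI[of _ "min e 1"]) simp
qed

text \<open>Distinct limits keep the gaps away from 0 near \<open>\<tau>\<close>, and compactness
  does so before. Hence a single truncated solution agrees with \<open>X\<close> on all of
  \<open>{0..<\<tau>}\<close>; it is defined at \<open>\<tau>\<close> too, where its gaps persist by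
  continuity.\<close>

lemma osol_close:
  assumes w: "\<And>i. i < N \<Longrightarrow> continuous_on {0..} (w i)" and \<tau>: "0 < \<tau>"
    and X: "\<And>s. s \<in> {0..<\<tau>} \<Longrightarrow> osol s w X"
    and l: "\<And>i. i < N \<Longrightarrow> (X i \<longlongrightarrow> l i) (at_left \<tau>)"
    and ord: "\<And>i j. j < i \<Longrightarrow> i < N \<Longrightarrow> l j < l i"
  shows "\<exists>X. osol \<tau> w X"
proof -
  let ?S = "Sigma {..<N} (\<lambda>i. {..<i})"
  have "\<exists>d>0. \<forall>p\<in>?S. d < l (fst p) - l (snd p)"
  proof (rule finite_common_pos)
    fix p assume "p \<in> ?S"
    then have "0 < l (fst p) - l (snd p)" using ord[of "snd p" "fst p"] by auto
    then show "\<exists>d>0. d < l (fst p) - l (snd p)" using dense by blast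
  qed auto
  then obtain d where d: "0 < d" "\<And>p. p \<in> ?S \<Longrightarrow> d < l (fst p) - l (snd p)" by blast
  have "\<forall>\<^sub>F t in at_left \<tau>. \<forall>p\<in>?S. d < X (fst p) t - X (snd p) t"
  proof (intro eventually_ball_finite ballI)
    fix p assume p: "p \<in> ?S"
    have "((\<lambda>t. X (fst p) t - X (snd p) t) \<longlongrightarrow> l (fst p) - l (snd p)) (at_left \<tau>)"
      using p by (intro tendsto_intros l) auto
    then show "\<forall>\<^sub>F t in at_left \<tau>. d < X (fst p) t - X (snd p) t"
      using d(2)[OF p] by (rule order_tendstoD(1))
  qed auto
  then obtain q where q: "0 \<le> q" "q < \<tau>" "\<And>t. q \<le> t \<Longrightarrow> t < \<tau> \<Longrightarrow> \<forall>p\<in>?S. d < X (fst p) t - X (snd p) t"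
    by (rule at_left_rational_tail[OF _ \<tau>]) blast
  have Xq: "osol q w X" using q by (intro X) auto
  obtain d' where d': "0 < d'" "\<And>t. t \<in> {0..q} \<Longrightarrow> gapped N d' (\<lambda>i. X i t)"
    by (rule osol_gapped[OF q(1) Xq]) blast
  define \<delta> where "\<delta> = min d d'"
  have \<delta>: "0 < \<delta>" unfolding \<delta>_def using d d' by simp
  have gap: "gapped N \<delta> (\<lambda>i. X i t)" if t: "t \<in> {0..<\<tau>}" for t
  proof (cases "t \<le> q")
    case True
    then show ?thesis using d'(2)[of t] t by (auto intro: gapped_mono simp: \<delta>_def)
  next
    case False
    then have "\<forall>p\<in>?S. d < X (fst p) t - X (snd p) t" using q(3)[of t] t by simp
    then have "d < X i t - X j t" if "i < N" "j < i" for i j using that by fastforce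
    then have "gapped N d (\<lambda>i. X i t)" unfolding gapped_def by (auto intro: less_imp_le)
    then show ?thesis by (rule gapped_mono) (simp add: \<delta>_def)
  qed
  let ?Y = "tsol \<delta> w"
  have eq: "X i t = ?Y i t" if t: "t \<in> {0..<\<tau>}" and i: "i < N" for i t
    by (rule osol_eq_tsol[of \<delta> w t X, OF \<delta> w X[OF t] gap]) (use t i in auto)
  have Y: "solves N (tdrift \<delta>) \<tau> w ?Y" by (rule tsol_solves[OF \<delta> w])
  have "gapped N \<delta> (\<lambda>i. ?Y i t)" if t: "t \<in> {0..\<tau>}" for t
    unfolding gapped_def
  proof (intro allI impI)
    fix i j assume ij: "i < N" "j < i"
    have less: "\<delta> \<le> ?Y i t - ?Y j t" if "t \<in> {0..<\<tau>}" for t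
    proof -
      have "\<delta> \<le> X i t - X j t" using gap[OF that] ij unfolding gapped_def by blast
      then show ?thesis using eq[OF that] ij by simp
    qed
    have "((\<lambda>t. ?Y i t - ?Y j t) \<longlongrightarrow> ?Y i \<tau> - ?Y j \<tau>) (at_left \<tau>)"
      using solvesD(1)[OF Y] ij \<tau> by (intro tendsto_intros continuous_on_Icc_at_leftD) auto
    moreover have "\<forall>\<^sub>F t in at_left \<tau>. \<delta> \<le> ?Y i t - ?Y j t"
      using eventually_at_left_real[OF \<tau>] by eventually_elim (use less in auto)
    ultimately have "\<delta> \<le> ?Y i \<tau> - ?Y j \<tau>" by (rule tendsto_lowerbound) simp
    then show "\<delta> \<le> ?Y i t - ?Y j t" using less[of t] t by (cases "t = \<tau>") auto
  qed
  then have "osol \<tau> w ?Y" by (intro tsol_osol[OF \<delta> w])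
  then show ?thesis by (rule exI[of _ ?Y])
qed

text \<open>The indices \<open>k\<close> and \<open>n\<close> are the extreme ones among the
  particles with the same limit as \<open>m\<close>. All other limits are different, so close to
  \<open>\<tau>\<close> the particles below \<open>k\<close> and above \<open>n\<close> stay at
  distance at least \<open>r\<close>, and \<open>cluster_drift\<close> applies with this
  \<open>r\<close>.\<close>

lemma collision_supersolution:
  assumes w: "\<And>i. i < N \<Longrightarrow> continuous_on {0..} (w i)" and \<tau>: "0 < \<tau>"
    and X: "\<And>s. s \<in> {0..<\<tau>} \<Longrightarrow> osol s w X"
    and l: "\<And>i. i < N \<Longrightarrow> (X i \<longlongrightarrow> l i) (at_left \<tau>)"
    and coll: "m' < m" "m < N" "\<not> l m' < l m"
    and rep: "0 < \<eta>" "\<And>d. 0 < d \<Longrightarrow> d \<le> \<eta> \<Longrightarrow> \<kappa> / d \<le> 2 / real N * d powr (- \<alpha>)"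
  obtains k n q C where "k < n" "n < N" "q \<in> \<rat>" "0 \<le> q" "q < \<tau>"
    "((\<lambda>t. X n t - X k t) \<longlongrightarrow> 0) (at_left \<tau>)"
    "\<And>s t. q \<le> s \<Longrightarrow> s \<le> t \<Longrightarrow> t < \<tau> \<Longrightarrow>
      (w n t - w k t) - (w n s - w k s) + integral {s..t} (\<lambda>r. \<kappa> / (X n r - X k r) - real (C::nat))
        \<le> (X n t - X k t) - (X n s - X k s)"
proof -
  have order: "X j t < X i t" if "j < i" "i < N" "t \<in> {0..<\<tau>}" for i j t
  proof -
    have "strict_mono_on {..<N} (\<lambda>i. X i t)" using X[OF that(3)] that(3) unfolding osol_def by auto
    then show ?thesis using strict_mono_onD[of "{..<N}" "\<lambda>i. X i t" j i] that by simp
  qed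
  have l_mono: "l j \<le> l i" if "j \<le> i" "i < N" for i j
  proof (cases "j = i")
    case False
    have "\<forall>\<^sub>F t in at_left \<tau>. X j t \<le> X i t"
      using eventually_at_left_real[OF \<tau>]
      by eventually_elim (use order[of j i] that False in \<open>auto intro: less_imp_le\<close>)
    then show ?thesis using tendsto_le[of "at_left \<tau>" "X i" "l i" "X j" "l j"] l that by simp
  qed simp
  have eq: "l m' = l m" using coll l_mono[of m' m] by simp
  define S where "S = {j. j < N \<and> l j = l m}"
  have fS: "finite S" and mS: "m \<in> S" "m' \<in> S" using coll eq unfolding S_def by auto
  define k where "k = Min S"
  define n where "n = Max S"
  have kS: "k \<in> S" and nS: "n \<in> S" unfolding k_def n_def using fS mS by (auto intro: Min_in Max_in)
  have "k \<le> m'" "m \<le> n" unfolding k_def n_def using fS mS by auto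
  then have kn: "k < n" using coll by simp
  have nN: "n < N" using nS unfolding S_def by simp
  have lkn: "l k = l m" "l n = l m" using kS nS unfolding S_def by auto
  have lt_k: "l j < l k" if "j < k" for j
  proof -
    have "j \<notin> S" using that Min_le[OF fS, of j] unfolding k_def by force
    then have "l j \<noteq> l k" using that kn nN lkn unfolding S_def by auto
    then show ?thesis using l_mono[of j k] that kn nN by simp
  qed
  have gt_n: "l n < l j" if "n < j" "j < N" for j
  proof -
    have "j \<notin> S" using that Max_ge[OF fS, of j] unfolding n_def by force
    then have "l j \<noteq> l n" using that lkn unfolding S_def by auto
    then show ?thesis using l_mono[of n j] that by simp
  qed
  have "\<exists>r>0. \<forall>j\<in>{..<N}. (j < k \<longrightarrow> r < l k - l j) \<and> (n < j \<longrightarrow> r < l j - l n)"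
  proof (rule finite_common_pos)
    fix j assume "j \<in> {..<N}"
    then show "\<exists>r>0. (j < k \<longrightarrow> r < l k - l j) \<and> (n < j \<longrightarrow> r < l j - l n)"
      using lt_k[of j] gt_n[of j] kn dense[of 0 "l k - l j"] dense[of 0 "l j - l n"] gt_ex[of "0::real"]
      by (cases "j < k"; cases "n < j") auto
  qed auto
  then obtain r where r: "0 < r" "\<And>j. j < k \<Longrightarrow> r < l k - l j" "\<And>j. n < j \<Longrightarrow> j < N \<Longrightarrow> r < l j - l n"
    using kn nN by (metis lessThan_iff less_trans)
  have D0: "((\<lambda>t. X n t - X k t) \<longlongrightarrow> 0) (at_left \<tau>)"
    using tendsto_diff[OF l[OF nN] l[of k]] kn nN lkn by simp
  have "\<forall>\<^sub>F t in at_left \<tau>. \<forall>j\<in>{..<k}. r < X k t - X j t"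
  proof (intro eventually_ball_finite ballI)
    fix j assume j: "j \<in> {..<k}"
    have "((\<lambda>t. X k t - X j t) \<longlongrightarrow> l k - l j) (at_left \<tau>)" using j kn nN by (intro tendsto_intros l) auto
    then show "\<forall>\<^sub>F t in at_left \<tau>. r < X k t - X j t" using r(2) j by (intro order_tendstoD(1)) auto
  qed simp
  moreover have "\<forall>\<^sub>F t in at_left \<tau>. \<forall>j\<in>{n<..<N}. r < X j t - X n t"
  proof (intro eventually_ball_finite ballI)
    fix j assume j: "j \<in> {n<..<N}"
    have "((\<lambda>t. X j t - X n t) \<longlongrightarrow> l j - l n) (at_left \<tau>)" using j nN by (intro tendsto_intros l) auto
    then show "\<forall>\<^sub>F t in at_left \<tau>. r < X j t - X n t" using r(3) j by (intro order_tendstoD(1)) auto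
  qed simp
  moreover have "\<forall>\<^sub>F t in at_left \<tau>. X n t - X k t < min 1 \<eta>"
    using D0 rep(1) by (intro order_tendstoD(2)) auto
  ultimately have "\<forall>\<^sub>F t in at_left \<tau>. (\<forall>j\<in>{..<k}. r < X k t - X j t) \<and>
      (\<forall>j\<in>{n<..<N}. r < X j t - X n t) \<and> X n t - X k t < min 1 \<eta>"
    by eventually_elim simp
  then obtain q where q: "q \<in> \<rat>" "0 \<le> q" "q < \<tau>"
    and near: "\<And>t. q \<le> t \<Longrightarrow> t < \<tau> \<Longrightarrow> (\<forall>j\<in>{..<k}. r < X k t - X j t) \<and>
      (\<forall>j\<in>{n<..<N}. r < X j t - X n t) \<and> X n t - X k t < min 1 \<eta>"
    by (rule at_left_rational_tail[OF _ \<tau>]) blast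
  \<comment> \<open>Rounding up to a natural number leaves countably many possible constants,
    although \<open>r\<close> depends on the path.\<close>
  obtain C :: nat where C: "L + 2 * r powr (- \<alpha>) \<le> real C" using real_arch_simple by blast
  show ?thesis
  proof (rule that[OF kn nN q D0, of C])
    fix s t assume st: "q \<le> s" "s \<le> t" "t < \<tau>"
    have t0: "0 \<le> t" using st q by simp
    have k: "k < N" using kn nN by simp
    obtain \<delta> where \<delta>: "0 < \<delta>" "\<And>u. u \<in> {0..t} \<Longrightarrow> gapped N \<delta> (\<lambda>i. X i u)" "solves N (tdrift \<delta>) t w X"
      by (rule osol_gapped[OF t0 X[of t]]) (use st t0 in auto)
    have cX: "continuous_on {0..t} (X i)" if "i < N" for i by (rule solvesD(1)[OF \<delta>(3) that])
    define b where "b i u = tdrift \<delta> (\<lambda>j. X j u) i" for i u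
    have cb: "continuous_on {0..t} (b i)" if "i < N" for i
      unfolding b_def by (rule sum_lipschitz_continuous[OF tdrift_lipschitz[OF \<delta>(1)] that cX])
    have sub: "{s..t} \<subseteq> {0..t}" using st q by auto
    have incr: "(X i t - w i t) - (X i s - w i s) = integral {s..t} (b i)" if i: "i < N" for i
      unfolding b_def
      by (rule solves_increment[OF \<delta>(3) tdrift_lipschitz[OF \<delta>(1)] i _ st(2) order_refl]) (use st q in simp)
    have "integral {s..t} (\<lambda>u. \<kappa> / (X n u - X k u) - real C) \<le> integral {s..t} (\<lambda>u. b n u - b k u)"
    proof (rule integral_le)
      have "X n u - X k u \<noteq> 0" if "u \<in> {s..t}" for u using order[OF kn nN, of u] that st q by auto
      then show "(\<lambda>u. \<kappa> / (X n u - X k u) - real C) integrable_on {s..t}"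
        by (intro integrable_continuous_real continuous_intros continuous_on_subset[OF cX sub] nN k) auto
      show "(\<lambda>u. b n u - b k u) integrable_on {s..t}"
        by (intro integrable_continuous_real continuous_intros continuous_on_subset[OF cb sub] nN k)
      fix u assume u: "u \<in> {s..t}"
      have nu: "\<forall>j\<in>{..<k}. r < X k u - X j u" "\<forall>j\<in>{n<..<N}. r < X j u - X n u" "X n u - X k u < min 1 \<eta>"
        using near[of u] u st by auto
      have pos: "0 < X n u - X k u" using order[OF kn nN, of u] u st q by auto
      have "\<kappa> / (X n u - X k u) - (L + 2 * r powr (- \<alpha>)) \<le> tdrift \<delta> (\<lambda>j. X j u) n - tdrift \<delta> (\<lambda>j. X j u) k"
        by (rule cluster_drift[OF \<delta>(1) \<delta>(2) kn nN r(1)])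
          (use u sub nu pos rep(2) in \<open>auto intro: less_imp_le\<close>)
      then show "\<kappa> / (X n u - X k u) - real C \<le> b n u - b k u" using C unfolding b_def by linarith
    qed
    also have "\<dots> = integral {s..t} (b n) - integral {s..t} (b k)"
      by (intro integral_diff integrable_continuous_real continuous_on_subset[OF cb sub] nN k)
    finally show "(w n t - w k t) - (w n s - w k s) + integral {s..t} (\<lambda>r. \<kappa> / (X n r - X k r) - real C)
        \<le> (X n t - X k t) - (X n s - X k s)"
      using incr[OF nN] incr[OF k] by linarith
  qed
qed

text \<open>All probability is confined to \<open>nocoll\<close>. At a time \<open>\<tau>\<close> to
  be reached the solution has left limits. If they are distinct it can be closed; if two coincide,
  the corresponding chain collapses at every level \<open>\<epsilon>\<close> for one choice of
  \<open>k\<close>, \<open>n\<close>, \<open>q\<close>, \<open>C\<close>, \<open>T\<close>,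
  \<open>z\<close>, which \<open>nocoll\<close> excludes.\<close>

lemma osol_global:
  assumes w: "\<And>i. i < N \<Longrightarrow> continuous_on {0..} (w i)" and w0: "strict_mono_on {..<N} (\<lambda>i. w i 0)"
    and rep: "0 < \<eta>" "\<And>d. 0 < d \<Longrightarrow> d \<le> \<eta> \<Longrightarrow> \<kappa> / d \<le> 2 / real N * d powr (- \<alpha>)" and \<kappa>: "0 \<le> \<kappa>"
    and nocoll: "\<And>k n q C T z. k < n \<Longrightarrow> n < N \<Longrightarrow> q \<in> \<rat> \<Longrightarrow> 0 \<le> q \<Longrightarrow> q < real T \<Longrightarrow> z \<in> \<rat> \<Longrightarrow> 0 < z \<Longrightarrow>
      \<exists>\<epsilon>>0. \<not> (collapses \<kappa> (real (C::nat)) \<epsilon> z (real T) q (\<lambda>t. w n t - w k t))"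
    and T: "0 \<le> T"
  shows "\<exists>X. osol T w X"
proof -
  have "T \<in> {0..T}" using T by simp
  then show ?thesis
  proof (induction rule: interval_induct)
    case start
    have "osol 0 w w" unfolding osol_def solves_def using w0 by (auto simp: has_integral_refl)
    then show ?case by (rule exI[of _ w])
  next
    case (open_step t)
    then have t: "0 \<le> t" by simp
    obtain X where "osol t w X" using open_step.IH[of t] t by auto
    from osol_extend[OF w t this] show ?case by auto
  next
    case (closed_step \<tau>)
    then have \<tau>: "0 < \<tau>" by simp
    obtain X where X: "\<And>s. s \<in> {0..<\<tau>} \<Longrightarrow> osol s w X"
      by (rule osol_glue[of \<tau> w]) (use closed_step.IH in blast)+
    have "\<exists>l. (X i \<longlongrightarrow> l) (at_left \<tau>)" if "i < N" for i
      by (rule solution_left_limit[OF w \<tau> X that])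
    then obtain l where l: "\<And>i. i < N \<Longrightarrow> (X i \<longlongrightarrow> l i) (at_left \<tau>)" by metis
    show ?case
    proof (cases "\<forall>i j. j < i \<longrightarrow> i < N \<longrightarrow> l j < l i")
      case True
      then show ?thesis by (intro osol_close[OF w \<tau> X l]) auto
    next
      case False
      then obtain m m' where m: "m' < m" "m < N" "\<not> l m' < l m" by blast
      obtain k n q C where c: "k < n" "n < N" "q \<in> \<rat>" "0 \<le> q" "q < \<tau>"
        "((\<lambda>t. X n t - X k t) \<longlongrightarrow> 0) (at_left \<tau>)"
        "\<And>s t. q \<le> s \<Longrightarrow> s \<le> t \<Longrightarrow> t < \<tau> \<Longrightarrow>
          (w n t - w k t) - (w n s - w k s) + integral {s..t} (\<lambda>r. \<kappa> / (X n r - X k r) - real (C::nat))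
            \<le> (X n t - X k t) - (X n s - X k s)"
        by (rule collision_supersolution[where w = w and X = X and l = l and \<tau> = \<tau> and \<kappa> = \<kappa> and \<eta> = \<eta>, OF _ \<tau> _ _ m rep(1)])
          (use w X l rep(2) in blast)+
      have pos: "0 < X n t - X k t" if t: "t \<in> {q..<\<tau>}" for t
      proof -
        have "strict_mono_on {..<N} (\<lambda>i. X i t)" using X[of t] t c(4) unfolding osol_def by auto
        then show ?thesis using strict_mono_onD[of "{..<N}" "\<lambda>i. X i t" k n] c(1,2) by simp
      qed
      have cX: "continuous_on {q..<\<tau>} (X i)" if i: "i < N" for i
        unfolding continuous_on_eq_continuous_within
      proof
        fix t assume t: "t \<in> {q..<\<tau>}"
        define s where "s = (t + \<tau>) / 2"
        have s: "t < s" "s < \<tau>" "s \<in> {0..<\<tau>}" using t c(4) unfolding s_def by auto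
        have "solves N (drift N U' \<alpha>) s w X" using X[OF s(3)] unfolding osol_def by blast
        from solvesD(1)[OF this i] have "continuous_on ({q..<\<tau>} \<inter> {..<s}) (X i)"
          by (rule continuous_on_subset) (use c(4) in auto)
        then have "continuous (at t within {q..<\<tau>} \<inter> {..<s}) (X i)"
          using t s unfolding continuous_on_eq_continuous_within by auto
        then show "continuous (at t within {q..<\<tau>}) (X i)"

          using at_within_nhd[of t "{..<s}" "{q..<\<tau>} \<inter> {..<s}" "{q..<\<tau>}"] s by (auto simp: continuous_within)
      qed
      obtain T' :: nat where T': "\<tau> \<le> real T'" using real_arch_simple by blast
      have "0 < X n q - X k q" using pos[of q] c(5) by simp
      \<comment> \<open>The comparison needs only a start below \<open>X n q - X k q\<close>, so a
        rational \<open>z\<close> will do.\<close>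
      then obtain z where z: "z \<in> \<rat>" "0 < z" "z < X n q - X k q" using Rats_dense_in_real by blast
      have coll: "collapses \<kappa> (real C) \<epsilon> z (real T') q (\<lambda>t. w n t - w k t)" if "0 < \<epsilon>" for \<epsilon>
      proof (rule chain_collapses[where D = "\<lambda>t. X n t - X k t" and \<tau> = \<tau>, OF that \<kappa> c(5) T' _ _ pos c(6,7)])
        show "continuous_on {q..} (\<lambda>t. w n t - w k t)"
          using c by (intro continuous_intros continuous_on_subset[OF w]) auto
        show "continuous_on {q..<\<tau>} (\<lambda>t. X n t - X k t)"
          using c(1,2) by (intro continuous_intros cX) auto
        show "z \<le> X n q - X k q" using z by simp
      qed
      have "q < real T'" using c(5) T' by simp
      then obtain \<epsilon> where "0 < \<epsilon>" "\<not> (collapses \<kappa> (real C) \<epsilon> z (real T') q (\<lambda>t. w n t - w k t))"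
        using nocoll[OF c(1,2,3,4) _ z(1,2), of T' C] by blast
      then show ?thesis using coll by blast
    qed
  qed
qed

end

section \<open>The Euler chain rarely collapses\<close>

lemma ln_one_plus_ge:
  fixes x :: real
  assumes "- 1 / 2 \<le> x"
  shows "x - x\<^sup>2 / 2 - \<bar>x\<bar> ^ 3 \<le> ln (1 + x)"
proof (cases "0 \<le> x")
  case True
  have "ln (1 + 0) - 0 + 0\<^sup>2 / 2 \<le> ln (1 + x) - x + x\<^sup>2 / 2"
  proof (rule DERIV_nonneg_imp_nondecreasing[where f = "\<lambda>x::real. ln (1 + x) - x + x\<^sup>2 / 2", OF True])
    fix y :: real assume y: "0 \<le> y" "y \<le> x"
    have "((\<lambda>x. ln (1 + x) - x + x\<^sup>2 / 2) has_real_derivative (1 / (1 + y) - 1 + y)) (at y)"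
      using y by (auto intro!: derivative_eq_intros)
    moreover have "1 / (1 + y) - 1 + y = y\<^sup>2 / (1 + y)" using y by (simp add: field_simps power2_eq_square)
    ultimately show "\<exists>d. ((\<lambda>x. ln (1 + x) - x + x\<^sup>2 / 2) has_real_derivative d) (at y) \<and> 0 \<le> d"
      using y by (intro exI[of _ "1 / (1 + y) - 1 + y"]) auto
  qed
  then have "0 \<le> ln (1 + x) - x + x\<^sup>2 / 2" by simp
  moreover have "0 \<le> \<bar>x\<bar> ^ 3" by simp
  ultimately show ?thesis by linarith
next
  case False
  \<comment> \<open>The coefficient 2/3 contributes \<open>- 2 * y\<^sup>2\<close> to the
    derivative, which beats \<open>y\<^sup>2 / (1 + y)\<close> because \<open>1 + y\<close> is at
    least 1/2.\<close>
  let ?f = "\<lambda>x::real. ln (1 + x) - x + x\<^sup>2 / 2 - 2 / 3 * x ^ 3"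
  have "?f 0 \<le> ?f x"
  proof (rule DERIV_nonpos_imp_nonincreasing[where f = ?f])
    show "x \<le> 0" using False by simp
    fix y :: real assume y: "x \<le> y" "y \<le> 0"
    have y1: "1 / 2 \<le> 1 + y" using y assms by simp
    have "(?f has_real_derivative (1 / (1 + y) - 1 + y - 2 * y\<^sup>2)) (at y)"
      using y1 by (auto intro!: derivative_eq_intros)
    moreover have "1 / (1 + y) - 1 + y = y\<^sup>2 * (1 / (1 + y))" using y1 by (simp add: field_simps power2_eq_square)
    moreover have "y\<^sup>2 * (1 / (1 + y)) \<le> y\<^sup>2 * 2" using y1 by (intro mult_left_mono) (auto simp: field_simps)
    ultimately show "\<exists>d. (?f has_real_derivative d) (at y) \<and> d \<le> 0"
      by (intro exI[of _ "1 / (1 + y) - 1 + y - 2 * y\<^sup>2"]) auto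
  qed
  then have "x - x\<^sup>2 / 2 + 2 / 3 * x ^ 3 \<le> ln (1 + x)" by simp
  moreover have "\<bar>x\<bar> ^ 3 = - (x ^ 3)" using False by (simp add: abs_if power3_eq_cube)
  moreover have "0 \<le> \<bar>x\<bar> ^ 3" by simp
  ultimately show ?thesis by linarith
qed

text \<open>For \<open>D \<ge> - z / 2\<close> this is \<open>ln_one_plus_ge\<close> rescaled. A
  larger downward jump is paid for by the cubic term alone: from
  \<open>\<bar>D\<bar> \<ge> z / 2\<close> it is at least \<open>2 * (z / \<epsilon>) ^ 3\<close>,
  which exceeds the largest possible drop, from \<open>ln z\<close> to
  \<open>ln (\<epsilon> / 2)\<close>. This case fixes the constant 16.\<close>

lemma ln_max_taylor:
  fixes z D :: real
  assumes \<epsilon>: "0 < \<epsilon>" and z: "\<epsilon> \<le> z"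
  shows "ln z + D / z - D\<^sup>2 / (2 * z\<^sup>2) - 16 / \<epsilon> ^ 3 * \<bar>D\<bar> ^ 3 \<le> ln (max (z + D) (\<epsilon> / 2))"
proof (cases "- 1 / 2 \<le> D / z")
  case True
  have z0: "0 < z" using assms by simp
  then have zD: "0 < z + D" using True by (simp add: field_simps)
  have e: "z + D = z * (1 + D / z)" using z0 by (simp add: field_simps)
  have "ln (z + D) = ln z + ln (1 + D / z)"
    using z0 True unfolding e by (intro ln_mult_pos) auto
  moreover have "ln (z + D) \<le> ln (max (z + D) (\<epsilon> / 2))" using zD by simp
  moreover have "\<bar>D / z\<bar> ^ 3 \<le> 16 / \<epsilon> ^ 3 * \<bar>D\<bar> ^ 3"
  proof -
    have "\<bar>D / z\<bar> ^ 3 = \<bar>D\<bar> ^ 3 / z ^ 3" using z0 by (simp add: power_divide abs_divide)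
    also have "\<dots> \<le> \<bar>D\<bar> ^ 3 / \<epsilon> ^ 3" using assms by (intro divide_left_mono power_mono) auto
    also have "\<dots> \<le> 16 * (\<bar>D\<bar> ^ 3 / \<epsilon> ^ 3)"
    proof -
      have "0 \<le> \<bar>D\<bar> ^ 3 / \<epsilon> ^ 3" using \<epsilon> by simp
      then show ?thesis by linarith
    qed
    finally show ?thesis by simp
  qed
  moreover have "(D / z)\<^sup>2 / 2 = D\<^sup>2 / (2 * z\<^sup>2)" by (simp add: power_divide)
  ultimately show ?thesis using ln_one_plus_ge[OF True] by linarith
next
  case False
  have z0: "0 < z" using assms by simp
  have D: "D < - (z / 2)" using False z0 by (simp add: field_simps)
  have "(z / 2) ^ 3 \<le> \<bar>D\<bar> ^ 3" using D z0 by (intro power_mono) auto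
  then have "16 / \<epsilon> ^ 3 * (z / 2) ^ 3 \<le> 16 / \<epsilon> ^ 3 * \<bar>D\<bar> ^ 3" using \<epsilon> by (intro mult_left_mono) auto
  moreover have "16 / \<epsilon> ^ 3 * (z / 2) ^ 3 = 2 * (z / \<epsilon>) ^ 3" by (simp add: power_divide)
  moreover have "(z / \<epsilon>) ^ 1 \<le> (z / \<epsilon>) ^ 3" using assms by (intro power_increasing) auto
  ultimately have "2 * (z / \<epsilon>) \<le> 16 / \<epsilon> ^ 3 * \<bar>D\<bar> ^ 3" by simp
  moreover have "ln z - ln (\<epsilon> / 2) \<le> 2 * (z / \<epsilon>)"
  proof -
    have "ln z - ln (\<epsilon> / 2) = ln (z / (\<epsilon> / 2))" using z0 \<epsilon> by (subst ln_div) auto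
    also have "\<dots> \<le> z / (\<epsilon> / 2) - 1" using z0 \<epsilon> by (intro ln_le_minus_one) auto
    also have "z / (\<epsilon> / 2) = 2 * (z / \<epsilon>)" by simp
    finally show ?thesis by linarith
  qed
  moreover have "ln (\<epsilon> / 2) \<le> ln (max (z + D) (\<epsilon> / 2))" using \<epsilon> by simp
  moreover have "D / z < 0" using D z0 by (intro divide_neg_pos) auto
  moreover have "0 \<le> D\<^sup>2 / (2 * z\<^sup>2)" by simp
  ultimately show ?thesis by linarith
qed

text \<open>
  The logarithm is harmonic for the critical Bessel process.  The linear term compensates the drift
  \<open>- C\<close>, the quadratic term makes the function bounded above, uniformly in \<open>\<epsilon>\<close>, and the truncation
  at \<open>\<epsilon> / 2\<close> takes care of the overshoot below \<open>\<epsilon>\<close>.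
\<close>

definition lyapunov :: "real \<Rightarrow> real \<Rightarrow> real \<Rightarrow> real" where
  "lyapunov K \<epsilon> z = ln (max z (\<epsilon> / 2)) + K * z - z\<^sup>2"

lemma abs_add_cube_le:
  fixes a b :: real
  shows "\<bar>a + b\<bar> ^ 3 \<le> 4 * (\<bar>a\<bar> ^ 3 + \<bar>b\<bar> ^ 3)"
proof -
  define x y where "x = \<bar>a\<bar>" and "y = \<bar>b\<bar>"
  have xy: "0 \<le> x" "0 \<le> y" unfolding x_def y_def by auto
  have "\<bar>a + b\<bar> ^ 3 \<le> (x + y) ^ 3" unfolding x_def y_def by (intro power_mono) auto
  moreover have "4 * (x ^ 3 + y ^ 3) - (x + y) ^ 3 = 3 * (x + y) * (x - y)\<^sup>2"
    by (simp add: power2_eq_square power3_eq_cube algebra_simps)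
  moreover have "0 \<le> 3 * (x + y) * (x - y)\<^sup>2" using xy by simp
  ultimately show ?thesis unfolding x_def y_def by linarith
qed

text \<open>The expansion is sorted by powers of \<open>\<xi>\<close>, with coefficients that depend
  on \<open>z\<close> alone, so that independence can later factor each expectation. The 64 is the
  16 of \<open>ln_max_taylor\<close> times the 4 from splitting the cube of
  \<open>\<xi> + h * a\<close>.\<close>

lemma lyapunov_step:
  fixes z \<xi> h \<kappa> C \<epsilon> K :: real
  assumes \<epsilon>: "0 < \<epsilon>" and z: "\<epsilon> < z" and h: "0 \<le> h" and \<kappa>: "0 \<le> \<kappa>" and C: "0 \<le> C"
    and a: "a = \<kappa> / z - C" and p: "p = 1 / (2 * z\<^sup>2) + 1" and Bm: "Bm = \<kappa> / \<epsilon> + C"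
  shows "lyapunov K \<epsilon> z + ((1 / z + K - 2 * z) - 2 * p * h * a) * \<xi> - p * \<xi>\<^sup>2 + h * a * (1 / z + K - 2 * z)
      - (1 / (2 * \<epsilon>\<^sup>2) + 1) * (h * Bm)\<^sup>2 - 64 / \<epsilon> ^ 3 * (\<bar>\<xi>\<bar> ^ 3 + (h * Bm) ^ 3)
    \<le> lyapunov K \<epsilon> (z + \<xi> + h * a)"
proof -
  define D where "D = \<xi> + h * a"
  have z0: "0 < z" using assms by simp
  have "\<kappa> / z \<le> \<kappa> / \<epsilon>" using \<epsilon> z \<kappa> by (intro divide_left_mono) auto
  moreover have "0 \<le> \<kappa> / z" "0 \<le> \<kappa> / \<epsilon>" using z0 \<kappa> \<epsilon> by auto
  ultimately have aB: "\<bar>a\<bar> \<le> Bm" unfolding a Bm using C by (auto simp: abs_le_iff)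
  have haB: "\<bar>h * a\<bar> \<le> h * Bm" unfolding abs_mult using h aB by (intro mult_mono) auto
  have p0: "0 \<le> p" "p \<le> 1 / (2 * \<epsilon>\<^sup>2) + 1"
    unfolding p using z0 \<epsilon> z by (auto intro!: divide_left_mono power_mono)
  have "(h * a)\<^sup>2 \<le> (h * Bm)\<^sup>2" using haB by (rule power2_le_iff_abs_le[THEN iffD2, rotated]) (use h aB in auto)
  then have q: "p * (h * a)\<^sup>2 \<le> (1 / (2 * \<epsilon>\<^sup>2) + 1) * (h * Bm)\<^sup>2" using p0 by (intro mult_mono) auto
  have "\<bar>D\<bar> ^ 3 \<le> 4 * (\<bar>\<xi>\<bar> ^ 3 + \<bar>h * a\<bar> ^ 3)" unfolding D_def by (rule abs_add_cube_le)
  also have "\<dots> \<le> 4 * (\<bar>\<xi>\<bar> ^ 3 + (h * Bm) ^ 3)" using haB by (intro mult_left_mono add_left_mono power_mono) auto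
  finally have "16 / \<epsilon> ^ 3 * \<bar>D\<bar> ^ 3 \<le> 16 / \<epsilon> ^ 3 * (4 * (\<bar>\<xi>\<bar> ^ 3 + (h * Bm) ^ 3))"
    using \<epsilon> by (intro mult_left_mono) auto
  then have cube: "16 / \<epsilon> ^ 3 * \<bar>D\<bar> ^ 3 \<le> 64 / \<epsilon> ^ 3 * (\<bar>\<xi>\<bar> ^ 3 + (h * Bm) ^ 3)" by simp
  have "lyapunov K \<epsilon> z = ln z + K * z - z\<^sup>2" unfolding lyapunov_def using \<epsilon> z by (simp add: max_def)
  moreover have "lyapunov K \<epsilon> (z + D) \<ge> ln z + D / z - D\<^sup>2 / (2 * z\<^sup>2) - 16 / \<epsilon> ^ 3 * \<bar>D\<bar> ^ 3 + K * (z + D) - (z + D)\<^sup>2"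
    unfolding lyapunov_def using ln_max_taylor[OF \<epsilon>, of z D] z by linarith
  moreover have "D / z - D\<^sup>2 / (2 * z\<^sup>2) + K * (z + D) - (z + D)\<^sup>2
      = K * z - z\<^sup>2 + ((1 / z + K - 2 * z) - 2 * p * h * a) * \<xi> - p * \<xi>\<^sup>2 + h * a * (1 / z + K - 2 * z) - p * (h * a)\<^sup>2"
    unfolding p D_def using z0 by (simp add: field_simps power2_eq_square)
  ultimately have "lyapunov K \<epsilon> z + (((1 / z + K - 2 * z) - 2 * p * h * a) * \<xi> - p * \<xi>\<^sup>2 + h * a * (1 / z + K - 2 * z))
      - (1 / (2 * \<epsilon>\<^sup>2) + 1) * (h * Bm)\<^sup>2 - 64 / \<epsilon> ^ 3 * (\<bar>\<xi>\<bar> ^ 3 + (h * Bm) ^ 3) \<le> lyapunov K \<epsilon> (z + D)"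
    using q cube by linarith
  then show ?thesis unfolding D_def by (simp add: add.assoc)
qed

text \<open>Here \<open>V\<close> is the variance rate of the noise. The linear coefficient
  \<open>C / \<kappa>\<close> makes the terms in \<open>1 / z\<close> cancel, and those in
  \<open>1 / z\<^sup>2\<close> combine to \<open>(2 * \<kappa> - V) / (2 * z\<^sup>2)\<close>, which
  is where criticality enters. The unbounded remainder \<open>2 * C * z\<close> has the good
  sign.\<close>

lemma lyapunov_generator:
  fixes z \<kappa> C V :: real
  assumes z: "0 < z" and \<kappa>: "0 < \<kappa>" and C: "0 \<le> C" and V: "V \<le> 2 * \<kappa>"
  shows "- (V + C\<^sup>2 / \<kappa> + 2 * \<kappa>) \<le> (\<kappa> / z - C) * (1 / z + C / \<kappa> - 2 * z) - V * (1 / (2 * z\<^sup>2) + 1)"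
proof -
  have "(\<kappa> / z - C) * (1 / z + C / \<kappa> - 2 * z) - V * (1 / (2 * z\<^sup>2) + 1)
      = (2 * \<kappa> - V) / (2 * z\<^sup>2) + 2 * C * z - (V + C\<^sup>2 / \<kappa> + 2 * \<kappa>)"
    using z \<kappa> by (simp add: field_simps power2_eq_square)
  moreover have "0 \<le> (2 * \<kappa> - V) / (2 * z\<^sup>2)" "0 \<le> 2 * C * z" using z C V by auto
  ultimately show ?thesis by linarith
qed

text \<open>A stopped path carries the large negative value \<open>ln \<epsilon>\<close>, up to a
  bound free of \<open>\<epsilon>\<close>; elsewhere \<open>ln z \<le> z\<close> is absorbed by the
  square. With the lower bound on the expectation this limits the probability of being
  stopped.\<close>

lemma lyapunov_upper:
  fixes z K \<epsilon> :: real
  assumes \<epsilon>: "0 < \<epsilon>" and K: "0 \<le> K"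
  shows "lyapunov K \<epsilon> z \<le> (K + 1)\<^sup>2 + (if z \<le> \<epsilon> then ln \<epsilon> else 0)"
proof -
  have sq: "k * z - z\<^sup>2 \<le> k\<^sup>2" for k :: real
  proof -
    have "0 \<le> (k / 2 - z)\<^sup>2" by simp
    then have "k * z - z\<^sup>2 \<le> k\<^sup>2 / 4" by (simp add: power2_diff power_divide)
    moreover have "0 \<le> k\<^sup>2" by simp
    ultimately show ?thesis by linarith
  qed
  show ?thesis
  proof (cases "z \<le> \<epsilon>")
    case True
    have "ln (max z (\<epsilon> / 2)) \<le> ln \<epsilon>" using True \<epsilon> by simp
    moreover have "K\<^sup>2 \<le> (K + 1)\<^sup>2" using K by (intro power_mono) auto
    ultimately show ?thesis unfolding lyapunov_def using sq[of K] True by simp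
  next
    case False
    then have "ln (max z (\<epsilon> / 2)) = ln z" using \<epsilon> by (simp add: max_def)
    also have "\<dots> \<le> z" using False \<epsilon> ln_le_minus_one[of z] by simp
    finally show ?thesis unfolding lyapunov_def using sq[of "K + 1"] False by (simp add: algebra_simps)
  qed
qed

lemma lyapunov_abs_le:
  fixes z K \<epsilon> :: real
  assumes \<epsilon>: "0 < \<epsilon>" and K: "0 \<le> K"
  shows "\<bar>lyapunov K \<epsilon> z\<bar> \<le> \<bar>ln (\<epsilon> / 2)\<bar> + \<epsilon> + (1 + K) * \<bar>z\<bar> + z\<^sup>2"
proof -
  have "ln (\<epsilon> / 2) \<le> ln (max z (\<epsilon> / 2))" using \<epsilon> by simp
  moreover have "ln (max z (\<epsilon> / 2)) \<le> max z (\<epsilon> / 2) - 1" using \<epsilon> by (intro ln_le_minus_one) auto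
  moreover have "max z (\<epsilon> / 2) \<le> \<bar>z\<bar> + \<epsilon>" using \<epsilon> by auto
  ultimately have "\<bar>ln (max z (\<epsilon> / 2))\<bar> \<le> \<bar>ln (\<epsilon> / 2)\<bar> + \<epsilon> + \<bar>z\<bar>" using \<epsilon> by linarith
  moreover have "\<bar>K * z\<bar> = K * \<bar>z\<bar>" using K by (simp add: abs_mult)
  moreover have "\<bar>z\<^sup>2\<bar> = z\<^sup>2" by simp
  ultimately show ?thesis unfolding lyapunov_def by (simp only: distrib_right) linarith
qed

lemma lyapunov_measurable [measurable]: "lyapunov K \<epsilon> \<in> borel_measurable borel"
  unfolding lyapunov_def by measurable

text \<open>Here \<open>R\<close> bounds the absolute third moment of one noise increment. With
  \<open>R\<close> of order \<open>h\<close> to the power 3/2 the error is o(h) for fixed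
  \<open>\<epsilon>\<close>, so its sum over a bounded time interval vanishes with the mesh.\<close>

abbreviation step_error :: "real \<Rightarrow> real \<Rightarrow> real \<Rightarrow> real \<Rightarrow> real \<Rightarrow> real" where
  "step_error \<kappa> C \<epsilon> h R \<equiv> (1 / (2 * \<epsilon>\<^sup>2) + 1) * (h * (\<kappa> / \<epsilon> + C))\<^sup>2
     + 64 / \<epsilon> ^ 3 * (R + (h * (\<kappa> / \<epsilon> + C)) ^ 3)"

definition chain_step :: "real \<Rightarrow> real \<Rightarrow> real \<Rightarrow> real \<Rightarrow> real \<Rightarrow> real \<Rightarrow> real" where
  "chain_step \<kappa> C \<epsilon> h z \<xi> = (if z \<le> \<epsilon> then z else z + \<xi> + h * (\<kappa> / z - C))"

lemma chain_Suc: "chain \<kappa> C \<epsilon> z h \<xi> (Suc k) = chain_step \<kappa> C \<epsilon> h (chain \<kappa> C \<epsilon> z h \<xi> k) (\<xi> k)"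
  unfolding chain_step_def by simp

context prob_space
begin

section \<open>Expectation along the chain\<close>

text \<open>The scalar increment is written as a function \<open>f\<close> of a vector
  \<open>Y\<close> because independence from the past is given for the vector of all Brownian
  increments. \<open>X\<close> stands for a coefficient determined by the past.\<close>

lemma indep_set_product:
  fixes X :: "'a \<Rightarrow> real" and f :: "'b \<Rightarrow> real"
  assumes G: "subalgebra M G" and Y: "Y \<in> measurable M S"
    and ind: "indep_set (sets G) (sets (vimage_algebra (space M) Y S))"
    and X: "X \<in> borel_measurable G" and f: "f \<in> borel_measurable S"
    and iX: "integrable M X" and iY: "integrable M (\<lambda>\<omega>. f (Y \<omega>))"
  shows "integrable M (\<lambda>\<omega>. X \<omega> * f (Y \<omega>))"
    and "expectation (\<lambda>\<omega>. X \<omega> * f (Y \<omega>)) = expectation X * expectation (\<lambda>\<omega>. f (Y \<omega>))"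
proof -
  have sG: "space G = space M" using G unfolding subalgebra_def by simp
  have XM: "X \<in> borel_measurable M" using measurable_from_subalg[OF G X] .
  have fY: "(\<lambda>\<omega>. f (Y \<omega>)) \<in> borel_measurable M" using measurable_compose[OF Y f] .
  have "indep_var borel X borel (\<lambda>\<omega>. f (Y \<omega>))"
    unfolding indep_var_eq
  proof (intro conjI XM fY)
    have 1: "sigma_sets (space M) {X -` A \<inter> space M |A. A \<in> sets borel} \<subseteq> sets G"
    proof -
      have "{X -` A \<inter> space M |A. A \<in> sets borel} \<subseteq> sets G"
        using measurable_sets[OF X] unfolding sG by auto
      then show ?thesis using sets.sigma_sets_subset[of _ G] unfolding sG by blast
    qed
    have 2: "sigma_sets (space M) {(\<lambda>\<omega>. f (Y \<omega>)) -` A \<inter> space M |A. A \<in> sets borel}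
      \<subseteq> sets (vimage_algebra (space M) Y S)"
    proof -
      have "(\<lambda>\<omega>. f (Y \<omega>)) -` A \<inter> space M \<in> sets (vimage_algebra (space M) Y S)" if "A \<in> sets borel" for A
      proof -
        have "(\<lambda>\<omega>. f (Y \<omega>)) -` A \<inter> space M = Y -` (f -` A \<inter> space S) \<inter> space M"
          using measurable_space[OF Y] by auto
        then show ?thesis using in_vimage_algebra[OF measurable_sets[OF f that], of Y "space M"] by simp
      qed
      then have "{(\<lambda>\<omega>. f (Y \<omega>)) -` A \<inter> space M |A. A \<in> sets borel} \<subseteq> sets (vimage_algebra (space M) Y S)"
        by auto
      then show ?thesis using sets.sigma_sets_subset[of _ "vimage_algebra (space M) Y S"] by simp
    qed
    show "indep_set (sigma_sets (space M) {X -` A \<inter> space M |A. A \<in> sets borel})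
      (sigma_sets (space M) {(\<lambda>\<omega>. f (Y \<omega>)) -` A \<inter> space M |A. A \<in> sets borel})"
      unfolding indep_set_def
      by (rule indep_sets_mono_sets[OF ind[unfolded indep_set_def]]) (use 1 2 in \<open>auto split: bool.split\<close>)
  qed
  from indep_var_integrable[OF this iX iY] indep_var_lebesgue_integral[OF this iX iY]
  show "integrable M (\<lambda>\<omega>. X \<omega> * f (Y \<omega>))"
    "expectation (\<lambda>\<omega>. X \<omega> * f (Y \<omega>)) = expectation X * expectation (\<lambda>\<omega>. f (Y \<omega>))" by auto
qed

text \<open>Taking expectations in \<open>lyapunov_step\<close>, independence removes the term
  linear in \<open>\<xi>\<close> and replaces the square of \<open>\<xi>\<close> by
  \<open>V * h\<close>; \<open>lyapunov_generator\<close> then bounds the sum of the drift and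
  variance terms.\<close>

lemma chain_step_expectation:
  fixes Z \<xi> :: "'a \<Rightarrow> real" and f :: "'b \<Rightarrow> real"
  assumes G: "subalgebra M G" and Y: "Y \<in> measurable M S"
    and ind: "indep_set (sets G) (sets (vimage_algebra (space M) Y S))"
    and f: "f \<in> borel_measurable S" and \<xi>: "\<And>\<omega>. \<omega> \<in> space M \<Longrightarrow> \<xi> \<omega> = f (Y \<omega>)"
    and m2: "integrable M (\<lambda>\<omega>. (\<xi> \<omega>)\<^sup>2)" "expectation (\<lambda>\<omega>. (\<xi> \<omega>)\<^sup>2) = V * h"
    and m1: "expectation \<xi> = 0"
    and m3: "integrable M (\<lambda>\<omega>. \<bar>\<xi> \<omega>\<bar> ^ 3)" "expectation (\<lambda>\<omega>. \<bar>\<xi> \<omega>\<bar> ^ 3) \<le> R"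
    and Z: "Z \<in> borel_measurable G" and Z2: "integrable M (\<lambda>\<omega>. (Z \<omega>)\<^sup>2)"
    and \<epsilon>: "0 < \<epsilon>" and \<kappa>: "0 < \<kappa>" and C: "0 \<le> C" and h: "0 \<le> h" and V: "V \<le> 2 * \<kappa>"
  shows "integrable M (\<lambda>\<omega>. (chain_step \<kappa> C \<epsilon> h (Z \<omega>) (\<xi> \<omega>))\<^sup>2)"
    and "integrable M (\<lambda>\<omega>. lyapunov (C / \<kappa>) \<epsilon> (Z \<omega>))"
    and "expectation (\<lambda>\<omega>. lyapunov (C / \<kappa>) \<epsilon> (Z \<omega>)) - h * (\<bar>V\<bar> + C\<^sup>2 / \<kappa> + 2 * \<kappa>)
      - step_error \<kappa> C \<epsilon> h R
      \<le> expectation (\<lambda>\<omega>. lyapunov (C / \<kappa>) \<epsilon> (chain_step \<kappa> C \<epsilon> h (Z \<omega>) (\<xi> \<omega>)))"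
proof -
  define K where "K = C / \<kappa>"
  have K: "0 \<le> K" unfolding K_def using C \<kappa> by simp
  define Bm where "Bm = \<kappa> / \<epsilon> + C"
  have Bm: "0 \<le> Bm" unfolding Bm_def using C \<kappa> \<epsilon> by simp
  have fY: "(\<lambda>\<omega>. f (Y \<omega>)) \<in> borel_measurable M" using measurable_compose[OF Y f] .
  have \<xi>M [measurable]: "\<xi> \<in> borel_measurable M" using fY by (rule measurable_cong[THEN iffD2, rotated]) (rule \<xi>)
  have ZM [measurable]: "Z \<in> borel_measurable M" using measurable_from_subalg[OF G Z] .
  note Z [measurable]
  have Z1: "integrable M Z" by (rule square_integrable_imp_integrable[OF ZM Z2])
  have \<xi>1: "integrable M \<xi>" by (rule square_integrable_imp_integrable[OF \<xi>M m2(1)])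
  define Z' where "Z' \<omega> = chain_step \<kappa> C \<epsilon> h (Z \<omega>) (\<xi> \<omega>)" for \<omega>
  have Z'M [measurable]: "Z' \<in> borel_measurable M" unfolding Z'_def chain_step_def by measurable
  have drift_bd: "\<bar>\<kappa> / z - C\<bar> \<le> Bm" if "\<epsilon> < z" for z
  proof -
    have "\<kappa> / z \<le> \<kappa> / \<epsilon>" using \<epsilon> that \<kappa> by (intro divide_left_mono) auto
    moreover have "0 \<le> \<kappa> / z" "0 \<le> \<kappa> / \<epsilon>" using that \<kappa> \<epsilon> by auto
    ultimately show ?thesis unfolding Bm_def using C by (auto simp: abs_le_iff)
  qed
  have Z'2: "integrable M (\<lambda>\<omega>. (Z' \<omega>)\<^sup>2)"
  proof (rule Bochner_Integration.integrable_bound)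
    show "integrable M (\<lambda>\<omega>. 3 * ((Z \<omega>)\<^sup>2 + (\<xi> \<omega>)\<^sup>2 + (h * Bm)\<^sup>2))" using Z2 m2(1) by simp
    show "(\<lambda>\<omega>. (Z' \<omega>)\<^sup>2) \<in> borel_measurable M" by measurable
    have three: "(a + b + c)\<^sup>2 \<le> 3 * (a\<^sup>2 + b\<^sup>2 + c\<^sup>2)" for a b c :: real
    proof -
      have "3 * (a\<^sup>2 + b\<^sup>2 + c\<^sup>2) - (a + b + c)\<^sup>2 = (a - b)\<^sup>2 + (b - c)\<^sup>2 + (a - c)\<^sup>2"
        by (simp add: power2_eq_square algebra_simps)
      moreover have "0 \<le> (a - b)\<^sup>2 + (b - c)\<^sup>2 + (a - c)\<^sup>2" by simp
      ultimately show ?thesis by linarith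
    qed
    have "(Z' \<omega>)\<^sup>2 \<le> 3 * ((Z \<omega>)\<^sup>2 + (\<xi> \<omega>)\<^sup>2 + (h * Bm)\<^sup>2)" for \<omega>
    proof (cases "Z \<omega> \<le> \<epsilon>")
      case True
      have "0 \<le> (Z \<omega>)\<^sup>2" "0 \<le> (\<xi> \<omega>)\<^sup>2" "0 \<le> (h * Bm)\<^sup>2" by auto
      then show ?thesis using True unfolding Z'_def chain_step_def by simp
    next
      case False
      have "(Z' \<omega>)\<^sup>2 \<le> 3 * ((Z \<omega>)\<^sup>2 + (\<xi> \<omega>)\<^sup>2 + (h * (\<kappa> / Z \<omega> - C))\<^sup>2)"
        using three False unfolding Z'_def chain_step_def by simp
      moreover have "(h * (\<kappa> / Z \<omega> - C))\<^sup>2 \<le> (h * Bm)\<^sup>2"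
        using drift_bd[of "Z \<omega>"] False h Bm by (intro abs_le_square_iff[THEN iffD1]) (auto simp: abs_mult intro!: mult_mono)
      then have "3 * ((Z \<omega>)\<^sup>2 + (\<xi> \<omega>)\<^sup>2 + (h * (\<kappa> / Z \<omega> - C))\<^sup>2) \<le> 3 * ((Z \<omega>)\<^sup>2 + (\<xi> \<omega>)\<^sup>2 + (h * Bm)\<^sup>2)"
        by (intro mult_left_mono add_left_mono) auto
      ultimately show ?thesis by (rule order_trans)
    qed
    then show "AE \<omega> in M. norm ((Z' \<omega>)\<^sup>2) \<le> norm (3 * ((Z \<omega>)\<^sup>2 + (\<xi> \<omega>)\<^sup>2 + (h * Bm)\<^sup>2))" by simp
  qed
  have Z'1: "integrable M Z'" by (rule square_integrable_imp_integrable[OF Z'M Z'2])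
  have lyap_int: "integrable M (\<lambda>\<omega>. lyapunov K \<epsilon> (W \<omega>))"
    if [measurable]: "W \<in> borel_measurable M" and W: "integrable M W" "integrable M (\<lambda>\<omega>. (W \<omega>)\<^sup>2)" for W
  proof (rule Bochner_Integration.integrable_bound)
    show "integrable M (\<lambda>\<omega>. \<bar>ln (\<epsilon> / 2)\<bar> + \<epsilon> + (1 + K) * \<bar>W \<omega>\<bar> + (W \<omega>)\<^sup>2)" using W by simp
    show "AE \<omega> in M. norm (lyapunov K \<epsilon> (W \<omega>)) \<le> norm (\<bar>ln (\<epsilon> / 2)\<bar> + \<epsilon> + (1 + K) * \<bar>W \<omega>\<bar> + (W \<omega>)\<^sup>2)"
    proof (rule AE_I2)
      fix \<omega>
      show "norm (lyapunov K \<epsilon> (W \<omega>)) \<le> norm (\<bar>ln (\<epsilon> / 2)\<bar> + \<epsilon> + (1 + K) * \<bar>W \<omega>\<bar> + (W \<omega>)\<^sup>2)"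
        using lyapunov_abs_le[OF \<epsilon> K, of "W \<omega>"] by simp
    qed
  qed measurable
  \<comment> \<open>These coefficients vanish where the chain is stopped. The inequality between
    \<open>?r\<close> and the next value then holds at every sample point, since the error terms are
    only subtracted.\<close>
  define p where "p z = (if z \<le> \<epsilon> then 0 else 1 / (2 * z\<^sup>2) + 1)" for z :: real
  define g where "g z = (if z \<le> \<epsilon> then 0 else (1 / z + K - 2 * z) - 2 * (1 / (2 * z\<^sup>2) + 1) * h * (\<kappa> / z - C))" for z
  define b where "b z = (if z \<le> \<epsilon> then 0 else (\<kappa> / z - C) * (1 / z + K - 2 * z))" for z
  have pm [measurable]: "p \<in> borel_measurable borel" unfolding p_def by measurable
  have gm [measurable]: "g \<in> borel_measurable borel" unfolding g_def by measurable
  have bm [measurable]: "b \<in> borel_measurable borel" unfolding b_def by measurable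
  let ?P = "1 / (2 * \<epsilon>\<^sup>2) + 1"
  have p_bd: "0 \<le> p z" "p z \<le> ?P" for z
  proof -
    show "0 \<le> p z" unfolding p_def by simp
    show "p z \<le> ?P"
      unfolding p_def using \<epsilon> by (auto intro!: divide_left_mono power_mono mult_pos_pos simp: not_le)
  qed
  have ev_bd: "\<bar>1 / z + K - 2 * z\<bar> \<le> 1 / \<epsilon> + K + 2 * \<bar>z\<bar>" if "\<epsilon> < z" for z
  proof -
    have "1 / z \<le> 1 / \<epsilon>" "0 \<le> 1 / z" using \<epsilon> that by (auto intro!: divide_left_mono)
    then show ?thesis using K by linarith
  qed
  have g_bd: "\<bar>g z\<bar> \<le> 1 / \<epsilon> + K + 2 * \<bar>z\<bar> + 2 * ?P * h * Bm" for z
  proof (cases "z \<le> \<epsilon>")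
    case True
    have "0 \<le> 1 / \<epsilon>" "0 \<le> 2 * ?P * h * Bm" using \<epsilon> h Bm by auto
    then show ?thesis unfolding g_def using True K by simp
  next
    case False
    have "\<bar>2 * p z * h * (\<kappa> / z - C)\<bar> \<le> 2 * ?P * h * Bm"
      unfolding abs_mult using p_bd[of z] h Bm drift_bd[of z] False
      by (intro mult_mono) auto
    then show ?thesis using ev_bd[of z] False unfolding g_def p_def by simp
  qed
  have b_bd: "\<bar>b z\<bar> \<le> Bm * (1 / \<epsilon> + K + 2 * \<bar>z\<bar>)" for z
  proof (cases "z \<le> \<epsilon>")
    case True
    then show ?thesis unfolding b_def using Bm K \<epsilon> by simp
  next
    case False
    then show ?thesis unfolding b_def using ev_bd[of z] drift_bd[of z] Bm by (auto simp: abs_mult intro!: mult_mono)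
  qed
  have ip: "integrable M (\<lambda>\<omega>. p (Z \<omega>))"
    using p_bd by (intro integrable_const_bound[of _ ?P]) auto
  have ig: "integrable M (\<lambda>\<omega>. g (Z \<omega>))"
  proof (rule Bochner_Integration.integrable_bound)
    show "integrable M (\<lambda>\<omega>. 1 / \<epsilon> + K + 2 * \<bar>Z \<omega>\<bar> + 2 * ?P * h * Bm)" using Z1 by simp
    show "AE \<omega> in M. norm (g (Z \<omega>)) \<le> norm (1 / \<epsilon> + K + 2 * \<bar>Z \<omega>\<bar> + 2 * ?P * h * Bm)"
      by (rule AE_I2) (use g_bd abs_ge_self order_trans in \<open>fastforce simp del: abs_of_nonneg\<close>)
  qed measurable
  have ib: "integrable M (\<lambda>\<omega>. b (Z \<omega>))"
  proof (rule Bochner_Integration.integrable_bound)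
    show "integrable M (\<lambda>\<omega>. Bm * (1 / \<epsilon> + K + 2 * \<bar>Z \<omega>\<bar>))" using Z1 by simp
    show "AE \<omega> in M. norm (b (Z \<omega>)) \<le> norm (Bm * (1 / \<epsilon> + K + 2 * \<bar>Z \<omega>\<bar>))"
      by (rule AE_I2) (metis b_bd abs_ge_self order_trans real_norm_def)
  qed measurable
  have \<xi>Y: "expectation (\<lambda>\<omega>. g (Z \<omega>) * \<xi> \<omega>) = 0" "integrable M (\<lambda>\<omega>. g (Z \<omega>) * \<xi> \<omega>)"
    "expectation (\<lambda>\<omega>. p (Z \<omega>) * (\<xi> \<omega>)\<^sup>2) = expectation (\<lambda>\<omega>. p (Z \<omega>)) * (V * h)"
    "integrable M (\<lambda>\<omega>. p (Z \<omega>) * (\<xi> \<omega>)\<^sup>2)"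
  proof -
    have cg: "integrable M (\<lambda>\<omega>. u (\<xi> \<omega>)) = integrable M (\<lambda>\<omega>. u (f (Y \<omega>)))"
      "expectation (\<lambda>\<omega>. u (\<xi> \<omega>)) = expectation (\<lambda>\<omega>. u (f (Y \<omega>)))" for u :: "real \<Rightarrow> real"
      by (auto intro!: Bochner_Integration.integrable_cong Bochner_Integration.integral_cong simp: \<xi>)
    have cg': "integrable M (\<lambda>\<omega>. v (Z \<omega>) * u (\<xi> \<omega>)) = integrable M (\<lambda>\<omega>. v (Z \<omega>) * u (f (Y \<omega>)))"
      "expectation (\<lambda>\<omega>. v (Z \<omega>) * u (\<xi> \<omega>)) = expectation (\<lambda>\<omega>. v (Z \<omega>) * u (f (Y \<omega>)))" for u v :: "real \<Rightarrow> real"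
      by (auto intro!: Bochner_Integration.integrable_cong Bochner_Integration.integral_cong simp: \<xi>)
    have f2: "(\<lambda>x. (f x)\<^sup>2) \<in> borel_measurable S" using f by measurable
    have gG: "(\<lambda>\<omega>. g (Z \<omega>)) \<in> borel_measurable G" "(\<lambda>\<omega>. p (Z \<omega>)) \<in> borel_measurable G" by measurable
    note A = indep_set_product[OF G Y ind gG(1) f ig]
    note B = indep_set_product[OF G Y ind gG(2) f2 ip]
    show "expectation (\<lambda>\<omega>. g (Z \<omega>) * \<xi> \<omega>) = 0" "integrable M (\<lambda>\<omega>. g (Z \<omega>) * \<xi> \<omega>)"
      using A \<xi>1 m1 cg[of "\<lambda>x. x"] cg'[of g "\<lambda>x. x"] by auto
    show "expectation (\<lambda>\<omega>. p (Z \<omega>) * (\<xi> \<omega>)\<^sup>2) = expectation (\<lambda>\<omega>. p (Z \<omega>)) * (V * h)"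
      "integrable M (\<lambda>\<omega>. p (Z \<omega>) * (\<xi> \<omega>)\<^sup>2)"
      using B m2 cg[of "\<lambda>x. x\<^sup>2"] cg'[of p "\<lambda>x. x\<^sup>2"] by auto
  qed
  let ?c = "?P * (h * Bm)\<^sup>2" and ?d = "(h * Bm) ^ 3"
  let ?r = "\<lambda>\<omega>. lyapunov K \<epsilon> (Z \<omega>) + g (Z \<omega>) * \<xi> \<omega> - p (Z \<omega>) * (\<xi> \<omega>)\<^sup>2 + h * b (Z \<omega>) - ?c - 64 / \<epsilon> ^ 3 * (\<bar>\<xi> \<omega>\<bar> ^ 3 + ?d)"
  have lZ: "integrable M (\<lambda>\<omega>. lyapunov K \<epsilon> (Z \<omega>))" by (rule lyap_int[OF ZM Z1 Z2])
  have lZ': "integrable M (\<lambda>\<omega>. lyapunov K \<epsilon> (Z' \<omega>))" by (rule lyap_int[OF Z'M Z'1 Z'2])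
  have d0: "0 \<le> ?d" "0 \<le> ?c" using h Bm by auto
  have "expectation ?r \<le> expectation (\<lambda>\<omega>. lyapunov K \<epsilon> (Z' \<omega>))"
  proof (rule integral_mono)
    show "integrable M ?r" using lZ \<xi>Y ib m3(1) by simp
    fix \<omega>
    show "?r \<omega> \<le> lyapunov K \<epsilon> (Z' \<omega>)"
    proof (cases "Z \<omega> \<le> \<epsilon>")
      case True
      have "0 \<le> 64 / \<epsilon> ^ 3 * (\<bar>\<xi> \<omega>\<bar> ^ 3 + ?d)" using d0(1) \<epsilon> by simp
      moreover have "Z' \<omega> = Z \<omega>" "g (Z \<omega>) = 0" "p (Z \<omega>) = 0" "b (Z \<omega>) = 0"
        using True unfolding Z'_def chain_step_def g_def p_def b_def by simp_all
      ultimately show ?thesis using d0(2) by (simp only: mult_zero_left mult_zero_right)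
    next
      case False
      then have "\<epsilon> < Z \<omega>" by simp
      from lyapunov_step[OF \<epsilon> this h less_imp_le[OF \<kappa>] C refl refl Bm_def, of K "\<xi> \<omega>"]
      show ?thesis using False unfolding Z'_def chain_step_def g_def p_def b_def
        by (simp add: mult.assoc)
    qed
  qed (rule lZ')
  moreover have "expectation ?r = expectation (\<lambda>\<omega>. lyapunov K \<epsilon> (Z \<omega>)) + h * (expectation (\<lambda>\<omega>. b (Z \<omega>)) - V * expectation (\<lambda>\<omega>. p (Z \<omega>)))
      - ?c - 64 / \<epsilon> ^ 3 * (expectation (\<lambda>\<omega>. \<bar>\<xi> \<omega>\<bar> ^ 3) + ?d)"
    using lZ \<xi>Y ib m3(1) by (simp add: prob_space algebra_simps)
  moreover have "- (\<bar>V\<bar> + C\<^sup>2 / \<kappa> + 2 * \<kappa>) \<le> expectation (\<lambda>\<omega>. b (Z \<omega>)) - V * expectation (\<lambda>\<omega>. p (Z \<omega>))"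
  proof -
    \<comment> \<open>The absolute value of \<open>V\<close> makes the left-hand side nonpositive,
      so it is also a bound in the stopped region, where the right-hand side is 0.\<close>
    have "- (\<bar>V\<bar> + C\<^sup>2 / \<kappa> + 2 * \<kappa>) \<le> b z - V * p z" for z
    proof (cases "z \<le> \<epsilon>")
      case True
      have "0 \<le> C\<^sup>2 / \<kappa>" using \<kappa> by simp
      moreover have "b z - V * p z = 0" unfolding b_def p_def using True by simp
      ultimately show ?thesis using \<kappa> by linarith
    next
      case False
      then have "0 < z" using \<epsilon> by simp
      from lyapunov_generator[OF this \<kappa> C V] show ?thesis unfolding b_def p_def K_def using False by simp
    qed
    then have "expectation (\<lambda>\<omega>. - (\<bar>V\<bar> + C\<^sup>2 / \<kappa> + 2 * \<kappa>)) \<le> expectation (\<lambda>\<omega>. b (Z \<omega>) - V * p (Z \<omega>))"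
      using ib ip by (intro integral_mono) auto
    then show ?thesis using ib ip by (simp add: prob_space)
  qed
  then have "h * - (\<bar>V\<bar> + C\<^sup>2 / \<kappa> + 2 * \<kappa>) \<le> h * (expectation (\<lambda>\<omega>. b (Z \<omega>)) - V * expectation (\<lambda>\<omega>. p (Z \<omega>)))"
    using h by (rule mult_left_mono)
  moreover have "64 / \<epsilon> ^ 3 * (expectation (\<lambda>\<omega>. \<bar>\<xi> \<omega>\<bar> ^ 3) + ?d) \<le> 64 / \<epsilon> ^ 3 * (R + ?d)"
    using m3(2) \<epsilon> by (intro mult_left_mono) auto
  ultimately have "expectation (\<lambda>\<omega>. lyapunov K \<epsilon> (Z \<omega>)) - h * (\<bar>V\<bar> + C\<^sup>2 / \<kappa> + 2 * \<kappa>) - (?c + 64 / \<epsilon> ^ 3 * (R + ?d))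
      \<le> expectation (\<lambda>\<omega>. lyapunov K \<epsilon> (Z' \<omega>))" by linarith
  then show "expectation (\<lambda>\<omega>. lyapunov (C / \<kappa>) \<epsilon> (Z \<omega>)) - h * (\<bar>V\<bar> + C\<^sup>2 / \<kappa> + 2 * \<kappa>)
      - step_error \<kappa> C \<epsilon> h R
      \<le> expectation (\<lambda>\<omega>. lyapunov (C / \<kappa>) \<epsilon> (chain_step \<kappa> C \<epsilon> h (Z \<omega>) (\<xi> \<omega>)))"
    unfolding K_def Bm_def Z'_def .
  show "integrable M (\<lambda>\<omega>. (chain_step \<kappa> C \<epsilon> h (Z \<omega>) (\<xi> \<omega>))\<^sup>2)" using Z'2 unfolding Z'_def .
  show "integrable M (\<lambda>\<omega>. lyapunov (C / \<kappa>) \<epsilon> (Z \<omega>))" using lZ unfolding K_def .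
qed

text \<open>Over \<open>n\<close> steps the expectation of the Lyapunov function drops by at most
  \<open>n\<close> times the one-step loss. By \<open>lyapunov_upper\<close> its final value is at
  most a constant plus \<open>ln \<epsilon>\<close> times the probability of collapse, as in
  Markov's inequality.\<close>

lemma chain_prob:
  fixes \<xi> :: "nat \<Rightarrow> 'a \<Rightarrow> real" and f :: "'b \<Rightarrow> real"
  assumes G: "\<And>k. subalgebra M (G k)" "\<And>k. sets (G k) \<subseteq> sets (G (Suc k))"
    and Y: "\<And>k. Y k \<in> measurable M S"
    and ind: "\<And>k. indep_set (sets (G k)) (sets (vimage_algebra (space M) (Y k) S))"
    and f: "f \<in> borel_measurable S" and \<xi>: "\<And>k \<omega>. \<omega> \<in> space M \<Longrightarrow> \<xi> k \<omega> = f (Y k \<omega>)"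
    and \<xi>G: "\<And>k. \<xi> k \<in> borel_measurable (G (Suc k))"
    and m2: "\<And>k. integrable M (\<lambda>\<omega>. (\<xi> k \<omega>)\<^sup>2)" "\<And>k. expectation (\<lambda>\<omega>. (\<xi> k \<omega>)\<^sup>2) = V * h"
    and m1: "\<And>k. expectation (\<xi> k) = 0"
    and m3: "\<And>k. integrable M (\<lambda>\<omega>. \<bar>\<xi> k \<omega>\<bar> ^ 3)" "\<And>k. expectation (\<lambda>\<omega>. \<bar>\<xi> k \<omega>\<bar> ^ 3) \<le> R"
    and \<epsilon>: "0 < \<epsilon>" "\<epsilon> \<le> z" and \<kappa>: "0 < \<kappa>" and C: "0 \<le> C" and h: "0 \<le> h" and V: "V \<le> 2 * \<kappa>"
  shows "(\<lambda>\<omega>. chain \<kappa> C \<epsilon> z h (\<lambda>j. \<xi> j \<omega>) n) \<in> borel_measurable M"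
    and "prob {\<omega> \<in> space M. chain \<kappa> C \<epsilon> z h (\<lambda>j. \<xi> j \<omega>) n \<le> \<epsilon>} * (- ln \<epsilon>)
      \<le> (C / \<kappa> + 1)\<^sup>2 - (ln z + C / \<kappa> * z - z\<^sup>2) + real n * (h * (\<bar>V\<bar> + C\<^sup>2 / \<kappa> + 2 * \<kappa>) + step_error \<kappa> C \<epsilon> h R)"
proof -
  define Z where "Z k \<omega> = chain \<kappa> C \<epsilon> z h (\<lambda>j. \<xi> j \<omega>) k" for k \<omega>
  define \<rho> where "\<rho> = h * (\<bar>V\<bar> + C\<^sup>2 / \<kappa> + 2 * \<kappa>) + step_error \<kappa> C \<epsilon> h R"
  define l where "l = ln z + C / \<kappa> * z - z\<^sup>2"
  let ?L = "\<lambda>k \<omega>. lyapunov (C / \<kappa>) \<epsilon> (Z k \<omega>)"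
  have Z0: "Z 0 = (\<lambda>_. z)" and ZS: "Z (Suc k) = (\<lambda>\<omega>. chain_step \<kappa> C \<epsilon> h (Z k \<omega>) (\<xi> k \<omega>))" for k
    unfolding Z_def chain_Suc by auto
  have main: "Z k \<in> borel_measurable (G k) \<and> integrable M (\<lambda>\<omega>. (Z k \<omega>)\<^sup>2) \<and> l - real k * \<rho> \<le> expectation (?L k)" for k
  proof (induction k)
    case 0
    have "lyapunov (C / \<kappa>) \<epsilon> z = l" unfolding lyapunov_def l_def using \<epsilon> by (simp add: max_def)
    then show ?case unfolding Z0 by (simp add: prob_space)
  next
    case (Suc k)
    note st = chain_step_expectation[where Y = "Y k" and S = S and f = f and \<xi> = "\<xi> k" and Z = "Z k" and G = "G k" and h = h
        and V = V and R = R and \<epsilon> = \<epsilon> and \<kappa> = \<kappa> and C = C,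
        OF G(1) Y ind f \<xi> m2 m1 m3 _ _ \<epsilon>(1) \<kappa> C h V]
    have sub: "subalgebra (G (Suc k)) (G k)"
      using G(1)[of k] G(1)[of "Suc k"] G(2) unfolding subalgebra_def by auto
    have "Z k \<in> borel_measurable (G (Suc k))" using Suc measurable_from_subalg[OF sub] by blast
    then have "Z (Suc k) \<in> borel_measurable (G (Suc k))"
      unfolding ZS chain_step_def using \<xi>G[of k] by measurable
    moreover have "expectation (?L k) - \<rho> \<le> expectation (?L (Suc k))"
      using st(3) Suc unfolding ZS \<rho>_def by (simp only: diff_diff_add)
    then have "l - real (Suc k) * \<rho> \<le> expectation (?L (Suc k))" using Suc by (simp add: algebra_simps)
    ultimately show ?case using st(1) Suc unfolding ZS by blast
  qed
  have ZM [measurable]: "Z k \<in> borel_measurable M" for k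
    using main measurable_from_subalg[OF G(1)] by blast
  show "(\<lambda>\<omega>. chain \<kappa> C \<epsilon> z h (\<lambda>j. \<xi> j \<omega>) n) \<in> borel_measurable M" using ZM[of n] unfolding Z_def .
  have Lint: "integrable M (?L n)"
    using chain_step_expectation(2)[where Y = "Y n" and S = S and f = f and \<xi> = "\<xi> n" and Z = "Z n" and G = "G n" and h = h
        and V = V and R = R and \<epsilon> = \<epsilon> and \<kappa> = \<kappa> and C = C,
        OF G(1) Y ind f \<xi> m2 m1 m3 _ _ \<epsilon>(1) \<kappa> C h V] main[of n] by blast
  have K: "0 \<le> C / \<kappa>" using C \<kappa> by simp
  let ?E = "{\<omega> \<in> space M. Z n \<omega> \<le> \<epsilon>}"
  have E: "?E \<in> sets M" by measurable
  have "expectation (?L n) \<le> expectation (\<lambda>\<omega>. (C / \<kappa> + 1)\<^sup>2 + ln \<epsilon> * indicator ?E \<omega>)"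
  proof (rule integral_mono[OF Lint])
    show "integrable M (\<lambda>\<omega>. (C / \<kappa> + 1)\<^sup>2 + ln \<epsilon> * indicator ?E \<omega>)"
      using E by (intro Bochner_Integration.integrable_add integrable_mult_right) (auto simp: emeasure_eq_measure)
    fix \<omega> assume "\<omega> \<in> space M"
    then show "?L n \<omega> \<le> (C / \<kappa> + 1)\<^sup>2 + ln \<epsilon> * indicator ?E \<omega>"
      using lyapunov_upper[OF \<epsilon>(1) K, of "Z n \<omega>"] by (auto simp: indicator_def)
  qed
  also have "\<dots> = (C / \<kappa> + 1)\<^sup>2 + ln \<epsilon> * prob ?E"
    using E by (simp add: prob_space emeasure_eq_measure)
  finally have "l - real n * \<rho> \<le> (C / \<kappa> + 1)\<^sup>2 + ln \<epsilon> * prob ?E" using main[of n] by linarith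
  then have "prob ?E * (- ln \<epsilon>) \<le> (C / \<kappa> + 1)\<^sup>2 - l + real n * \<rho>" by (simp add: algebra_simps)
  then show "prob {\<omega> \<in> space M. chain \<kappa> C \<epsilon> z h (\<lambda>j. \<xi> j \<omega>) n \<le> \<epsilon>} * (- ln \<epsilon>)
      \<le> (C / \<kappa> + 1)\<^sup>2 - (ln z + C / \<kappa> * z - z\<^sup>2) + real n * (h * (\<bar>V\<bar> + C\<^sup>2 / \<kappa> + 2 * \<kappa>) + step_error \<kappa> C \<epsilon> h R)"
    unfolding Z_def \<rho>_def l_def .
qed

section \<open>Gaussian increments and the limit of zero mesh\<close>

lemma normal_moments:
  assumes X: "distributed M lborel X (normal_density 0 s)" and s: "0 < s"
  shows "integrable M X" "expectation X = 0" "integrable M (\<lambda>\<omega>. (X \<omega>)\<^sup>2)" "expectation (\<lambda>\<omega>. (X \<omega>)\<^sup>2) = s\<^sup>2"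
    "integrable M (\<lambda>\<omega>. \<bar>X \<omega>\<bar> ^ 3)" "expectation (\<lambda>\<omega>. \<bar>X \<omega>\<bar> ^ 3) = 2 * sqrt (2 / pi) * s ^ 3"
proof -
  note di = distributed_integrable[OF X _ normal_density_nonneg] and de = distributed_integral[OF X _ normal_density_nonneg]
  have 1: "has_bochner_integral lborel (\<lambda>x. normal_density 0 s x * x) 0"
    using normal_moment_nz_1[OF s, of 0] .
  have 2: "has_bochner_integral lborel (\<lambda>x. normal_density 0 s x * x\<^sup>2) (s\<^sup>2)"
    using normal_moment_even[OF s, of 0 1] s by (simp add: numeral_2_eq_2)
  have 3: "has_bochner_integral lborel (\<lambda>x. normal_density 0 s x * \<bar>x\<bar> ^ 3) (2 * sqrt (2 / pi) * s ^ 3)"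
    using normal_moment_abs_odd[OF s, of 0 1] by (simp add: numeral_3_eq_3 mult_ac)
  show "integrable M X" using di[of "\<lambda>x. x"] 1 by (simp add: has_bochner_integral_iff)
  show "expectation X = 0" using de[of "\<lambda>x. x"] 1 by (simp add: has_bochner_integral_iff)
  show "integrable M (\<lambda>\<omega>. (X \<omega>)\<^sup>2)" using di[of "\<lambda>x. x\<^sup>2"] 2 by (simp add: has_bochner_integral_iff)
  show "expectation (\<lambda>\<omega>. (X \<omega>)\<^sup>2) = s\<^sup>2" using de[of "\<lambda>x. x\<^sup>2"] 2 by (simp add: has_bochner_integral_iff)
  show "integrable M (\<lambda>\<omega>. \<bar>X \<omega>\<bar> ^ 3)" using di[of "\<lambda>x. \<bar>x\<bar> ^ 3"] 3 by (simp add: has_bochner_integral_iff)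
  show "expectation (\<lambda>\<omega>. \<bar>X \<omega>\<bar> ^ 3) = 2 * sqrt (2 / pi) * s ^ 3"
    using de[of "\<lambda>x. \<bar>x\<bar> ^ 3"] 3 by (simp add: has_bochner_integral_iff)
qed

text \<open>Independence kills the cross term of the square. The 16 is the 4 of
  \<open>abs_add_cube_le\<close> times two absolute third moments, each equal to
  \<open>2 * sqrt (2 / pi) * s ^ 3\<close>.\<close>

lemma normal_difference_moments:
  fixes X :: "nat \<Rightarrow> 'a \<Rightarrow> real"
  assumes X: "\<And>i. i \<in> {k, n} \<Longrightarrow> distributed M lborel (X i) (normal_density 0 s)" and s: "0 < s"
    and ind: "indep_vars (\<lambda>_. borel) X {k, n}" and kn: "k \<noteq> n" and c: "0 \<le> c"
  shows "expectation (\<lambda>\<omega>. c * (X n \<omega> - X k \<omega>)) = 0"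
    "integrable M (\<lambda>\<omega>. (c * (X n \<omega> - X k \<omega>))\<^sup>2)" "expectation (\<lambda>\<omega>. (c * (X n \<omega> - X k \<omega>))\<^sup>2) = 2 * c\<^sup>2 * s\<^sup>2"
    "integrable M (\<lambda>\<omega>. \<bar>c * (X n \<omega> - X k \<omega>)\<bar> ^ 3)"
    "expectation (\<lambda>\<omega>. \<bar>c * (X n \<omega> - X k \<omega>)\<bar> ^ 3) \<le> c ^ 3 * (16 * sqrt (2 / pi)) * s ^ 3"
proof -
  have n: "n \<in> {k, n}" and k: "k \<in> {k, n}" by auto
  note mn = normal_moments[OF X[OF n] s] and mk = normal_moments[OF X[OF k] s]
  show "expectation (\<lambda>\<omega>. c * (X n \<omega> - X k \<omega>)) = 0" using mn mk by simp
  have "integrable M (\<lambda>\<omega>. \<Prod>i\<in>{k, n}. X i \<omega>)" "(\<integral>\<omega>. (\<Prod>i\<in>{k, n}. X i \<omega>) \<partial>M) = (\<Prod>i\<in>{k, n}. expectation (X i))"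
    using mn mk by (intro indep_vars_integrable indep_vars_lebesgue_integral ind; auto)+
  then have prod: "integrable M (\<lambda>\<omega>. X k \<omega> * X n \<omega>)" "expectation (\<lambda>\<omega>. X k \<omega> * X n \<omega>) = 0"
    using kn mn mk by auto
  have sq: "(c * (X n \<omega> - X k \<omega>))\<^sup>2 = c\<^sup>2 * ((X n \<omega>)\<^sup>2 + (X k \<omega>)\<^sup>2 - 2 * (X k \<omega> * X n \<omega>))" for \<omega>
    by (simp add: power2_eq_square algebra_simps)
  show "integrable M (\<lambda>\<omega>. (c * (X n \<omega> - X k \<omega>))\<^sup>2)" unfolding sq using mn mk prod by simp
  show "expectation (\<lambda>\<omega>. (c * (X n \<omega> - X k \<omega>))\<^sup>2) = 2 * c\<^sup>2 * s\<^sup>2" unfolding sq using mn mk prod by simp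
  have cube: "\<bar>c * (X n \<omega> - X k \<omega>)\<bar> ^ 3 \<le> c ^ 3 * (4 * (\<bar>X n \<omega>\<bar> ^ 3 + \<bar>X k \<omega>\<bar> ^ 3))" for \<omega>
    using abs_add_cube_le[of "X n \<omega>" "- X k \<omega>"] c by (simp add: abs_mult power_mult_distrib mult_left_mono)
  have int: "integrable M (\<lambda>\<omega>. c ^ 3 * (4 * (\<bar>X n \<omega>\<bar> ^ 3 + \<bar>X k \<omega>\<bar> ^ 3)))" using mn mk by simp
  have meas [measurable]: "X n \<in> borel_measurable M" "X k \<in> borel_measurable M" using mn mk by auto
  show i: "integrable M (\<lambda>\<omega>. \<bar>c * (X n \<omega> - X k \<omega>)\<bar> ^ 3)"
  proof (rule Bochner_Integration.integrable_bound[OF int])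
    show "AE \<omega> in M. norm (\<bar>c * (X n \<omega> - X k \<omega>)\<bar> ^ 3) \<le> norm (c ^ 3 * (4 * (\<bar>X n \<omega>\<bar> ^ 3 + \<bar>X k \<omega>\<bar> ^ 3)))"
      by (rule AE_I2) (metis abs_ge_zero abs_of_nonneg cube order_trans real_norm_def zero_le_power)
  qed measurable
  have "expectation (\<lambda>\<omega>. \<bar>c * (X n \<omega> - X k \<omega>)\<bar> ^ 3) \<le> expectation (\<lambda>\<omega>. c ^ 3 * (4 * (\<bar>X n \<omega>\<bar> ^ 3 + \<bar>X k \<omega>\<bar> ^ 3)))"
    by (intro integral_mono i int cube)
  also have "\<dots> = c ^ 3 * (16 * sqrt (2 / pi)) * s ^ 3" using mn mk by simp
  finally show "expectation (\<lambda>\<omega>. \<bar>c * (X n \<omega> - X k \<omega>)\<bar> ^ 3) \<le> c ^ 3 * (16 * sqrt (2 / pi)) * s ^ 3" .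
qed

text \<open>The event is the increasing union over \<open>j\<close> of the events that all
  \<open>E m\<close> with \<open>m \<ge> j\<close> occur. Each of these has at most the probability
  of any later \<open>E m\<close>, so its bound follows as \<open>m\<close> tends to infinity, and
  then \<open>j\<close> does.\<close>

lemma eventually_event_prob_le:
  assumes E: "\<And>m. E m \<in> sets M" and r: "r \<longlonglongrightarrow> c" and L: "0 \<le> L"
    and bound: "\<And>m. 0 < m \<Longrightarrow> prob (E m) * L \<le> r m"
  shows "{\<omega> \<in> space M. \<forall>\<^sub>F m in sequentially. \<omega> \<in> E m} \<in> sets M"
    and "prob {\<omega> \<in> space M. \<forall>\<^sub>F m in sequentially. \<omega> \<in> E m} * L \<le> c"
proof -
  define A where "A j = {\<omega> \<in> space M. \<forall>m\<ge>j. \<omega> \<in> E m}" for j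
  have [measurable]: "E m \<in> sets M" for m by (rule E)
  have A: "range A \<subseteq> sets M" unfolding A_def by (auto)
  have eq: "{\<omega> \<in> space M. \<forall>\<^sub>F m in sequentially. \<omega> \<in> E m} = (\<Union>j. A j)"
    unfolding A_def eventually_sequentially by auto
  show "{\<omega> \<in> space M. \<forall>\<^sub>F m in sequentially. \<omega> \<in> E m} \<in> sets M" unfolding eq using A by auto
  have "prob (A j) * L \<le> c" for j
  proof (rule LIMSEQ_le_const[OF r], rule exI[of _ "Suc j"], intro allI impI)
    fix m assume m: "Suc j \<le> m"
    have "prob (A j) \<le> prob (E m)" using m E by (intro finite_measure_mono) (auto simp: A_def)
    then have "prob (A j) * L \<le> prob (E m) * L" using L by (rule mult_right_mono)
    also have "\<dots> \<le> r m" using m by (intro bound) auto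
    finally show "prob (A j) * L \<le> r m" .
  qed
  moreover have "(\<lambda>j. prob (A j) * L) \<longlonglongrightarrow> prob (\<Union>j. A j) * L"
    by (intro tendsto_intros finite_Lim_measure_incseq A) (auto simp: incseq_def A_def)
  ultimately show "prob {\<omega> \<in> space M. \<forall>\<^sub>F m in sequentially. \<omega> \<in> E m} * L \<le> c"
    unfolding eq by (intro LIMSEQ_le_const2[where X = "\<lambda>j. prob (A j) * L"]) auto
qed

end

text \<open>For fixed \<open>\<epsilon>\<close> the mesh tends to 0 first: the errors, whose
  constants blow up as \<open>\<epsilon>\<close> decreases, disappear and leave the bound
  \<open>c0\<close>, which is free of \<open>\<epsilon>\<close>. Only then is \<open>c0\<close>
  divided by \<open>- ln \<epsilon>\<close>, so that collapse at all the levels \<open>e j\<close>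
  has probability 0.\<close>

lemma chain_avoids_zero_AE:
  assumes fp: "filtered_prob_space M F" and ib: "independent_brownian_motions M F N B"
    and kn: "k < n" "n < N" and q: "0 \<le> q" "q < T" and \<sigma>: "0 \<le> \<sigma>" and \<kappa>: "0 < \<kappa>" "2 * \<sigma> \<le> \<kappa>"
    and C: "0 \<le> C" and z: "0 < z"
  shows "AE \<omega> in M. \<exists>\<epsilon>>0. \<not> (collapses \<kappa> C \<epsilon> z T q (\<lambda>t. (x n + sqrt (2 * \<sigma>) * B n t \<omega>) - (x k + sqrt (2 * \<sigma>) * B k t \<omega>)))"
proof -
  interpret prob_space M using fp unfolding filtered_prob_space_def by blast
  define c where "c = sqrt (2 * \<sigma>)"
  have c: "0 \<le> c" "c\<^sup>2 = 2 * \<sigma>" unfolding c_def using \<sigma> by auto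
  define W where "W \<omega> t = (x n + c * B n t \<omega>) - (x k + c * B k t \<omega>)" for \<omega> t
  have sub: "subalgebra M (F t)" for t using fp unfolding filtered_prob_space_def by blast
  have fmono: "s \<le> t \<Longrightarrow> sets (F s) \<subseteq> sets (F t)" for s t
    using fp unfolding filtered_prob_space_def filtration_def by blast
  have bm: "brownian_motion M F (B i)" if "i < N" for i
    using ib that unfolding independent_brownian_motions_def by blast
  have BF: "B i t \<in> borel_measurable (F t)" if "i < N" "0 \<le> t" for i t
    using bm[OF that(1)] that(2) unfolding brownian_motion_def by blast
  have BM: "B i t \<in> borel_measurable M" if "i < N" "0 \<le> t" for i t
    by (rule measurable_from_subalg[OF sub BF[OF that]])
  define f :: "(nat \<Rightarrow> real) \<Rightarrow> real" where "f y = c * (y n - y k)" for y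
  define S where "S = Pi\<^sub>M {..<N} (\<lambda>_::nat. borel :: real measure)"
  have f: "f \<in> borel_measurable S" unfolding f_def S_def
    by (intro borel_measurable_times borel_measurable_diff borel_measurable_const measurable_component_singleton)
      (use kn in auto)
  define Y where "Y s t \<omega> = (\<lambda>i\<in>{..<N}. B i t \<omega> - B i s \<omega>)" for s t \<omega>
  have YM: "Y s t \<in> measurable M S" if "0 \<le> s" "s < t" for s t
    unfolding Y_def S_def using BM that by (intro measurable_restrict) auto
  have Yind: "indep_set (sets (F s)) (sets (vimage_algebra (space M) (Y s t) S))" if "0 \<le> s" "s < t" for s t
    using ib that unfolding independent_brownian_motions_def Y_def S_def by blast
  have fY: "W \<omega> t - W \<omega> s = f (Y s t \<omega>)" for \<omega> s t
    unfolding W_def f_def Y_def using kn by (simp add: algebra_simps)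
  define R where "R h = c ^ 3 * (16 * sqrt (2 / pi)) * sqrt h ^ 3" for h
  have mom: "expectation (\<lambda>\<omega>. W \<omega> t - W \<omega> s) = 0" "integrable M (\<lambda>\<omega>. (W \<omega> t - W \<omega> s)\<^sup>2)"
    "expectation (\<lambda>\<omega>. (W \<omega> t - W \<omega> s)\<^sup>2) = (4 * \<sigma>) * (t - s)"
    "integrable M (\<lambda>\<omega>. \<bar>W \<omega> t - W \<omega> s\<bar> ^ 3)" "expectation (\<lambda>\<omega>. \<bar>W \<omega> t - W \<omega> s\<bar> ^ 3) \<le> R (t - s)"
    if st: "0 \<le> s" "s < t" for s t
  proof -
    have X: "distributed M lborel (\<lambda>\<omega>. B i t \<omega> - B i s \<omega>) (normal_density 0 (sqrt (t - s)))" if "i \<in> {k, n}" for i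
      using bm[of i] that kn st unfolding brownian_motion_def by auto
    have "indep_vars (\<lambda>_. Pi\<^sub>M {0..} (\<lambda>_. borel)) (\<lambda>i \<omega>. \<lambda>t\<in>{0..}. B i t \<omega>) {..<N}"
      using ib unfolding independent_brownian_motions_def by blast
    then have "indep_vars (\<lambda>_. Pi\<^sub>M {0..} (\<lambda>_. borel)) (\<lambda>i \<omega>. \<lambda>t\<in>{0..}. B i t \<omega>) {k, n}"
      by (rule indep_vars_subset) (use kn in auto)
    then have "indep_vars (\<lambda>_. borel) (\<lambda>i \<omega>. (\<lambda>p. p t - p s) (\<lambda>t\<in>{0..}. B i t \<omega>)) {k, n}"

      by (rule indep_vars_compose2, intro borel_measurable_diff measurable_component_singleton) (use st in auto)
    then have ind: "indep_vars (\<lambda>_. borel) (\<lambda>i \<omega>. B i t \<omega> - B i s \<omega>) {k, n}" using st by simp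
    have eq: "W \<omega> t - W \<omega> s = c * ((B n t \<omega> - B n s \<omega>) - (B k t \<omega> - B k s \<omega>))" for \<omega>
      unfolding W_def by (simp add: algebra_simps)
    have st': "0 < sqrt (t - s)" using st by simp
    have kn': "k \<noteq> n" using kn by simp
    note m = normal_difference_moments[where X = "\<lambda>i \<omega>. B i t \<omega> - B i s \<omega>", OF X st' ind kn' c(1)]
    show "expectation (\<lambda>\<omega>. W \<omega> t - W \<omega> s) = 0" "integrable M (\<lambda>\<omega>. (W \<omega> t - W \<omega> s)\<^sup>2)"
      "expectation (\<lambda>\<omega>. (W \<omega> t - W \<omega> s)\<^sup>2) = (4 * \<sigma>) * (t - s)"
      "integrable M (\<lambda>\<omega>. \<bar>W \<omega> t - W \<omega> s\<bar> ^ 3)" "expectation (\<lambda>\<omega>. \<bar>W \<omega> t - W \<omega> s\<bar> ^ 3) \<le> R (t - s)"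
      unfolding eq R_def using m c(2) st by (auto simp: real_sqrt_pow2)
  qed
  define h where "h m = (T - q) / real m" for m :: nat
  have hpos: "0 < h m" "real m * h m = T - q" if "0 < m" for m unfolding h_def using that q by auto
  define E where "E \<epsilon> m = {\<omega> \<in> space M. chain \<kappa> C \<epsilon> z (h m) (grid_increment (W \<omega>) q (h m)) m \<le> \<epsilon>}" for \<epsilon> m
  define r where "r \<epsilon> m = (C / \<kappa> + 1)\<^sup>2 - (ln z + C / \<kappa> * z - z\<^sup>2) + (T - q) * ((\<bar>4 * \<sigma>\<bar> + C\<^sup>2 / \<kappa> + 2 * \<kappa>)
        + ((1 / (2 * \<epsilon>\<^sup>2) + 1) * (h m * (\<kappa> / \<epsilon> + C)\<^sup>2)
          + 64 / \<epsilon> ^ 3 * (c ^ 3 * (16 * sqrt (2 / pi)) * sqrt (h m) + (h m)\<^sup>2 * (\<kappa> / \<epsilon> + C) ^ 3)))" for \<epsilon> m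
  define c0 where "c0 = (C / \<kappa> + 1)\<^sup>2 - (ln z + C / \<kappa> * z - z\<^sup>2) + (T - q) * (\<bar>4 * \<sigma>\<bar> + C\<^sup>2 / \<kappa> + 2 * \<kappa>)"
  have chain: "E \<epsilon> m \<in> sets M" "prob (E \<epsilon> m) * (- ln \<epsilon>) \<le> r \<epsilon> m" if \<epsilon>: "0 < \<epsilon>" "\<epsilon> \<le> z" and m: "0 < m" for \<epsilon> m
  proof -
    let ?s = "\<lambda>k. q + real k * h m"
    have s: "0 \<le> ?s j" "?s j < ?s (Suc j)" "?s (Suc j) - ?s j = h m" for j
      using hpos[OF m] q by (auto simp: algebra_simps)
    have g: "grid_increment (W \<omega>) q (h m) = (\<lambda>j. W \<omega> (?s (Suc j)) - W \<omega> (?s j))" for \<omega>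
      unfolding grid_increment_def by auto
    have GW: "(\<lambda>\<omega>. W \<omega> (?s (Suc j)) - W \<omega> (?s j)) \<in> borel_measurable (F (?s (Suc j)))" for j
    proof -
      have sb: "subalgebra (F (?s (Suc j))) (F (?s j))"
        using sub[of "?s j"] sub[of "?s (Suc j)"] fmono[of "?s j" "?s (Suc j)"] s(2)[of j]
        unfolding subalgebra_def by auto
      have B1: "B i (?s (Suc j)) \<in> borel_measurable (F (?s (Suc j)))" if "i < N" for i
        by (rule BF[OF that s(1)])
      have B2: "B i (?s j) \<in> borel_measurable (F (?s (Suc j)))" if "i < N" for i
        by (rule measurable_from_subalg[OF sb BF[OF that s(1)]])
      show ?thesis unfolding W_def
        by (intro borel_measurable_diff borel_measurable_add borel_measurable_times borel_measurable_const B1 B2)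
          (use kn in auto)
    qed
    have \<kappa>': "4 * \<sigma> \<le> 2 * \<kappa>" using \<kappa> by simp
    note cp = chain_prob[where G = "\<lambda>j. F (?s j)" and Y = "\<lambda>j. Y (?s j) (?s (Suc j))" and S = S and f = f
        and \<xi> = "\<lambda>j \<omega>. W \<omega> (?s (Suc j)) - W \<omega> (?s j)" and V = "4 * \<sigma>" and h = "h m" and R = "R (h m)" and n = m,
        OF sub fmono[OF less_imp_le[OF s(2)]] YM[OF s(1,2)] Yind[OF s(1,2)] f fY GW mom(2)[OF s(1,2)] _ mom(1)[OF s(1,2)] mom(4)[OF s(1,2)] _
        \<epsilon> \<kappa>(1) C less_imp_le[OF hpos(1)[OF m]] \<kappa>']
    have e1: "expectation (\<lambda>\<omega>. (W \<omega> (?s (Suc j)) - W \<omega> (?s j))\<^sup>2) = 4 * \<sigma> * h m"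
      "expectation (\<lambda>\<omega>. \<bar>W \<omega> (?s (Suc j)) - W \<omega> (?s j)\<bar> ^ 3) \<le> R (h m)" for j
      using mom(3,5)[OF s(1,2)[of j]] unfolding s(3) by auto
    have "(\<lambda>\<omega>. chain \<kappa> C \<epsilon> z (h m) (grid_increment (W \<omega>) q (h m)) m) \<in> borel_measurable M"
      unfolding g by (rule cp(1)[OF e1])
    then show "E \<epsilon> m \<in> sets M" unfolding E_def by measurable
    \<comment> \<open>The third moment is of order \<open>h\<close> to the power 3/2, so every term
      contains a factor \<open>h m\<close>, and \<open>real m * h m\<close> is the fixed length
      \<open>T - q\<close>.\<close>
    have sq: "sqrt (h m) ^ 3 = h m * sqrt (h m)" using hpos[OF m] by (simp add: power3_eq_cube)
    have "prob (E \<epsilon> m) * (- ln \<epsilon>) \<le> (C / \<kappa> + 1)\<^sup>2 - (ln z + C / \<kappa> * z - z\<^sup>2) + real m * (h m * (\<bar>4 * \<sigma>\<bar> + C\<^sup>2 / \<kappa> + 2 * \<kappa>)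
        + ((1 / (2 * \<epsilon>\<^sup>2) + 1) * (h m * (\<kappa> / \<epsilon> + C))\<^sup>2 + 64 / \<epsilon> ^ 3 * (R (h m) + (h m * (\<kappa> / \<epsilon> + C)) ^ 3)))"
      unfolding E_def g by (rule cp(2)[OF e1])
    also have "\<dots> = (C / \<kappa> + 1)\<^sup>2 - (ln z + C / \<kappa> * z - z\<^sup>2) + (real m * h m) * ((\<bar>4 * \<sigma>\<bar> + C\<^sup>2 / \<kappa> + 2 * \<kappa>)
        + ((1 / (2 * \<epsilon>\<^sup>2) + 1) * (h m * (\<kappa> / \<epsilon> + C)\<^sup>2)
          + 64 / \<epsilon> ^ 3 * (c ^ 3 * (16 * sqrt (2 / pi)) * sqrt (h m) + (h m)\<^sup>2 * (\<kappa> / \<epsilon> + C) ^ 3)))"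
    proof -
      have "a * (b * u + (P * (b * v)\<^sup>2 + Q * (R' * (b * s) + (b * v) ^ 3)))
        = (a * b) * (u + (P * (b * v\<^sup>2) + Q * (R' * s + b\<^sup>2 * v ^ 3)))" for a b u v P Q R' s :: real
        by (simp add: power2_eq_square power3_eq_cube algebra_simps)
      then show ?thesis unfolding R_def sq by (simp only:)
    qed
    finally show "prob (E \<epsilon> m) * (- ln \<epsilon>) \<le> r \<epsilon> m" unfolding hpos(2)[OF m] r_def .
  qed
  have h0: "h \<longlonglongrightarrow> 0" unfolding h_def by (rule lim_const_over_n)
  have r: "r \<epsilon> \<longlonglongrightarrow> c0" for \<epsilon>
  proof -
    have "r \<epsilon> \<longlonglongrightarrow> (C / \<kappa> + 1)\<^sup>2 - (ln z + C / \<kappa> * z - z\<^sup>2) + (T - q) * ((\<bar>4 * \<sigma>\<bar> + C\<^sup>2 / \<kappa> + 2 * \<kappa>)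
        + ((1 / (2 * \<epsilon>\<^sup>2) + 1) * (0 * (\<kappa> / \<epsilon> + C)\<^sup>2)
          + 64 / \<epsilon> ^ 3 * (c ^ 3 * (16 * sqrt (2 / pi)) * sqrt 0 + 0\<^sup>2 * (\<kappa> / \<epsilon> + C) ^ 3)))"
      unfolding r_def by (intro tendsto_intros h0)
    then show ?thesis unfolding c0_def by simp
  qed
  \<comment> \<open>\<open>Suc m\<close> avoids a chain with no steps, whose mesh would be the value
    0 of a division by zero.\<close>
  define A where "A \<epsilon> = {\<omega> \<in> space M. \<forall>\<^sub>F m in sequentially. \<omega> \<in> E \<epsilon> (Suc m)}" for \<epsilon>
  have A: "A \<epsilon> \<in> sets M" "prob (A \<epsilon>) * (- ln \<epsilon>) \<le> c0" if \<epsilon>: "0 < \<epsilon>" "\<epsilon> \<le> z" "\<epsilon> \<le> 1" for \<epsilon>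
    unfolding A_def
    using eventually_event_prob_le[of "\<lambda>m. E \<epsilon> (Suc m)" "\<lambda>m. r \<epsilon> (Suc m)" c0 "- ln \<epsilon>"]
      chain[OF \<epsilon>(1,2)] LIMSEQ_Suc[OF r] \<epsilon> by auto
  obtain J :: nat where J: "- ln z \<le> real J" using real_arch_simple by blast
  \<comment> \<open>Chosen so that \<open>- ln (e j)\<close> is \<open>real (j + J)\<close>, with
    \<open>J\<close> large enough for all these levels to lie below the start
    \<open>z\<close>.\<close>
  define e where "e j = exp (- real (j + J))" for j :: nat
  have e: "0 < e j" "e j \<le> z" "e j \<le> 1" "- ln (e j) = real (j + J)" for j
  proof -
    have "exp (- real (j + J)) \<le> exp (ln z)" unfolding exp_le_cancel_iff using J by simp
    then show "e j \<le> z" unfolding e_def using z by simp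
  qed (auto simp: e_def)
  define D where "D = (\<Inter>j. A (e j))"
  have D: "D \<in> sets M" unfolding D_def using A(1)[OF e(1-3)] by auto
  have "prob D * real (j + J) \<le> c0" for j
  proof -
    have "prob D \<le> prob (A (e j))" unfolding D_def by (rule finite_measure_mono) (use A(1)[OF e(1-3)] in auto)
    then have "prob D * real (j + J) \<le> prob (A (e j)) * real (j + J)" by (intro mult_right_mono) auto
    also have "\<dots> \<le> c0" using A(2)[OF e(1-3), of j] unfolding e(4) .
    finally show ?thesis .
  qed
  then have "prob D = 0"
  proof (rule_tac ccontr)
    assume h: "\<And>j. prob D * real (j + J) \<le> c0" and "prob D \<noteq> 0"
    then have pos: "0 < prob D" by (simp add: zero_less_measure_iff)
    obtain j :: nat where "c0 / prob D < real j" using reals_Archimedean2 by blast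
    then have "c0 < prob D * real j" using pos by (simp add: field_simps)
    also have "\<dots> \<le> prob D * real (j + J)" using pos by (intro mult_left_mono) auto
    finally show False using h[of j] by simp
  qed
  then have "AE \<omega> in M. \<omega> \<notin> D" using D by (intro AE_not_in) (auto simp: null_sets_def emeasure_eq_measure)
  then show ?thesis
  proof (rule AE_mp, intro AE_I2 impI)
    fix \<omega> assume \<omega>: "\<omega> \<in> space M" "\<omega> \<notin> D"
    then obtain j where j: "\<omega> \<notin> A (e j)" unfolding D_def by auto
    have "\<not> (collapses \<kappa> C (e j) z T q (W \<omega>))"
    proof
      assume "collapses \<kappa> C (e j) z T q (W \<omega>)"
      then have "\<forall>\<^sub>F m in sequentially. \<omega> \<in> E (e j) m" unfolding E_def h_def using \<omega> by simp
      then have "\<forall>\<^sub>F m in sequentially. \<omega> \<in> E (e j) (Suc m)"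
        by (rule eventually_sequentially_Suc[THEN iffD2])
      then show False using j \<omega> unfolding A_def by simp
    qed
    then show "\<exists>\<epsilon>>0. \<not> (collapses \<kappa> C \<epsilon> z T q (\<lambda>t. (x n + sqrt (2 * \<sigma>) * B n t \<omega>) - (x k + sqrt (2 * \<sigma>) * B k t \<omega>)))"
      using e(1)[of j] unfolding W_def c_def by blast
  qed
qed

section \<open>Strong solutions\<close>

lemma measurable_natural_filtration:
  assumes "i < N" "0 \<le> s" "s \<le> t"
  shows "B i s \<in> borel_measurable (natural_filtration M N B t)"
proof (rule measurableI)
  let ?G = "{B i s -` A \<inter> space M | i s A. i < N \<and> 0 \<le> s \<and> s \<le> t \<and> A \<in> sets borel}"
  have sub: "?G \<subseteq> Pow (space M)" by auto
  fix A :: "real set" assume "A \<in> sets borel"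
  then have "B i s -` A \<inter> space M \<in> ?G" using assms by blast
  then show "B i s -` A \<inter> space (natural_filtration M N B t) \<in> sets (natural_filtration M N B t)"
    unfolding natural_filtration_def sets_measure_of[OF sub] space_measure_of[OF sub] by (rule sigma_sets.Basic)
qed simp

lemma subalgebra_augmentation:
  assumes "space (F t) = space M"
  shows "subalgebra (augmentation M F t) (F t)"
proof -
  have sub: "sets (F t) \<union> null_sets M \<subseteq> Pow (space M)"
    using sets.sets_into_space[of _ "F t"] sets.sets_into_space[of _ M] assms by (fastforce dest: null_setsD2)
  show ?thesis
    unfolding subalgebra_def augmentation_def sets_measure_of[OF sub] space_measure_of[OF sub]
    using assms by auto
qed

text \<open>The scheme reads \<open>w\<close> only at grid times up to \<open>t\<close>. This is the
  source of adaptedness of the solution.\<close>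

lemma euler_measurable:
  assumes w: "\<And>i s. i < N \<Longrightarrow> 0 \<le> s \<Longrightarrow> s \<le> t \<Longrightarrow> (\<lambda>\<omega>. w \<omega> i s) \<in> borel_measurable G"
    and b: "\<And>y i. (\<And>j. j < N \<Longrightarrow> (\<lambda>\<omega>. y \<omega> j) \<in> borel_measurable G) \<Longrightarrow> i < N \<Longrightarrow> (\<lambda>\<omega>. b (y \<omega>) i) \<in> borel_measurable G"
    and t: "0 \<le> t" "0 \<le> h" "real n * h \<le> t"
  shows "k \<le> n \<Longrightarrow> i < N \<Longrightarrow> (\<lambda>\<omega>. euler b (w \<omega>) h k i) \<in> borel_measurable G"
proof (induction k arbitrary: i)
  case 0
  then show ?case using w[of i 0] t by simp
next
  case (Suc k)
  have kt: "real j * h \<le> t" if "j \<le> n" for j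
  proof -
    have "real j * h \<le> real n * h" using that t(2) by (intro mult_right_mono) auto
    then show ?thesis using t(3) by linarith
  qed
  have "(\<lambda>\<omega>. w \<omega> i (real (Suc k) * h)) \<in> borel_measurable G" "(\<lambda>\<omega>. w \<omega> i (real k * h)) \<in> borel_measurable G"
    using Suc.prems kt[of "Suc k"] kt[of k] t(2) by (intro w; simp)+
  moreover have "(\<lambda>\<omega>. b (euler b (w \<omega>) h k) i) \<in> borel_measurable G"
    using Suc.prems by (intro b Suc.IH) auto
  moreover have "(\<lambda>\<omega>. euler b (w \<omega>) h k i) \<in> borel_measurable G" using Suc by simp
  ultimately show ?case unfolding euler.simps
    by (intro borel_measurable_add borel_measurable_diff borel_measurable_times borel_measurable_const)
qed

context particles
begin

lemma U'_continuous: "continuous_on UNIV U'"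
  unfolding continuous_on_iff
proof (intro ballI allI impI)
  fix x e :: real assume e: "0 < e"
  show "\<exists>d>0. \<forall>x'\<in>UNIV. dist x' x < d \<longrightarrow> dist (U' x') (U' x) < e"
  proof (intro exI[of _ "e / (L + 1)"] conjI ballI impI)
    show "0 < e / (L + 1)" using e L_nonneg by simp
    fix y assume "dist y x < e / (L + 1)"
    then have "(L + 1) * \<bar>y - x\<bar> < e" using L_nonneg by (simp add: dist_real_def field_simps)
    moreover have "L * \<bar>y - x\<bar> \<le> (L + 1) * \<bar>y - x\<bar>" by (intro mult_right_mono) auto
    ultimately show "dist (U' y) (U' x) < e" using U'_lipschitz[of y x] by (simp add: dist_real_def)
  qed
qed

lemma tdrift_measurable:
  assumes "\<And>j. j < N \<Longrightarrow> (\<lambda>\<omega>. y \<omega> j) \<in> borel_measurable G" "i < N"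
  shows "(\<lambda>\<omega>. tdrift \<delta> (y \<omega>) i) \<in> borel_measurable G"
proof -
  have U: "U' \<in> borel_measurable borel" by (rule borel_measurable_continuous_onI[OF U'_continuous])
  have P: "phi \<delta> \<in> borel_measurable borel" unfolding phi_def by measurable
  show ?thesis unfolding tdrift_def
    by (intro borel_measurable_add borel_measurable_uminus borel_measurable_times borel_measurable_diff
        borel_measurable_sum borel_measurable_const measurable_compose[OF _ U] measurable_compose[OF _ P] assms)
      (use assms(2) in auto)
qed

text \<open>
  An iterated limit of Euler schemes is adapted without further argument.  Where a limit does not
  exist, \<open>lim\<close> is an arbitrary but still measurable choice.
\<close>

definition limit_solution :: "(nat \<Rightarrow> real \<Rightarrow> real) \<Rightarrow> nat \<Rightarrow> real \<Rightarrow> real" where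
  "limit_solution w i t = lim (\<lambda>m. lim (\<lambda>n. euler (tdrift (1 / real (Suc m))) w (t / real n) n i))"

text \<open>Once \<open>1 / real (Suc m)\<close> is below the smallest gap of \<open>X\<close> on
  \<open>{0..t}\<close>, the inner limit is exactly \<open>X i t\<close>. The outer sequence is
  therefore eventually constant.\<close>

lemma limit_solution_eq:
  assumes "0 \<le> t" "osol t w X" "i < N"
  shows "limit_solution w i t = X i t"
proof -
  obtain \<delta> where \<delta>: "0 < \<delta>" "\<And>s. s \<in> {0..t} \<Longrightarrow> gapped N \<delta> (\<lambda>i. X i s)"
    by (rule osol_gapped[OF assms(1,2)]) blast
  have s: "solves N (drift N U' \<alpha>) t w X" using assms(2) unfolding osol_def by blast
  obtain m0 where m0: "1 / real (Suc m0) < \<delta>" using nat_approx_posE[OF \<delta>(1)] by blast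
  have "lim (\<lambda>n. euler (tdrift (1 / real (Suc m))) w (t / real n) n i) = X i t" if m: "m0 \<le> m" for m
  proof -
    have d: "0 < 1 / real (Suc m)" "1 / real (Suc m) \<le> \<delta>"
    proof -
      have "1 / real (Suc m) \<le> 1 / real (Suc m0)" using m by (intro divide_left_mono) auto
      then show "1 / real (Suc m) \<le> \<delta>" using m0 by linarith
    qed simp
    have g: "gapped N (1 / real (Suc m)) (\<lambda>i. X i s)" if "s \<in> {0..t}" for s
      by (rule gapped_mono[OF \<delta>(2)[OF that] d(2)])
    have "solves N (tdrift (1 / real (Suc m))) t w X"
      using solves_drift_iff_tdrift[of "1 / real (Suc m)" t X w, OF d(1) g] s by blast
    then show ?thesis by (intro limI euler_tendsto[OF _ tdrift_lipschitz[OF d(1)] assms(1,3)])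
  qed
  then have "\<forall>\<^sub>F m in sequentially. lim (\<lambda>n. euler (tdrift (1 / real (Suc m))) w (t / real n) n i) = X i t"
    unfolding eventually_sequentially by blast
  then show ?thesis unfolding limit_solution_def by (intro limI tendsto_eventually)
qed

lemma osol_limit_solution:
  assumes "\<And>T. 0 \<le> T \<Longrightarrow> \<exists>X. osol T w X" "0 \<le> T"
  shows "osol T w (limit_solution w)"
proof -
  obtain X where X: "osol T w X" using assms by blast
  show ?thesis
  proof (rule osol_cong[OF X])
    fix i t assume it: "i < N" "t \<in> {0..T}"
    show "limit_solution w i t = X i t"
      by (rule limit_solution_eq[OF _ osol_subinterval[OF X] it(1)]) (use it in auto)
  qed
qed

lemma limit_solution_measurable:
  assumes w: "\<And>i s. i < N \<Longrightarrow> 0 \<le> s \<Longrightarrow> s \<le> t \<Longrightarrow> (\<lambda>\<omega>. w \<omega> i s) \<in> borel_measurable G" and t: "0 \<le> t" and i: "i < N"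
  shows "(\<lambda>\<omega>. limit_solution (w \<omega>) i t) \<in> borel_measurable G"
  unfolding limit_solution_def
proof (intro borel_measurable_lim_metric)
  fix m n
  have "real n * (t / real n) \<le> t" using t by (cases "n = 0") auto
  then show "(\<lambda>\<omega>. euler (tdrift (1 / real (Suc m))) (w \<omega>) (t / real n) n i) \<in> borel_measurable G"
    using t i by (intro euler_measurable[where N = N and t = t] w tdrift_measurable) auto
qed

lemma osol_drift_integrable:
  assumes X: "osol T w X" and t: "t \<in> {0..T}" and i: "i < N"
  shows "set_integrable lborel {0..t} (\<lambda>s. drift N U' \<alpha> (\<lambda>j. X j s) i)"
    and "X i t = w i t + (LBINT s:{0..t}. drift N U' \<alpha> (\<lambda>j. X j s) i)"
proof -
  have T: "0 \<le> T" using t by simp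
  obtain \<delta> where \<delta>: "0 < \<delta>" "\<And>s. s \<in> {0..T} \<Longrightarrow> gapped N \<delta> (\<lambda>i. X i s)" "solves N (tdrift \<delta>) T w X"
    by (rule osol_gapped[OF T X]) blast
  have s: "solves N (drift N U' \<alpha>) T w X" using X unfolding osol_def by blast
  have "continuous_on {0..T} (\<lambda>s. tdrift \<delta> (\<lambda>j. X j s) i)"
    by (rule sum_lipschitz_continuous[OF tdrift_lipschitz[OF \<delta>(1)] i solvesD(1)[OF \<delta>(3)]])
  then have "continuous_on {0..T} (\<lambda>s. drift N U' \<alpha> (\<lambda>j. X j s) i)"
    by (rule continuous_on_eq) (simp add: drift_eq_tdrift[OF \<delta>(1) \<delta>(2) i])
  then have "continuous_on {0..t} (\<lambda>s. drift N U' \<alpha> (\<lambda>j. X j s) i)"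
    by (rule continuous_on_subset) (use t in auto)
  then show int: "set_integrable lborel {0..t} (\<lambda>s. drift N U' \<alpha> (\<lambda>j. X j s) i)"
    by (rule borel_integrable_atLeastAtMost')
  show "X i t = w i t + (LBINT s:{0..t}. drift N U' \<alpha> (\<lambda>j. X j s) i)"
    unfolding set_borel_integral_eq_integral(2)[OF int] using integral_unique[OF solvesD(2)[OF s i t]] by simp
qed

section \<open>Almost sure global existence and pathwise uniqueness\<close>

text \<open>The exceptional sets are indexed by natural numbers \<open>k\<close>, \<open>n\<close>,
  \<open>C\<close>, \<open>T\<close> and rationals \<open>q\<close>, \<open>z\<close>, so their
  union is null. Off this union and the null sets of the Brownian paths, the deterministic
  \<open>osol_global\<close> applies to each path.\<close>

lemma osol_global_AE:
  assumes x: "strict_mono_on {..<N} x" and fp: "filtered_prob_space M F" and ib: "independent_brownian_motions M F N B"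
    and \<sigma>: "0 \<le> \<sigma>" and \<kappa>: "0 < \<kappa>" "2 * \<sigma> \<le> \<kappa>"
    and rep: "0 < \<eta>" "\<And>d. 0 < d \<Longrightarrow> d \<le> \<eta> \<Longrightarrow> \<kappa> / d \<le> 2 / real N * d powr (- \<alpha>)"
  shows "AE \<omega> in M. (\<forall>i<N. B i 0 \<omega> = 0) \<and> (\<forall>T\<ge>0. \<exists>X. osol T (\<lambda>i t. x i + sqrt (2 * \<sigma>) * B i t \<omega>) X)"
proof -
  let ?w = "\<lambda>\<omega> i t. x i + sqrt (2 * \<sigma>) * B i t \<omega>"
  have bm: "brownian_motion M F (B i)" if "i < N" for i
    using ib that unfolding independent_brownian_motions_def by blast
  have "AE \<omega> in M. \<forall>i\<in>{..<N}. B i 0 \<omega> = 0"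
    by (rule AE_finite_allI) (use bm in \<open>auto simp: brownian_motion_def\<close>)
  moreover have "AE \<omega> in M. \<forall>i\<in>{..<N}. continuous_on {0..} (\<lambda>t. B i t \<omega>)"
    by (rule AE_finite_allI) (use bm in \<open>auto simp: brownian_motion_def\<close>)
  moreover have "AE \<omega> in M. \<forall>k n. \<forall>q\<in>\<rat>. \<forall>C T. \<forall>z\<in>\<rat>. k < n \<longrightarrow> n < N \<longrightarrow> 0 \<le> q \<longrightarrow> q < real T \<longrightarrow> 0 < z \<longrightarrow>
      (\<exists>\<epsilon>>0. \<not> (collapses \<kappa> (real (C::nat)) \<epsilon> z (real T) q (\<lambda>t. ?w \<omega> n t - ?w \<omega> k t)))"
    unfolding AE_all_countable AE_ball_countable[OF countable_rat]
  proof (intro allI ballI)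
    fix k n C T :: nat and q z :: real
    show "AE \<omega> in M. k < n \<longrightarrow> n < N \<longrightarrow> 0 \<le> q \<longrightarrow> q < real T \<longrightarrow> 0 < z \<longrightarrow>
      (\<exists>\<epsilon>>0. \<not> (collapses \<kappa> (real C) \<epsilon> z (real T) q (\<lambda>t. ?w \<omega> n t - ?w \<omega> k t)))"
    proof (cases "k < n \<and> n < N \<and> 0 \<le> q \<and> q < real T \<and> 0 < z")
      case True
      then have h: "k < n" "n < N" "0 \<le> q" "q < real T" "0 < z" by auto
      show ?thesis
        by (rule AE_mp[OF chain_avoids_zero_AE[OF fp ib h(1-4) \<sigma> \<kappa> _ h(5), of "real C" x]]) auto
    qed auto
  qed
  ultimately show ?thesis
  proof eventually_elim
    case (elim \<omega>)
    have w: "continuous_on {0..} (?w \<omega> i)" if "i < N" for i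
      using elim(2) that by (intro continuous_intros) auto
    have w0: "strict_mono_on {..<N} (\<lambda>i. ?w \<omega> i 0)" using x elim(1) unfolding strict_mono_on_def by auto
    have "\<exists>X. osol T (?w \<omega>) X" if T: "0 \<le> T" for T
    proof (rule osol_global[where w = "?w \<omega>" and \<eta> = \<eta> and \<kappa> = \<kappa>, OF w w0 rep _ _ T])
      show "0 \<le> \<kappa>" using \<kappa> by simp
    next
      fix k n C T :: nat and q z :: real
      assume "k < n" "n < N" "q \<in> \<rat>" "0 \<le> q" "q < real T" "z \<in> \<rat>" "0 < z"
      then show "\<exists>\<epsilon>>0. \<not> (collapses \<kappa> (real C) \<epsilon> z (real T) q (\<lambda>t. ?w \<omega> n t - ?w \<omega> k t))"
        using elim(3) by blast
    qed auto
    then show ?case using elim(1) by auto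
  qed
qed

lemma unique_ordered_solution:
  assumes x: "strict_mono_on {..<N} x" and fp: "filtered_prob_space M F" and ib: "independent_brownian_motions M F N B"
    and \<sigma>: "0 \<le> \<sigma>" and \<kappa>: "0 < \<kappa>" "2 * \<sigma> \<le> \<kappa>"
    and rep: "0 < \<eta>" "\<And>d. 0 < d \<Longrightarrow> d \<le> \<eta> \<Longrightarrow> \<kappa> / d \<le> 2 / real N * d powr (- \<alpha>)"
  shows "unique_ordered_strong_solution M F N \<sigma> U' \<alpha> B x"
proof -
  define w where "w \<omega> = (\<lambda>i t. x i + sqrt (2 * \<sigma>) * B i t \<omega>)" for \<omega>
  define X where "X i t \<omega> = limit_solution (w \<omega>) i t" for i t \<omega>
  have good: "AE \<omega> in M. (\<forall>i<N. B i 0 \<omega> = 0) \<and> (\<forall>T\<ge>0. osol T (w \<omega>) (\<lambda>i t. X i t \<omega>))"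
  proof -
    have "AE \<omega> in M. (\<forall>i<N. B i 0 \<omega> = 0) \<and> (\<forall>T\<ge>0. \<exists>X. osol T (\<lambda>i t. x i + sqrt (2 * \<sigma>) * B i t \<omega>) X)"
      by (rule osol_global_AE[OF x fp ib \<sigma> \<kappa> rep(1)]) (rule rep(2))
    then show ?thesis
    proof eventually_elim
      case (elim \<omega>)
      then have "osol T (w \<omega>) (limit_solution (w \<omega>))" if "0 \<le> T" for T
        using that unfolding w_def by (intro osol_limit_solution) auto
      then show ?case using elim unfolding X_def by simp
    qed
  qed
  have ord: "AE \<omega> in M. \<forall>t\<ge>0. (\<lambda>i. X i t \<omega>) \<in> ordered_configurations N"
    using good
  proof eventually_elim
    case (elim \<omega>)
    have "(\<lambda>i. X i t \<omega>) \<in> ordered_configurations N" if t: "0 \<le> t" for t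
    proof -
      have "osol t (w \<omega>) (\<lambda>i t. X i t \<omega>)" using elim t by blast
      then show ?thesis unfolding osol_def ordered_configurations_def using t by auto
    qed
    then show ?case by blast
  qed
  have cont: "continuous_on {0..} f" if "\<And>T. 0 \<le> T \<Longrightarrow> continuous_on {0..T} f" for f :: "real \<Rightarrow> real"
    unfolding continuous_on_eq_continuous_within
  proof
    fix t :: real assume t: "t \<in> {0..}"
    have "continuous (at t within {0..t + 1}) f"
      using that[of "t + 1"] t unfolding continuous_on_eq_continuous_within by auto
    moreover have "at t within {0..t + 1} = at t within {0..}"
      by (rule at_within_nhd[of t "{..<t + 1}"]) auto
    ultimately show "continuous (at t within {0..}) f" by (simp add: continuous_within)
  qed
  have XM: "X i t \<in> borel_measurable (augmentation M (natural_filtration M N B) t)" if it: "i < N" "0 \<le> t" for i t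
  proof -
    have "X i t \<in> borel_measurable (natural_filtration M N B t)"
      unfolding X_def w_def using it
      by (intro limit_solution_measurable borel_measurable_add borel_measurable_times borel_measurable_const
          measurable_natural_filtration) auto
    moreover have "subalgebra (augmentation M (natural_filtration M N B) t) (natural_filtration M N B t)"
      by (rule subalgebra_augmentation) (simp add: natural_filtration_def space_measure_of_conv)
    ultimately show ?thesis using measurable_from_subalg by blast
  qed
  have sol: "strong_solution M N \<sigma> U' \<alpha> B x X"
    unfolding strong_solution_def sde_solution_def
  proof (intro conjI allI impI XM)
    show "AE \<omega> in M. \<forall>i<N. continuous_on {0..} (\<lambda>t. X i t \<omega>)"
      using good
    proof eventually_elim
      case (elim \<omega>)
      have "continuous_on {0..T} (\<lambda>t. X i t \<omega>)" if "i < N" "0 \<le> T" for i T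
      proof -
        have "solves N (drift N U' \<alpha>) T (w \<omega>) (\<lambda>i t. X i t \<omega>)" using elim that unfolding osol_def by blast
        from solvesD(1)[OF this that(1)] show ?thesis .
      qed
      then show ?case using cont by blast
    qed
    have start: "AE \<omega> in M. \<forall>i<N. X i 0 \<omega> = x i"
      using good
    proof eventually_elim
      case (elim \<omega>)
      have "X i 0 \<omega> = x i" if i: "i < N" for i
      proof -
        have "osol 0 (w \<omega>) (\<lambda>i t. X i t \<omega>)" using elim by blast
        then have "solves N (drift N U' \<alpha>) 0 (w \<omega>) (\<lambda>i t. X i t \<omega>)" unfolding osol_def by blast
        from integral_unique[OF solvesD(2)[OF this i, of 0]] have "X i 0 \<omega> = w \<omega> i 0" by simp
        then show ?thesis unfolding w_def using elim i by simp
      qed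
      then show ?case by blast
    qed
    then show "AE \<omega> in M. \<forall>i<N. X i 0 \<omega> = x i" .
    show "AE \<omega> in M. AE s in lborel. 0 \<le> s \<longrightarrow> inj_on (\<lambda>i. X i s \<omega>) {..<N}"
      using ord
    proof eventually_elim
      case (elim \<omega>)
      then show ?case
        by (intro AE_I2) (auto simp: ordered_configurations_def intro: strict_mono_on_imp_inj_on)
    qed
    show "AE \<omega> in M. \<forall>i<N. \<forall>t\<ge>0. set_integrable lborel {0..t} (\<lambda>s. drift N U' \<alpha> (\<lambda>j. X j s \<omega>) i) \<and>
        X i t \<omega> = X i 0 \<omega> + sqrt (2 * \<sigma>) * B i t \<omega> + (LBINT s:{0..t}. drift N U' \<alpha> (\<lambda>j. X j s \<omega>) i)"
      using good start
    proof eventually_elim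
      case (elim \<omega>)
      show ?case
      proof (intro allI impI)
        fix i t assume it: "i < N" "0 \<le> (t::real)"
        have o: "osol t (w \<omega>) (\<lambda>i t. X i t \<omega>)" using elim it by blast
        have t: "t \<in> {0..t}" using it by simp
        have "X i t \<omega> = w \<omega> i t + (LBINT s:{0..t}. drift N U' \<alpha> (\<lambda>j. X j s \<omega>) i)"
          by (rule osol_drift_integrable(2)[OF o t it(1)])
        then show "set_integrable lborel {0..t} (\<lambda>s. drift N U' \<alpha> (\<lambda>j. X j s \<omega>) i) \<and>
          X i t \<omega> = X i 0 \<omega> + sqrt (2 * \<sigma>) * B i t \<omega> + (LBINT s:{0..t}. drift N U' \<alpha> (\<lambda>j. X j s \<omega>) i)"
          using osol_drift_integrable(1)[OF o t it(1)] elim(2) it(1) unfolding w_def by simp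
      qed
    qed
  qed
  \<comment> \<open>Almost every path of \<open>Y\<close> solves the same deterministic equation as
    \<open>X\<close> on each \<open>{0..t}\<close>, so \<open>osol_unique\<close> gives agreement at
    all times outside one null set.\<close>
  have unique: "AE \<omega> in M. \<forall>t\<ge>0. \<forall>i<N. Y i t \<omega> = X i t \<omega>"
    if Y: "sde_solution M (augmentation M F) N \<sigma> U' \<alpha> B x Y" for Y
  proof -
    have "AE \<omega> in M. \<forall>i<N. continuous_on {0..} (\<lambda>t. Y i t \<omega>)" "AE \<omega> in M. \<forall>i<N. Y i 0 \<omega> = x i"
      "AE \<omega> in M. \<forall>i<N. \<forall>t\<ge>0. set_integrable lborel {0..t} (\<lambda>s. drift N U' \<alpha> (\<lambda>j. Y j s \<omega>) i) \<and>
        Y i t \<omega> = Y i 0 \<omega> + sqrt (2 * \<sigma>) * B i t \<omega> + (LBINT s:{0..t}. drift N U' \<alpha> (\<lambda>j. Y j s \<omega>) i)"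
      using Y unfolding sde_solution_def by blast+
    with good show ?thesis
    proof eventually_elim
      case (elim \<omega>)
      show ?case
      proof (intro allI impI)
        fix i t assume it: "0 \<le> (t::real)" "i < N"
        have "solves N (drift N U' \<alpha>) t (w \<omega>) (\<lambda>i t. Y i t \<omega>)"
          unfolding solves_def
        proof (intro conjI allI impI ballI)
          fix i assume i: "i < N"
          show "continuous_on {0..t} (\<lambda>t. Y i t \<omega>)"
            using elim(2) i by (auto intro: continuous_on_subset)
          fix s assume s: "s \<in> {0..t}"
          then have s0: "0 \<le> s" by simp
          have int: "set_integrable lborel {0..s} (\<lambda>s. drift N U' \<alpha> (\<lambda>j. Y j s \<omega>) i)"
            and eq: "Y i s \<omega> = Y i 0 \<omega> + sqrt (2 * \<sigma>) * B i s \<omega> + (LBINT s:{0..s}. drift N U' \<alpha> (\<lambda>j. Y j s \<omega>) i)"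
            using elim(4)[rule_format, OF i s0] by blast+
          have "Y i s \<omega> - w \<omega> i s = integral {0..s} (\<lambda>s. drift N U' \<alpha> (\<lambda>j. Y j s \<omega>) i)"
            using eq elim(3) i unfolding w_def set_borel_integral_eq_integral(2)[OF int] by simp
          then show "((\<lambda>s. drift N U' \<alpha> (\<lambda>j. Y j s \<omega>) i) has_integral (Y i s \<omega> - w \<omega> i s)) {0..s}"
            using integrable_integral[OF set_borel_integral_eq_integral(1)[OF int]] by simp
        qed
        moreover have "osol t (w \<omega>) (\<lambda>i t. X i t \<omega>)" using elim(1) it by blast
        ultimately show "Y i t \<omega> = X i t \<omega>"
          by (intro osol_unique[of t "w \<omega>" "\<lambda>i t. X i t \<omega>" "\<lambda>i t. Y i t \<omega>"]) (use it in auto)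
      qed
    qed
  qed
  show ?thesis unfolding unique_ordered_strong_solution_def
    by (intro exI[of _ X] conjI allI impI sol ord unique)
qed

text \<open>A singularity stronger than \<open>1 / d\<close> exceeds every multiple of it near 0,
  namely as soon as \<open>d powr (\<alpha> - 1)\<close> is at most
  \<open>2 / (\<kappa> * real N)\<close>. This is why \<open>\<sigma>\<close> is unrestricted for
  \<open>\<alpha> > 1\<close>.\<close>

lemma repulsion_dominates:
  assumes \<alpha>: "1 < \<alpha>" and \<kappa>: "0 < \<kappa>"
  obtains \<eta> where "0 < \<eta>" "\<And>d. 0 < d \<Longrightarrow> d \<le> \<eta> \<Longrightarrow> \<kappa> / d \<le> 2 / real N * d powr (- \<alpha>)"
proof -
  define c where "c = 2 / (\<kappa> * real N)"
  have c: "0 < c" unfolding c_def using \<kappa> N by simp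
  show ?thesis
  proof (rule that[of "c powr (1 / (\<alpha> - 1))"])
    show "0 < c powr (1 / (\<alpha> - 1))" using c by simp
    fix d :: real assume d: "0 < d" "d \<le> c powr (1 / (\<alpha> - 1))"
    have "d powr (\<alpha> - 1) \<le> (c powr (1 / (\<alpha> - 1))) powr (\<alpha> - 1)" using d \<alpha> by (intro powr_mono2) auto
    also have "\<dots> = c" using \<alpha> c by (simp add: powr_powr)
    finally have "\<kappa> * d powr (\<alpha> - 1) \<le> \<kappa> * c" using \<kappa> by (intro mult_left_mono) auto
    also have "\<dots> = 2 / real N" unfolding c_def using \<kappa> N by (simp add: field_simps)
    finally have "\<kappa> * d powr (\<alpha> - 1) * d powr (- \<alpha>) \<le> 2 / real N * d powr (- \<alpha>)" by (intro mult_right_mono) auto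
    moreover have "\<kappa> * d powr (\<alpha> - 1) * d powr (- \<alpha>) = \<kappa> / d"
    proof -
      have "d powr (\<alpha> - 1) * d powr (- \<alpha>) = d powr ((\<alpha> - 1) + - \<alpha>)" by (rule powr_add[symmetric])
      also have "\<dots> = 1 / d" using d by (simp add: powr_neg_one)
      finally show ?thesis by (simp add: mult.assoc)
    qed
    ultimately show "\<kappa> / d \<le> 2 / real N * d powr (- \<alpha>)" by simp
  qed
qed

end

theorem theorem2:
  fixes M :: "'a measure" and F :: "real \<Rightarrow> 'a measure"
    and N :: nat and B :: "nat \<Rightarrow> real \<Rightarrow> 'a \<Rightarrow> real" and x :: "nat \<Rightarrow> real"
    and U U' U'' :: "real \<Rightarrow> real" and L_U \<alpha> :: real
  assumes "N \<ge> 2"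
    and "x \<in> ordered_configurations N"
    and "\<And>y. (U has_real_derivative U' y) (at y)"
    and "\<And>y. (U' has_real_derivative U'' y) (at y)"
    and "continuous_on UNIV U''"
    and "\<And>y. \<bar>U'' y\<bar> \<le> L_U"
    and "\<alpha> \<ge> 1"
    and "filtered_prob_space M F"
    and "independent_brownian_motions M F N B"
  shows "(\<alpha> > 1 \<longrightarrow> (\<forall>\<sigma>\<ge>0. unique_ordered_strong_solution M F N \<sigma> U' \<alpha> B x)) \<and>
         (\<alpha> = 1 \<longrightarrow> (\<forall>\<sigma>. 0 \<le> \<sigma> \<and> \<sigma> \<le> 1 / real N \<longrightarrow>
            unique_ordered_strong_solution M F N \<sigma> U' \<alpha> B x))"
proof -
  have "\<bar>U' y - U' z\<bar> \<le> L_U * \<bar>y - z\<bar>" for y z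
    using field_differentiable_bound[of UNIV U' U'' L_U y z] assms(4,6) by simp
  then interpret particles N U' \<alpha> L_U
    using assms(1,7) by unfold_locales auto
  have x: "strict_mono_on {..<N} x" using assms(2) unfolding ordered_configurations_def by simp
  have "unique_ordered_strong_solution M F N \<sigma> U' \<alpha> B x" if \<alpha>: "\<alpha> > 1" and \<sigma>: "0 \<le> \<sigma>" for \<sigma>
  proof -
    \<comment> \<open>The summand 1 keeps \<open>\<kappa>\<close> positive when
      \<open>\<sigma> = 0\<close>.\<close>
    have \<kappa>: "0 < 2 * \<sigma> + 1" "2 * \<sigma> \<le> 2 * \<sigma> + 1" using \<sigma> by auto
    obtain \<eta> where "0 < \<eta>" "\<And>d. 0 < d \<Longrightarrow> d \<le> \<eta> \<Longrightarrow> (2 * \<sigma> + 1) / d \<le> 2 / real N * d powr (- \<alpha>)"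
      by (rule repulsion_dominates[OF \<alpha> \<kappa>(1)]) blast
    then show ?thesis by (rule unique_ordered_solution[OF x assms(8,9) \<sigma> \<kappa>])
  qed
  moreover have "unique_ordered_strong_solution M F N \<sigma> U' \<alpha> B x"
    if "\<alpha> = 1" "0 \<le> \<sigma>" "\<sigma> \<le> 1 / real N" for \<sigma>
  proof (rule unique_ordered_solution[OF x assms(8,9) that(2), of "2 / real N" 1])
    \<comment> \<open>For \<open>\<alpha> = 1\<close> the repulsion equals
      \<open>\<kappa> / d\<close> with \<open>\<kappa> = 2 / real N\<close> at every distance, so
      \<open>\<eta> = 1\<close> is an arbitrary choice, and
      \<open>2 * \<sigma> \<le> \<kappa>\<close> is the hypothesis on
      \<open>\<sigma>\<close>.\<close>
    show "0 < 2 / real N" "2 * \<sigma> \<le> 2 / real N" using assms(1) that(3) by auto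
    show "2 / real N / d \<le> 2 / real N * d powr (- \<alpha>)" if "0 < d" for d
      using that by (simp add: \<open>\<alpha> = 1\<close> powr_minus_divide)
  qed simp
  ultimately show ?thesis by blast
qed

end
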